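(* Let $(M,\omega)$, $J$, $H$, $X$ be as defined in the context, let $0<\gamma<\frac1{48}$, and let $F_t=(J,(1-2t)H+t\gamma X)$. At $t=\frac12$, the system $F_{\frac12}:M\to\mathbb{R}^2$ has precisely two focus-focus fibres, each of which contains precisely two focus-focus points, so that each of these two fibres has the shape of a double pinched torus. Moreover, $F_{\frac12}^{-1}(1,0)$ can be parametrised as $$\left\{\left[\sqrt2,\sqrt{6-r^2},\sqrt{6-r^2},\sqrt{8-r^2},2,\sqrt{2+r^2},\pm r i e^{-i\theta},re^{i\theta}\right]\in M\ \middle|\ \theta\in[0,2\pi[,\ r\in[0,\sqrt6]\right\},$$ where both choices of sign are included.
   Context: Construction of $(M,\omega)$. On $\mathbb{C}^8$ with coordinates $z_k=x_k+iy_k$ take the symplectic form $\omega_{st}=-\frac{i}{2}\sum_{k=1}^8 dz_k\wedge d\bar z_k$. Let $W\subset\mathbb{C}^8$ be the set of points satisfying (A) $|z_1|^2+|z_5|^2=6$, (B) $|z_2|^2+|z_5|^2+|z_7|^2=10$, (C) $|z_3|^2+|z_7|^2=6$, (D) $|z_4|^2-|z_5|^2+|z_7|^2=4$, (E) $|z_5|^2-|z_6|^2+|z_7|^2=2$, (F) $|z_5|^2-|z_7|^2+|z_8|^2=4$. The torus $N\simeq\mathbb{T}^6=(\mathbb{R}/2\pi\mathbb{Z})^6$ acts on $\mathbb{C}^8$ by $$(t,z)\mapsto(e^{it_1}z_1,e^{it_2}z_2,e^{it_3}z_3,e^{it_4}z_4,e^{i(t_1+t_2-t_4-t_5+t_6)}z_5,e^{it_5}z_6,e^{i(t_2+t_3+t_4-t_5-t_6)}z_7,e^{it_6}z_8).$$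 $W$ is a regular level set of a momentum map of this action, $N$ acts freely on $W$, and $M:=W/N$ with quotient map $\tau:W\to M$ is a $4$-dimensional compact connected manifold carrying the unique symplectic form $\omega$ with $\tau^*\omega=\kappa^*\omega_{st}$, where $\kappa:W\hookrightarrow\mathbb{C}^8$ is the inclusion. Points of $M$ are written $[z]=[z_1,\dots,z_8]$. Functions on $M$ (well defined since $N$-invariant): $J([z])=\frac12|z_1|^2$, $H([z])=\frac12|z_3|^2$, $X([z])=\mathrm{Re}(\overline{z_2}\,\overline{z_3}\,\overline{z_4}\,z_6z_7z_8)$. A fixed point of $f=(f_1,f_2)$ is a point $p$ where $df(p)=0$. It is nondegenerate iff $d^2f_1(p),d^2f_2(p)$ are linearly independent and some linear combination of $\omega_p^{-1}d^2f_1(p),\omega_p^{-1}d^2f_2(p)$ has four distinct eigenvalues; it is focus-focus if these are $\pm\alpha\pm i\beta$ with $\alpha,\beta\in\mathbb{R}\setminus\{0\}$. A focus-focus fibre is a fibre of the momentum map containing a focus-focus point. A double pinched torus (at two given points) is a chain of two spheres intersecting each other transversally exactly in the two given points (here the two focus-focus points). *)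

theory Defs
  imports "HOL-Analysis.Analysis"
begin

section \<open>The level set, the torus action and the quotient\<close>

text \<open>Coordinates on \<open>complex ^ 8\<close> are \<open>z $ 1, \<dots>, z $ 8\<close> (in the index type, \<open>8 = 0\<close>).
  The form is \<open>- (\<i>/2) \<Sum>k. dz\<^sub>k \<and> d(cnj z\<^sub>k)\<close> evaluated on a pair of vectors; this sum is real.\<close>

definition omega_st :: "complex ^ 8 \<Rightarrow> complex ^ 8 \<Rightarrow> real" where
  "omega_st u v = Re (- (\<i> / 2) * (\<Sum>k\<in>UNIV. u $ k * cnj (v $ k) - v $ k * cnj (u $ k)))"

definition level_W :: "(complex ^ 8) set" where
  "level_W = {z.
     (cmod (z $ 1))\<^sup>2 + (cmod (z $ 5))\<^sup>2 = 6 \<and>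
     (cmod (z $ 2))\<^sup>2 + (cmod (z $ 5))\<^sup>2 + (cmod (z $ 7))\<^sup>2 = 10 \<and>
     (cmod (z $ 3))\<^sup>2 + (cmod (z $ 7))\<^sup>2 = 6 \<and>
     (cmod (z $ 4))\<^sup>2 - (cmod (z $ 5))\<^sup>2 + (cmod (z $ 7))\<^sup>2 = 4 \<and>
     (cmod (z $ 5))\<^sup>2 - (cmod (z $ 6))\<^sup>2 + (cmod (z $ 7))\<^sup>2 = 2 \<and>
     (cmod (z $ 5))\<^sup>2 - (cmod (z $ 7))\<^sup>2 + (cmod (z $ 8))\<^sup>2 = 4}"

text \<open>The torus is represented by its universal cover \<open>real ^ 6\<close>, which has the same orbits.\<close>

definition phase :: "real ^ 6 \<Rightarrow> real ^ 8" where
  "phase t = vector [t $ 1, t $ 2, t $ 3, t $ 4, t $ 1 + t $ 2 - t $ 4 - t $ 5 + t $ 6, t $ 5,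
     t $ 2 + t $ 3 + t $ 4 - t $ 5 - t $ 6, t $ 6]"

definition act :: "real ^ 6 \<Rightarrow> complex ^ 8 \<Rightarrow> complex ^ 8" where
  "act t z = (\<chi> k. cis (phase t $ k) * z $ k)"

definition tau :: "complex ^ 8 \<Rightarrow> (complex ^ 8) set" where
  "tau z = range (\<lambda>t. act t z)"

definition mfd :: "(complex ^ 8) set set" where
  "mfd = tau ` level_W"

text \<open>Tangent space at \<open>z\<close> of the orbit through \<open>z\<close>: all velocities at \<open>s = 0\<close> of the curves
  \<open>s \<mapsto> act (s *\<^sub>R t) z\<close>.\<close>

definition orbit_tangent :: "complex ^ 8 \<Rightarrow> (complex ^ 8) set" where
  "orbit_tangent z = range (\<lambda>t. \<chi> k. \<i> * complex_of_real (phase t $ k) * z $ k)"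

text \<open>The function on the quotient induced by an invariant function on \<open>complex ^ 8\<close>.\<close>

definition descend :: "(complex ^ 8 \<Rightarrow> real) \<Rightarrow> (complex ^ 8) set \<Rightarrow> real" where
  "descend h p = the_elem (h ` p)"

definition J_fun :: "(complex ^ 8) set \<Rightarrow> real" where
  "J_fun = descend (\<lambda>z. (cmod (z $ 1))\<^sup>2 / 2)"

definition H_fun :: "(complex ^ 8) set \<Rightarrow> real" where
  "H_fun = descend (\<lambda>z. (cmod (z $ 3))\<^sup>2 / 2)"

definition X_fun :: "(complex ^ 8) set \<Rightarrow> real" where
  "X_fun = descend (\<lambda>z. Re (cnj (z $ 2) * cnj (z $ 3) * cnj (z $ 4) * z $ 6 * z $ 7 * z $ 8))"

definition F_sys :: "real \<Rightarrow> real \<Rightarrow> (complex ^ 8) set \<Rightarrow> real \<times> real" where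
  "F_sys \<gamma> t p = (J_fun p, (1 - 2 * t) * H_fun p + t * \<gamma> * X_fun p)"

lemma vector_8 [simp]:
  "(vector [a, b, c, d, e, f, g, h] :: 'a::zero ^ 8) $ 1 = a"
  "(vector [a, b, c, d, e, f, g, h] :: 'a::zero ^ 8) $ 2 = b"
  "(vector [a, b, c, d, e, f, g, h] :: 'a::zero ^ 8) $ 3 = c"
  "(vector [a, b, c, d, e, f, g, h] :: 'a::zero ^ 8) $ 4 = d"
  "(vector [a, b, c, d, e, f, g, h] :: 'a::zero ^ 8) $ 5 = e"
  "(vector [a, b, c, d, e, f, g, h] :: 'a::zero ^ 8) $ 6 = f"
  "(vector [a, b, c, d, e, f, g, h] :: 'a::zero ^ 8) $ 7 = g"
  "(vector [a, b, c, d, e, f, g, h] :: 'a::zero ^ 8) $ 8 = h"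
  by (simp_all add: vector_def)

lemma descend_tau:
  assumes "\<And>t. h (act t z) = h z"
  shows "descend h (tau z) = h z"
proof -
  have "h ` tau z = {h z}"
    by (simp add: tau_def image_image assms)
  then show ?thesis
    by (simp add: descend_def)
qed

lemma J_fun_tau: "J_fun (tau z) = (cmod (z $ 1))\<^sup>2 / 2"
  unfolding J_fun_def by (subst descend_tau) (auto simp: act_def norm_mult)

lemma H_fun_tau: "H_fun (tau z) = (cmod (z $ 3))\<^sup>2 / 2"
  unfolding H_fun_def by (subst descend_tau) (auto simp: act_def norm_mult)

lemma X_fun_tau:
  "X_fun (tau z) = Re (cnj (z $ 2) * cnj (z $ 3) * cnj (z $ 4) * z $ 6 * z $ 7 * z $ 8)"
  unfolding X_fun_def
proof (subst descend_tau)
  fix t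
  let ?c = "\<lambda>k. cis (phase t $ k)"
  have c: "cnj (?c 2) * cnj (?c 3) * cnj (?c 4) * ?c 6 * ?c 7 * ?c 8 = 1"
    by (simp add: phase_def cis_cnj cis_mult)
  have "cnj (act t z $ 2) * cnj (act t z $ 3) * cnj (act t z $ 4)
        * act t z $ 6 * act t z $ 7 * act t z $ 8
      = (cnj (?c 2) * cnj (?c 3) * cnj (?c 4) * ?c 6 * ?c 7 * ?c 8)
        * (cnj (z $ 2) * cnj (z $ 3) * cnj (z $ 4) * z $ 6 * z $ 7 * z $ 8)"
    by (simp only: act_def vec_lambda_beta complex_cnj_mult mult_ac)
  then show "Re (cnj (act t z $ 2) * cnj (act t z $ 3) * cnj (act t z $ 4)
        * act t z $ 6 * act t z $ 7 * act t z $ 8)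
      = Re (cnj (z $ 2) * cnj (z $ 3) * cnj (z $ 4) * z $ 6 * z $ 7 * z $ 8)"
    by (simp only: c mult_1_left)
qed (rule refl)


section \<open>Smooth charts of the quotient\<close>

text \<open>\<open>C_k k S f\<close>: \<open>f\<close> is \<open>k\<close> times continuously differentiable on the open set \<open>S\<close>.\<close>

primrec C_k :: "nat \<Rightarrow> 'a::euclidean_space set \<Rightarrow> ('a \<Rightarrow> 'b::real_normed_vector) \<Rightarrow> bool" where
  "C_k 0 S f \<longleftrightarrow> continuous_on S f"
| "C_k (Suc k) S f \<longleftrightarrow>
     (\<forall>x\<in>S. f differentiable (at x)) \<and> (\<forall>v. C_k k S (\<lambda>x. frechet_derivative f (at x) v))"

definition smooth_on :: "'a::euclidean_space set \<Rightarrow> ('a \<Rightarrow> 'b::real_normed_vector) \<Rightarrow> bool" where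
  "smooth_on S f \<longleftrightarrow> open S \<and> (\<forall>k. C_k k S f)"

text \<open>The smooth structure of the quotient is the one making \<open>tau\<close> a submersion. Since the action
  on \<open>level_W\<close> is free, its charts are the inverses of the maps \<open>tau \<circ> \<sigma>\<close>, where
  \<open>\<sigma>\<close> maps an open subset of \<open>real ^ 4\<close> smoothly into \<open>level_W\<close>, transversally to the orbits
  (so that \<open>tau \<circ> \<sigma>\<close> is a local diffeomorphism, \<open>10 = 4 + 6\<close> being the dimension of
  \<open>level_W\<close>) and meeting each orbit at most once.\<close>

definition slice_chart :: "(real ^ 4) set \<Rightarrow> (real ^ 4 \<Rightarrow> complex ^ 8) \<Rightarrow> bool" where
  "slice_chart U \<sigma> \<longleftrightarrow>
     smooth_on U \<sigma> \<and> \<sigma> ` U \<subseteq> level_W \<and> inj_on (tau \<circ> \<sigma>) U \<and>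
     (\<forall>u\<in>U. \<forall>v. frechet_derivative \<sigma> (at u) v \<in> orbit_tangent (\<sigma> u) \<longrightarrow> v = 0)"

definition chart_at ::
    "(complex ^ 8) set \<Rightarrow> (real ^ 4) set \<Rightarrow> (real ^ 4 \<Rightarrow> complex ^ 8) \<Rightarrow> real ^ 4 \<Rightarrow> bool" where
  "chart_at p U \<sigma> u \<longleftrightarrow> slice_chart U \<sigma> \<and> u \<in> U \<and> tau (\<sigma> u) = p"

text \<open>Matrix of the reduced form in the coordinates given by \<open>\<sigma>\<close>: the defining property of
  \<open>\<omega>\<close>, that its pullback along \<open>tau\<close> is the restriction of \<open>omega_st\<close> to \<open>level_W\<close>, says that
  its pullback along \<open>tau \<circ> \<sigma>\<close> is the pullback of \<open>omega_st\<close> along \<open>\<sigma>\<close>.\<close>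

definition omega_mat :: "(real ^ 4 \<Rightarrow> complex ^ 8) \<Rightarrow> real ^ 4 \<Rightarrow> real ^ 4 ^ 4" where
  "omega_mat \<sigma> u = (\<chi> i j. omega_st (frechet_derivative \<sigma> (at u) (axis i 1))
                                  (frechet_derivative \<sigma> (at u) (axis j 1)))"

definition hessian :: "(real ^ 4 \<Rightarrow> real) \<Rightarrow> real ^ 4 \<Rightarrow> real ^ 4 ^ 4" where
  "hessian h u = (\<chi> i j. frechet_derivative
      (\<lambda>x. frechet_derivative h (at x) (axis j 1)) (at u) (axis i 1))"


section \<open>Focus-focus points\<close>

text \<open>The conditions below do not depend on the chart used to express them (the Hessian of a
  function is a bilinear form on the tangent space at points where its differential vanishes), so
  requiring them in some chart or in every chart is the same.\<close>

definition fixed_point :: "((complex ^ 8) set \<Rightarrow> real \<times> real) \<Rightarrow> (complex ^ 8) set \<Rightarrow> bool" where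
  "fixed_point f p \<longleftrightarrow>
     (\<exists>U \<sigma> u. chart_at p U \<sigma> u \<and> ((\<lambda>x. f (tau (\<sigma> x))) has_derivative (\<lambda>_. 0)) (at u))"

definition eigenvalues :: "real ^ 4 ^ 4 \<Rightarrow> complex set" where
  "eigenvalues A = {l. \<exists>v::complex ^ 4. v \<noteq> 0 \<and> (\<chi> i j. complex_of_real (A $ i $ j)) *v v = l *s v}"

definition d2_1 :: "((complex ^ 8) set \<Rightarrow> real \<times> real) \<Rightarrow> (real ^ 4 \<Rightarrow> complex ^ 8) \<Rightarrow> real ^ 4 \<Rightarrow> real ^ 4 ^ 4" where
  "d2_1 f \<sigma> u = hessian (\<lambda>x. fst (f (tau (\<sigma> x)))) u"

definition d2_2 :: "((complex ^ 8) set \<Rightarrow> real \<times> real) \<Rightarrow> (real ^ 4 \<Rightarrow> complex ^ 8) \<Rightarrow> real ^ 4 \<Rightarrow> real ^ 4 ^ 4" where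
  "d2_2 f \<sigma> u = hessian (\<lambda>x. snd (f (tau (\<sigma> x)))) u"

definition lin_comb ::
    "((complex ^ 8) set \<Rightarrow> real \<times> real) \<Rightarrow> (real ^ 4 \<Rightarrow> complex ^ 8) \<Rightarrow> real ^ 4 \<Rightarrow> real \<Rightarrow> real \<Rightarrow> real ^ 4 ^ 4" where
  "lin_comb f \<sigma> u a b =
     a *\<^sub>R (matrix_inv (omega_mat \<sigma> u) ** d2_1 f \<sigma> u)
   + b *\<^sub>R (matrix_inv (omega_mat \<sigma> u) ** d2_2 f \<sigma> u)"

definition nondegenerate_at ::
    "((complex ^ 8) set \<Rightarrow> real \<times> real) \<Rightarrow> (real ^ 4 \<Rightarrow> complex ^ 8) \<Rightarrow> real ^ 4 \<Rightarrow> real \<Rightarrow> real \<Rightarrow> bool" where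
  "nondegenerate_at f \<sigma> u a b \<longleftrightarrow>
     (\<forall>c d. c *\<^sub>R d2_1 f \<sigma> u + d *\<^sub>R d2_2 f \<sigma> u = 0 \<longrightarrow> c = 0 \<and> d = 0) \<and>
     card (eigenvalues (lin_comb f \<sigma> u a b)) = 4"

definition nondegenerate :: "((complex ^ 8) set \<Rightarrow> real \<times> real) \<Rightarrow> (complex ^ 8) set \<Rightarrow> bool" where
  "nondegenerate f p \<longleftrightarrow> fixed_point f p \<and>
     (\<exists>U \<sigma> u a b. chart_at p U \<sigma> u \<and> nondegenerate_at f \<sigma> u a b)"

definition focus_focus :: "((complex ^ 8) set \<Rightarrow> real \<times> real) \<Rightarrow> (complex ^ 8) set \<Rightarrow> bool" where
  "focus_focus f p \<longleftrightarrow> fixed_point f p \<and>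
     (\<exists>U \<sigma> u a b \<alpha> \<beta>. chart_at p U \<sigma> u \<and> nondegenerate_at f \<sigma> u a b \<and>
        \<alpha> \<noteq> 0 \<and> \<beta> \<noteq> 0 \<and>
        eigenvalues (lin_comb f \<sigma> u a b) =
          {Complex \<alpha> \<beta>, Complex \<alpha> (- \<beta>), Complex (- \<alpha>) \<beta>, Complex (- \<alpha>) (- \<beta>)})"

definition fibre :: "((complex ^ 8) set \<Rightarrow> real \<times> real) \<Rightarrow> real \<times> real \<Rightarrow> (complex ^ 8) set set" where
  "fibre f c = {p \<in> mfd. f p = c}"

definition focus_focus_fibres :: "((complex ^ 8) set \<Rightarrow> real \<times> real) \<Rightarrow> (complex ^ 8) set set set" where
  "focus_focus_fibres f = {S. (\<exists>c. S = fibre f c) \<and> (\<exists>p\<in>S. focus_focus f p)}"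


section \<open>Double pinched tori\<close>

text \<open>\<open>local_rep e x U \<sigma> V g\<close>: near the point \<open>x\<close> of the unit sphere, the map \<open>e\<close> from the sphere
  to the quotient is given in the chart \<open>\<sigma>\<close> by \<open>g\<close>. As usual for maps defined on a submanifold,
  smoothness means the existence of a smooth local extension \<open>g\<close> to the ambient space; only
  the restriction of its derivative to the tangent plane of the sphere is meaningful.\<close>

definition local_rep ::
    "(real ^ 3 \<Rightarrow> (complex ^ 8) set) \<Rightarrow> real ^ 3 \<Rightarrow> (real ^ 4) set \<Rightarrow> (real ^ 4 \<Rightarrow> complex ^ 8)
     \<Rightarrow> (real ^ 3) set \<Rightarrow> (real ^ 3 \<Rightarrow> real ^ 4) \<Rightarrow> bool" where
  "local_rep e x U \<sigma> V g \<longleftrightarrow>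
     slice_chart U \<sigma> \<and> x \<in> V \<and> smooth_on V g \<and> g ` V \<subseteq> U \<and>
     (\<forall>y \<in> V \<inter> sphere 0 1. e y = tau (\<sigma> (g y)))"

definition sphere_tangent :: "real ^ 3 \<Rightarrow> (real ^ 3) set" where
  "sphere_tangent x = {v. v \<bullet> x = 0}"

definition embedded_sphere :: "(real ^ 3 \<Rightarrow> (complex ^ 8) set) \<Rightarrow> bool" where
  "embedded_sphere e \<longleftrightarrow> inj_on e (sphere 0 1) \<and>
     (\<forall>x \<in> sphere 0 1. \<exists>U \<sigma> V g. local_rep e x U \<sigma> V g \<and>
        inj_on (frechet_derivative g (at x)) (sphere_tangent x))"

text \<open>The tangent spaces at \<open>p\<close> of the two spheres together span the tangent space of the
  quotient, which is \<open>real ^ 4\<close> in the common chart \<open>\<sigma>\<close>.\<close>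

definition transverse_at ::
    "(real ^ 3 \<Rightarrow> (complex ^ 8) set) \<Rightarrow> (real ^ 3 \<Rightarrow> (complex ^ 8) set) \<Rightarrow> (complex ^ 8) set \<Rightarrow> bool" where
  "transverse_at e1 e2 p \<longleftrightarrow>
     (\<exists>x1 \<in> sphere 0 1. \<exists>x2 \<in> sphere 0 1. \<exists>U \<sigma> V1 g1 V2 g2.
        e1 x1 = p \<and> e2 x2 = p \<and> local_rep e1 x1 U \<sigma> V1 g1 \<and> local_rep e2 x2 U \<sigma> V2 g2 \<and>
        {a + b |a b. a \<in> frechet_derivative g1 (at x1) ` sphere_tangent x1 \<and>
                     b \<in> frechet_derivative g2 (at x2) ` sphere_tangent x2} = UNIV)"

definition double_pinched_torus ::
    "(complex ^ 8) set \<Rightarrow> (complex ^ 8) set \<Rightarrow> (complex ^ 8) set set \<Rightarrow> bool" where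
  "double_pinched_torus p q S \<longleftrightarrow> p \<noteq> q \<and>
     (\<exists>e1 e2. embedded_sphere e1 \<and> embedded_sphere e2 \<and>
        S = e1 ` sphere 0 1 \<union> e2 ` sphere 0 1 \<and>
        e1 ` sphere 0 1 \<inter> e2 ` sphere 0 1 = {p, q} \<and>
        transverse_at e1 e2 p \<and> transverse_at e1 e2 q)"

end

theory Submission
  imports Defs
begin

text \<open>Write \<open>a = |z\<^sub>5|\<^sup>2\<close> and \<open>b = |z\<^sub>7|\<^sup>2\<close>. The level equations express the other moduli affinely by \<open>(a, b)\<close>
  and confine \<open>(a, b)\<close> to an octagon, the moment polytope of the quotient. Here \<open>J = (6 - a) / 2\<close>, and at
  \<open>t = 1 / 2\<close> the second component is \<open>\<gamma> X / 2\<close> alone.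

  A fixed point must be critical for \<open>J\<close>, so it lies over one of the two edges \<open>a = 0\<close>, \<open>a = 6\<close> or over a
  vertex. Over the two edges it cannot be of focus-focus type: the circle action generated by \<open>J\<close> rotates a plane in
  the tangent space, all invariant Hessians are multiples of the same definite form on it, and this yields
  imaginary eigenvalues (\<open>imaginary_eigenvalue_on_edge\<close>). The four remaining vertices are
  permuted transitively by the reflections \<open>a \<mapsto> 6 - a\<close> and \<open>b \<mapsto> 6 - b\<close> of the octagon. Both are induced by
  permutations of the coordinates that preserve \<open>X\<close>, and they change \<open>J\<close> at most into \<open>3 - J\<close>. Hence it
  suffices to look at the vertex \<open>z\<^sub>7 = z\<^sub>8 = 0\<close>, where \<open>(z\<^sub>7, z\<^sub>8)\<close> are coordinates, \<open>J\<close> is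
  \<open>1 + (|z\<^sub>8|\<^sup>2 - |z\<^sub>7|\<^sup>2) / 2\<close>, and \<open>X\<close> is \<open>24 Re (z\<^sub>7 z\<^sub>8)\<close> to second order; a suitable combination has eigenvalues
  \<open>\<plusminus>1 \<plusminus> \<i>\<close> (\<open>focus_focus_slice\<close>). Two of the four points lie over \<open>(1, 0)\<close> and two over \<open>(2, 0)\<close>, and the
  reflection \<open>a \<mapsto> 6 - a\<close> exchanges these two values.

  On the fibre over \<open>(1, 0)\<close> one has \<open>a = 4\<close>, hence \<open>|z\<^sub>7| = |z\<^sub>8|\<close>. After normalising the first six coordinates to be
  nonnegative, \<open>X = 0\<close> becomes \<open>Re (z\<^sub>7 z\<^sub>8) = 0\<close>, that is \<open>z\<^sub>7 = \<plusminus>\<i> cnj z\<^sub>8\<close>. Each sign gives a disc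
  \<open>|z\<^sub>8|\<^sup>2 < 6\<close>, closed up to a sphere by the single point \<open>z\<^sub>2 = z\<^sub>3 = 0\<close>. The discs are the graphs of two
  linear maps with opposite signs, so they meet transversally at the origin, and the
  reflection \<open>b \<mapsto> 6 - b\<close>, which exchanges the two points common to both spheres, gives the same picture at the other one.\<close>

section \<open>Calculus of smooth maps\<close>

lemma C_k_cong:
  assumes "open S" and "\<And>x. x \<in> S \<Longrightarrow> f x = g x"
  shows "C_k k S f \<longleftrightarrow> C_k k S g"
  using assms(2)
proof (induction k arbitrary: f g)
  case 0
  then show ?case by (simp cong: continuous_on_cong)
next
  case (Suc k)
  have ev: "(f has_derivative D) (at x) \<longleftrightarrow> (g has_derivative D) (at x)" if "x \<in> S" for x D
    using that Suc.prems \<open>open S\<close>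
    by (metis has_derivative_transform_within_open)
  have diff: "f differentiable (at x) \<longleftrightarrow> g differentiable (at x)" if "x \<in> S" for x
    using ev[OF that] by (simp add: differentiable_def)
  have eq: "frechet_derivative f (at x) v = frechet_derivative g (at x) v" if "x \<in> S" for x v
    using ev[OF that] by (simp add: frechet_derivative_def)
  have "C_k k S (\<lambda>x. frechet_derivative f (at x) v) \<longleftrightarrow>
        C_k k S (\<lambda>x. frechet_derivative g (at x) v)" for v
    by (rule Suc.IH) (rule eq)
  then show ?case using diff by simp
qed

lemma C_k_SucI:
  assumes "open S"
    and "\<And>x. x \<in> S \<Longrightarrow> (f has_derivative f' x) (at x)"
    and "\<And>v. C_k k S (\<lambda>x. f' x v)"
  shows "C_k (Suc k) S f"
proof -
  have "frechet_derivative f (at x) v = f' x v" if "x \<in> S" for x v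
    using assms(2)[OF that] frechet_derivative_at by metis
  then have "C_k k S (\<lambda>x. frechet_derivative f (at x) v)" for v
    using assms(3)[of v] C_k_cong[OF \<open>open S\<close>, of "\<lambda>x. frechet_derivative f (at x) v" "\<lambda>x. f' x v"] by simp
  then show ?thesis
    using assms(2) by (auto simp: differentiable_def)
qed

lemma C_k_Suc_D:
  assumes "C_k (Suc k) S f" and "x \<in> S"
  shows "(f has_derivative frechet_derivative f (at x)) (at x)"
  using assms frechet_derivative_works by auto

lemma C_k_Suc_lower: "C_k (Suc k) S f \<Longrightarrow> C_k k S f"
proof (induction k arbitrary: f)
  case 0
  then show ?case
    by (auto intro!: continuous_at_imp_continuous_on differentiable_imp_continuous_within)
next
  case (Suc k)
  then show ?case by (metis C_k.simps(2))
qed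

lemma C_k_const: "open S \<Longrightarrow> C_k k S (\<lambda>x. c)"
proof (induction k arbitrary: c)
  case (Suc k)
  show ?case
    by (rule C_k_SucI[where f' = "\<lambda>_ _. 0"]) (auto intro: Suc)
qed auto

lemma C_k_linear:
  assumes "open S" and "bounded_linear f"
  shows "C_k k S f"
proof (cases k)
  case 0
  then show ?thesis using assms by (simp add: linear_continuous_on)
next
  case (Suc j)
  show ?thesis unfolding Suc
    by (rule C_k_SucI[where f' = "\<lambda>_. f"])
      (use assms in \<open>auto intro: bounded_linear_imp_has_derivative C_k_const\<close>)
qed

lemma C_k_compose_linear:
  assumes "open S" and "bounded_linear L" and "C_k k S f"
  shows "C_k k S (\<lambda>x. L (f x))"
  using assms(3)
proof (induction k arbitrary: f)
  case 0
  then show ?case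
    using bounded_linear.continuous_on[OF assms(2)] by simp
next
  case (Suc k)
  show ?case
  proof (rule C_k_SucI[where f' = "\<lambda>x v. L (frechet_derivative f (at x) v)"])
    show "((\<lambda>x. L (f x)) has_derivative (\<lambda>v. L (frechet_derivative f (at x) v))) (at x)"
      if "x \<in> S" for x
      using bounded_linear.has_derivative[OF assms(2) C_k_Suc_D[OF Suc.prems that]] .
  qed (use Suc assms in auto)
qed

lemma C_k_add:
  assumes "open S" and "C_k k S f" and "C_k k S g"
  shows "C_k k S (\<lambda>x. f x + g x)"
  using assms(2,3)
proof (induction k arbitrary: f g)
  case 0
  then show ?case by (auto intro: continuous_on_add)
next
  case (Suc k)
  show ?case
  proof (rule C_k_SucI[where
        f' = "\<lambda>x v. frechet_derivative f (at x) v + frechet_derivative g (at x) v"])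
    show "((\<lambda>x. f x + g x) has_derivative
        (\<lambda>v. frechet_derivative f (at x) v + frechet_derivative g (at x) v)) (at x)"
      if "x \<in> S" for x
      using Suc.prems that by (intro has_derivative_add C_k_Suc_D)
  qed (use Suc assms in auto)
qed

lemma C_k_sum:
  assumes "open S" and "\<And>i. i \<in> I \<Longrightarrow> C_k k S (f i)"
  shows "C_k k S (\<lambda>x. \<Sum>i\<in>I. f i x)"
  using assms(2)
  by (induction I rule: infinite_finite_induct) (auto intro: C_k_const C_k_add assms(1))

lemma C_k_mult:
  fixes f g :: "'a::euclidean_space \<Rightarrow> real"
  assumes "open S" and "C_k k S f" and "C_k k S g"
  shows "C_k k S (\<lambda>x. f x * g x)"
  using assms(2,3)
proof (induction k arbitrary: f g)
  case 0
  then show ?case by (auto intro: continuous_on_mult)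
next
  case (Suc k)
  show ?case
  proof (rule C_k_SucI[where
        f' = "\<lambda>x v. f x * frechet_derivative g (at x) v + frechet_derivative f (at x) v * g x"])
    show "((\<lambda>x. f x * g x) has_derivative
        (\<lambda>v. f x * frechet_derivative g (at x) v + frechet_derivative f (at x) v * g x)) (at x)"
      if "x \<in> S" for x
      using Suc.prems that by (intro has_derivative_mult C_k_Suc_D)
    show "C_k k S (\<lambda>x. f x * frechet_derivative g (at x) v +
        frechet_derivative f (at x) v * g x)" for v
      using Suc.prems C_k_Suc_lower[OF Suc.prems(1)] C_k_Suc_lower[OF Suc.prems(2)]
      by (intro C_k_add Suc.IH assms(1)) auto
  qed (rule assms)
qed

text \<open>Powers with arbitrary exponents are treated at once because differentiation lowers the
  exponent; square roots are the case \<open>a = 1 / 2\<close>.\<close>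

lemma C_k_powr:
  fixes f :: "'a::euclidean_space \<Rightarrow> real"
  assumes "open S" and "C_k k S f" and pos: "\<And>x. x \<in> S \<Longrightarrow> 0 < f x"
  shows "C_k k S (\<lambda>x. f x powr a)"
  using assms(2)
proof (induction k arbitrary: a)
  case 0
  then show ?case using pos by (auto intro!: continuous_on_powr simp: less_le)
next
  case (Suc k)
  show ?case
  proof (rule C_k_SucI[where
        f' = "\<lambda>x v. a * (f x powr (a - 1) * frechet_derivative f (at x) v)"])
    show "((\<lambda>x. f x powr a) has_derivative
        (\<lambda>v. a * (f x powr (a - 1) * frechet_derivative f (at x) v))) (at x)"
      if "x \<in> S" for x
    proof -
      have "((\<lambda>x. f x powr a) has_derivative
          (\<lambda>v. f x powr a * (0 * ln (f x) + frechet_derivative f (at x) v * a / f x))) (at x)"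
        using that pos by (intro has_derivative_powr C_k_Suc_D[OF Suc.prems]) auto
      then show ?thesis
        using pos[OF that] by (simp add: powr_diff field_simps)
    qed
    show "C_k k S (\<lambda>x. a * (f x powr (a - 1) * frechet_derivative f (at x) v))" for v
      using Suc assms(1) C_k_Suc_lower[OF Suc.prems]
      by (intro C_k_mult C_k_const Suc.IH) auto
  qed (rule assms)
qed

lemma smooth_on_const: "open S \<Longrightarrow> smooth_on S (\<lambda>x. c)"
  by (simp add: smooth_on_def C_k_const)

lemma smooth_on_linear: "open S \<Longrightarrow> bounded_linear f \<Longrightarrow> smooth_on S f"
  by (simp add: smooth_on_def C_k_linear)

lemma smooth_on_compose_linear:
  "bounded_linear L \<Longrightarrow> smooth_on S f \<Longrightarrow> smooth_on S (\<lambda>x. L (f x))"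
  by (simp add: smooth_on_def C_k_compose_linear)

lemma smooth_on_add: "smooth_on S f \<Longrightarrow> smooth_on S g \<Longrightarrow> smooth_on S (\<lambda>x. f x + g x)"
  by (simp add: smooth_on_def C_k_add)

lemma smooth_on_minus: "smooth_on S f \<Longrightarrow> smooth_on S (\<lambda>x. - f x)"
  by (rule smooth_on_compose_linear[OF bounded_linear_minus[OF bounded_linear_ident]])

lemma smooth_on_diff: "smooth_on S f \<Longrightarrow> smooth_on S g \<Longrightarrow> smooth_on S (\<lambda>x. f x - g x)"
  using smooth_on_add[OF _ smooth_on_minus, of S f g] by simp

lemma smooth_on_mult:
  fixes f g :: "'a::euclidean_space \<Rightarrow> real"
  shows "smooth_on S f \<Longrightarrow> smooth_on S g \<Longrightarrow> smooth_on S (\<lambda>x. f x * g x)"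
  by (simp add: smooth_on_def C_k_mult)

lemma smooth_on_power2:
  fixes f :: "'a::euclidean_space \<Rightarrow> real"
  shows "smooth_on S f \<Longrightarrow> smooth_on S (\<lambda>x. (f x)\<^sup>2)"
  by (simp add: power2_eq_square smooth_on_mult)

lemma smooth_on_powr:
  fixes f :: "'a::euclidean_space \<Rightarrow> real"
  shows "smooth_on S f \<Longrightarrow> (\<And>x. x \<in> S \<Longrightarrow> 0 < f x) \<Longrightarrow> smooth_on S (\<lambda>x. f x powr a)"
  by (simp add: smooth_on_def C_k_powr)

lemma smooth_on_cong: "(\<And>x. x \<in> S \<Longrightarrow> f x = g x) \<Longrightarrow> smooth_on S f \<longleftrightarrow> smooth_on S g"
  unfolding smooth_on_def using C_k_cong by blast

lemma smooth_on_sqrt: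
  fixes f :: "'a::euclidean_space \<Rightarrow> real"
  assumes "smooth_on S f" and "\<And>x. x \<in> S \<Longrightarrow> 0 < f x"
  shows "smooth_on S (\<lambda>x. sqrt (f x))"
  using smooth_on_powr[OF assms, of "1/2"] assms(2)
  by (subst smooth_on_cong[where g = "\<lambda>x. f x powr (1/2)"]) (auto simp: powr_half_sqrt less_imp_le)

lemma bounded_linear_axis: "bounded_linear (\<lambda>y :: 'b::euclidean_space. axis i y :: 'b ^ 'n)"
  by (intro linear_conv_bounded_linear[THEN iffD1] linearI) (auto simp: vec_eq_iff axis_def)

lemma sum_axis_nth: "(\<Sum>i\<in>UNIV. axis i (x $ i)) = (x :: 'b::euclidean_space ^ 'n)"
  by (auto simp: vec_eq_iff axis_def if_distrib cong: if_cong)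

lemma smooth_on_vec:
  fixes f :: "'a::euclidean_space \<Rightarrow> 'b::euclidean_space ^ 'n"
  assumes "open S" and "\<And>i. smooth_on S (\<lambda>x. f x $ i)"
  shows "smooth_on S f"
proof -
  have "C_k k S (\<lambda>x. axis i (f x $ i) :: 'b ^ 'n)" for k i
    using assms by (intro C_k_compose_linear[OF _ bounded_linear_axis]) (auto simp: smooth_on_def)
  then have "smooth_on S (\<lambda>x. \<Sum>i\<in>UNIV. axis i (f x $ i))"
    using assms(1) by (auto simp: smooth_on_def intro: C_k_sum)
  then show ?thesis by (simp only: sum_axis_nth)
qed

lemma smooth_on_derivative:
  assumes "smooth_on S f" and "x \<in> S"
  shows "(f has_derivative frechet_derivative f (at x)) (at x)"
proof -
  have "C_k (Suc 0) S f" using assms by (simp add: smooth_on_def del: C_k.simps)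
  from C_k_Suc_D[OF this assms(2)] show ?thesis .
qed

lemma smooth_on_second_derivative:
  assumes "smooth_on S f" and "x \<in> S"
  shows "(\<lambda>y. frechet_derivative f (at y) v) differentiable (at x)"
proof -
  have "C_k (Suc (Suc 0)) S f" using assms by (simp add: smooth_on_def del: C_k.simps)
  then show ?thesis using assms(2) by simp
qed

section \<open>Vectors with four, six and eight entries\<close>

lemma exhaust_8:
  fixes x :: 8
  shows "x = 1 \<or> x = 2 \<or> x = 3 \<or> x = 4 \<or> x = 5 \<or> x = 6 \<or> x = 7 \<or> x = 8"
proof (induct x)
  case (of_int z)
  then have "z = 0 \<or> z = 1 \<or> z = 2 \<or> z = 3 \<or> z = 4 \<or> z = 5 \<or> z = 6 \<or> z = 7" by fastforce
  then show ?case by auto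
qed

lemma exhaust_6:
  fixes x :: 6
  shows "x = 1 \<or> x = 2 \<or> x = 3 \<or> x = 4 \<or> x = 5 \<or> x = 6"
proof (induct x)
  case (of_int z)
  then have "z = 0 \<or> z = 1 \<or> z = 2 \<or> z = 3 \<or> z = 4 \<or> z = 5" by fastforce
  then show ?case by auto
qed

lemma forall_8: "(\<forall>i::8. P i) \<longleftrightarrow> P 1 \<and> P 2 \<and> P 3 \<and> P 4 \<and> P 5 \<and> P 6 \<and> P 7 \<and> P 8"
  by (metis exhaust_8)

lemma forall_6: "(\<forall>i::6. P i) \<longleftrightarrow> P 1 \<and> P 2 \<and> P 3 \<and> P 4 \<and> P 5 \<and> P 6"
  by (metis exhaust_6)

lemma UNIV_8: "UNIV = {1, 2, 3, 4, 5, 6, 7, 8 :: 8}"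
  using exhaust_8 by blast

lemma sum_8: "sum f (UNIV :: 8 set) = f 1 + f 2 + f 3 + f 4 + f 5 + f 6 + f 7 + f 8"
  unfolding UNIV_8 by (simp add: ac_simps)

lemma vector_4 [simp]:
  "(vector [a, b, c, d] :: 'a::zero ^ 4) $ 1 = a"
  "(vector [a, b, c, d] :: 'a::zero ^ 4) $ 2 = b"
  "(vector [a, b, c, d] :: 'a::zero ^ 4) $ 3 = c"
  "(vector [a, b, c, d] :: 'a::zero ^ 4) $ 4 = d"
  by (simp_all add: vector_def)

lemma vector_6 [simp]:
  "(vector [a, b, c, d, e, f] :: 'a::zero ^ 6) $ 1 = a"
  "(vector [a, b, c, d, e, f] :: 'a::zero ^ 6) $ 2 = b"
  "(vector [a, b, c, d, e, f] :: 'a::zero ^ 6) $ 3 = c"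
  "(vector [a, b, c, d, e, f] :: 'a::zero ^ 6) $ 4 = d"
  "(vector [a, b, c, d, e, f] :: 'a::zero ^ 6) $ 5 = e"
  "(vector [a, b, c, d, e, f] :: 'a::zero ^ 6) $ 6 = f"
  by (simp_all add: vector_def)

section \<open>The level set and its tangent spaces\<close>

definition times_i :: "complex ^ 8 \<Rightarrow> complex ^ 8" where
  "times_i z = (\<chi> k. \<i> * z $ k)"

definition weighted :: "real ^ 6 \<Rightarrow> complex ^ 8 \<Rightarrow> complex ^ 8" where
  "weighted t z = (\<chi> k. phase t $ k *\<^sub>R z $ k)"

text \<open>The vector \<open>weighted t z\<close> is the gradient at \<open>z\<close> of one half of the component in the direction \<open>t\<close> of the
  equations defining \<open>level_W\<close>, and \<open>times_i (weighted t z)\<close> is the velocity of the orbit. Thus the space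
  defined next is the kernel of the derivative of those equations.\<close>

definition level_tangent :: "complex ^ 8 \<Rightarrow> (complex ^ 8) set" where
  "level_tangent z = {v. \<forall>t. weighted t z \<bullet> v = 0}"

lemma phase_linear: "linear (\<lambda>t. phase t $ k)"
proof -
  have "\<forall>k. linear (\<lambda>t. phase t $ k)"
    unfolding forall_8 by (auto simp: phase_def linear_iff algebra_simps)
  then show ?thesis by blast
qed

lemma phase_add: "phase (s + t) $ k = phase s $ k + phase t $ k"
  by (rule linear_add[OF phase_linear])

lemma phase_scaleR: "phase (c *\<^sub>R t) $ k = c * phase t $ k"
  using linear_scale[OF phase_linear, of c t k] by simp

lemma weighted_linear: "linear (\<lambda>t. weighted t z)"
  by (rule linearI) (auto simp: weighted_def vec_eq_iff phase_add phase_scaleR scaleR_add_left)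

lemma weighted_linear_right: "linear (weighted t)"
  by (rule linearI) (auto simp: weighted_def vec_eq_iff algebra_simps)

lemma bounded_linear_weighted: "bounded_linear (weighted t)"
  using weighted_linear_right by (simp add: linear_conv_bounded_linear)

lemma linear_times_i: "linear times_i"
  by (rule linearI) (auto simp: times_i_def vec_eq_iff algebra_simps)

lemma bounded_linear_times_i: "bounded_linear times_i"
  using linear_times_i by (simp add: linear_conv_bounded_linear)

lemma times_i_times_i [simp]: "times_i (times_i z) = - z"
  by (simp add: times_i_def vec_eq_iff mult.assoc[symmetric])

lemma times_i_eq_0 [simp]: "times_i z = 0 \<longleftrightarrow> z = 0"
  by (simp add: times_i_def vec_eq_iff)

lemma times_i_uminus [simp]: "times_i (- z) = - times_i z"
  by (simp add: times_i_def vec_eq_iff)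

lemma times_i_inner: "times_i u \<bullet> v = - (u \<bullet> times_i v)"
  by (simp add: inner_vec_def times_i_def inner_complex_def sum_negf[symmetric] algebra_simps)

text \<open>Orthogonality for the symplectic form is orthogonality for the inner product after a
  multiplication by \<open>\<i>\<close>. This turns statements on symplectic complements into statements on
  orthogonal complements.\<close>

lemma omega_st_inner: "omega_st u v = u \<bullet> times_i v"
proof -
  have "Re (- (\<i> / 2) * (x * cnj y - y * cnj x)) = x \<bullet> (\<i> * y)" for x y
    by (simp add: inner_complex_def field_simps)
  then show ?thesis
    unfolding omega_st_def inner_vec_def times_i_def sum_distrib_left Re_sum by simp
qed

lemma orbit_tangent_weighted: "orbit_tangent z = range (\<lambda>t. times_i (weighted t z))"
  by (auto simp: orbit_tangent_def times_i_def weighted_def scaleR_conv_of_real mult.assoc)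

lemma weighted_inner_commute: "weighted t u \<bullet> v = weighted t v \<bullet> u"
  by (simp add: inner_vec_def weighted_def inner_commute)

lemma weighted_inner_orbit: "weighted s z \<bullet> times_i (weighted t z) = 0"
proof -
  have "(phase s $ k *\<^sub>R z $ k) \<bullet> (\<i> * (phase t $ k *\<^sub>R z $ k)) = 0" for k
    by (simp add: inner_complex_def algebra_simps)
  then show ?thesis
    unfolding inner_vec_def weighted_def times_i_def vec_lambda_beta by (intro sum.neutral) blast
qed

lemma level_W_weighted:
  assumes "z \<in> level_W"
  shows "weighted t z \<bullet> z =
    6 * t $ 1 + 10 * t $ 2 + 6 * t $ 3 + 4 * t $ 4 - 2 * t $ 5 + 4 * t $ 6"
proof -
  let ?Z = "\<lambda>k. (cmod (z $ k))\<^sup>2"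
  have "weighted t z \<bullet> z = (\<Sum>k\<in>UNIV. phase t $ k * ?Z k)"
    by (simp add: inner_vec_def weighted_def power2_norm_eq_inner)
  also have "\<dots> = t $ 1 * (?Z 1 + ?Z 5) + t $ 2 * (?Z 2 + ?Z 5 + ?Z 7) + t $ 3 * (?Z 3 + ?Z 7)
     + t $ 4 * (?Z 4 - ?Z 5 + ?Z 7) - t $ 5 * (?Z 5 - ?Z 6 + ?Z 7) + t $ 6 * (?Z 5 - ?Z 7 + ?Z 8)"
    by (simp add: sum_8 phase_def algebra_simps)
  also have "\<dots> = t $ 1 * 6 + t $ 2 * 10 + t $ 3 * 6 + t $ 4 * 4 - t $ 5 * 2 + t $ 6 * 4"
    using assms unfolding level_W_def by simp
  finally show ?thesis by simp
qed

text \<open>With \<open>A = |z\<^sub>5|\<^sup>2\<close> and \<open>B = |z\<^sub>7|\<^sup>2\<close> the other six moduli are affine functions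
  of \<open>(A, B)\<close>, which lies in an octagon. At most two coordinates vanish at a time, namely those
  belonging to adjacent edges, and the vanishing of the other six phases forces \<open>t = 0\<close>.\<close>

lemma level_W_free:
  assumes "z \<in> level_W" and "weighted t z = 0"
  shows "t = 0"
proof -
  define A B where "A = (cmod (z $ 5))\<^sup>2" and "B = (cmod (z $ 7))\<^sup>2"
  have Z: "(cmod (z $ 1))\<^sup>2 = 6 - A" "(cmod (z $ 2))\<^sup>2 = 10 - A - B"
    "(cmod (z $ 3))\<^sup>2 = 6 - B" "(cmod (z $ 4))\<^sup>2 = 4 + A - B"
    "(cmod (z $ 6))\<^sup>2 = A + B - 2" "(cmod (z $ 8))\<^sup>2 = 4 - A + B"
    using assms(1) unfolding level_W_def A_def B_def by auto
  have "\<forall>k. phase t $ k = 0 \<or> (cmod (z $ k))\<^sup>2 = 0"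
    using assms(2) by (auto simp: weighted_def vec_eq_iff)
  then have ph: "t $ 1 = 0 \<or> A = 6" "t $ 2 = 0 \<or> A + B = 10" "t $ 3 = 0 \<or> B = 6"
    "t $ 4 = 0 \<or> B = 4 + A" "t $ 1 + t $ 2 - t $ 4 - t $ 5 + t $ 6 = 0 \<or> A = 0"
    "t $ 5 = 0 \<or> A + B = 2" "t $ 2 + t $ 3 + t $ 4 - t $ 5 - t $ 6 = 0 \<or> B = 0"
    "t $ 6 = 0 \<or> A = 4 + B"
    unfolding forall_8 Z A_def[symmetric] B_def[symmetric]
    by (simp_all only: phase_def vector_8) auto
  have nn: "6 - A \<ge> 0" "10 - A - B \<ge> 0" "6 - B \<ge> 0" "4 + A - B \<ge> 0" "A + B - 2 \<ge> 0"
    "4 - A + B \<ge> 0" "A \<ge> 0" "B \<ge> 0"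
    using Z[symmetric] by (simp_all add: A_def B_def)
  consider "B = 0" | "B = 6" | "A = 6" "B \<noteq> 0" "B \<noteq> 6" | "A = 0" "B \<noteq> 0" "B \<noteq> 6"
    | "A \<noteq> 0" "A \<noteq> 6" "B \<noteq> 0" "B \<noteq> 6"
    by blast
  then have "t $ 1 = 0 \<and> t $ 2 = 0 \<and> t $ 3 = 0 \<and> t $ 4 = 0 \<and> t $ 5 = 0 \<and> t $ 6 = 0"
  proof cases
    case 1
    then have "t $ 1 = 0" "t $ 2 = 0" "t $ 3 = 0" "t $ 4 = 0" "t $ 5 = t $ 6" "t $ 5 = 0 \<or> t $ 6 = 0"
      using ph nn by (simp_all, linarith+)
    then show ?thesis by auto
  next
    case 2
    then have "t $ 1 = 0" "t $ 5 = 0" "t $ 6 = 0" "t $ 2 = t $ 4" "t $ 2 = 0 \<or> t $ 4 = 0" "t $ 2 + t $ 3 + t $ 4 = 0"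
      using ph nn by (simp_all, linarith+)
    then show ?thesis by auto
  next
    case 3
    then have "t $ 3 = 0" "t $ 4 = 0" "t $ 5 = 0" "t $ 2 = t $ 6" "t $ 2 = 0 \<or> t $ 6 = 0" "t $ 1 + t $ 2 + t $ 6 = 0"
      using ph nn by (simp_all, linarith+)
    then show ?thesis by auto
  next
    case 4
    then have "t $ 3 = 0" "t $ 1 = 0" "t $ 2 = 0" "t $ 6 = 0" "t $ 4 = t $ 5" "t $ 4 = 0 \<or> t $ 5 = 0"
      using ph nn by (simp_all, linarith+)
    then show ?thesis by auto
  next
    case 5
    then have "t $ 3 = 0" "t $ 1 = 0" "t $ 2 = t $ 5" "t $ 4 = t $ 6" "t $ 2 = 0 \<or> t $ 5 = 0"
      "t $ 4 = 0 \<or> t $ 6 = 0"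
      using ph nn by (simp_all, linarith+)
    then show ?thesis by auto
  qed
  then show ?thesis by (simp add: vec_eq_iff forall_6)
qed

lemma subspace_level_tangent: "subspace (level_tangent z)"
  by (auto simp: level_tangent_def subspace_def inner_add_right)

lemma level_tangent_orthogonal_comp:
  "level_tangent z = orthogonal_comp (range (\<lambda>t. weighted t z))"
  by (auto simp: level_tangent_def orthogonal_comp_def orthogonal_def)

text \<open>This is the existence of Lagrange multipliers: \<open>w\<close> will be the gradient of a function that is
  critical along the level set.\<close>

lemma orthogonal_level_tangent:
  assumes "\<And>v. v \<in> level_tangent z \<Longrightarrow> w \<bullet> v = 0"
  obtains t where "w = weighted t z"
proof -
  have "w \<in> orthogonal_comp (level_tangent z)"
    using assms by (auto simp: orthogonal_comp_def orthogonal_def inner_commute)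
  then have "w \<in> range (\<lambda>t. weighted t z)"
    unfolding level_tangent_orthogonal_comp
    by (subst (asm) orthogonal_comp_self)
      (auto intro: linear_subspace_image[OF weighted_linear] subspace_UNIV)
  then show ?thesis using that by auto
qed

lemma orbit_in_level_tangent: "times_i (weighted t z) \<in> level_tangent z"
  by (simp add: level_tangent_def weighted_inner_orbit)

lemma dim_level_tangent:
  assumes "z \<in> level_W"
  shows "dim (level_tangent z) = 10"
proof -
  let ?A = "range (\<lambda>t. weighted t z)"
  have "inj (\<lambda>t. weighted t z)"
    using level_W_free[OF assms] by (simp add: linear_injective_0[OF weighted_linear])
  then have "dim ?A = dim (UNIV :: (real ^ 6) set)"
    by (intro dim_image_eq[OF weighted_linear]) (auto intro: inj_on_subset)
  then have "dim ?A = 6" by simp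
  moreover have "dim {y \<in> UNIV. \<forall>x\<in>?A. orthogonal x y} + dim ?A = dim (UNIV :: (complex ^ 8) set)"
    by (intro dim_subspace_orthogonal_to_vectors)
      (auto intro: linear_subspace_image[OF weighted_linear] subspace_UNIV)
  moreover have "{y \<in> UNIV. \<forall>x\<in>?A. orthogonal x y} = level_tangent z"
    by (auto simp: level_tangent_def orthogonal_def)
  ultimately show ?thesis by simp
qed

lemma linear_axis_expansion:
  fixes w :: "real ^ 'n"
  assumes "linear f"
  shows "f w = (\<Sum>j\<in>UNIV. w $ j *\<^sub>R f (axis j 1))"
proof -
  have "f w = f (\<Sum>j\<in>UNIV. w $ j *\<^sub>R axis j 1)"
    using basis_expansion[of w] by (simp add: scalar_mult_eq_scaleR)
  also have "\<dots> = (\<Sum>j\<in>UNIV. w $ j *\<^sub>R f (axis j 1))"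
    by (simp add: linear_sum[OF assms] linear_scale[OF assms])
  finally show ?thesis .
qed

section \<open>Slice charts and the reduced form\<close>

context
  fixes U \<sigma>
  assumes chart: "slice_chart U \<sigma>"
begin

lemma chart_open: "open U" and chart_smooth: "smooth_on U \<sigma>"
  using chart by (auto simp: slice_chart_def smooth_on_def)

lemma chart_level: "x \<in> U \<Longrightarrow> \<sigma> x \<in> level_W"
  using chart by (auto simp: slice_chart_def)

lemma chart_derivative:
  "x \<in> U \<Longrightarrow> (\<sigma> has_derivative frechet_derivative \<sigma> (at x)) (at x)"
  by (rule smooth_on_derivative[OF chart_smooth])

lemma chart_derivative_linear: "x \<in> U \<Longrightarrow> linear (frechet_derivative \<sigma> (at x))"
  using chart_derivative has_derivative_linear by blast

lemma chart_derivative_level_tangent: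
  assumes "x \<in> U"
  shows "frechet_derivative \<sigma> (at x) v \<in> level_tangent (\<sigma> x)"
proof -
  have "weighted t (\<sigma> x) \<bullet> frechet_derivative \<sigma> (at x) v = 0" for t
  proof -
    let ?D = "frechet_derivative \<sigma> (at x)"
    define c where "c = 6 * t $ 1 + 10 * t $ 2 + 6 * t $ 3 + 4 * t $ 4 - 2 * t $ 5 + 4 * t $ 6"
    have "((\<lambda>y. weighted t (\<sigma> y) \<bullet> \<sigma> y) has_derivative
        (\<lambda>v. weighted t (\<sigma> x) \<bullet> ?D v + weighted t (?D v) \<bullet> \<sigma> x)) (at x)"
      by (intro has_derivative_inner chart_derivative assms
          bounded_linear.has_derivative[OF bounded_linear_weighted])
    moreover have "((\<lambda>y. weighted t (\<sigma> y) \<bullet> \<sigma> y) has_derivative (\<lambda>v. 0)) (at x)"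
      using has_derivative_const[of c "at x"] chart_open assms
      by (rule has_derivative_transform_within_open)
        (simp add: c_def level_W_weighted chart_level)
    ultimately have "(\<lambda>v. weighted t (\<sigma> x) \<bullet> ?D v + weighted t (?D v) \<bullet> \<sigma> x) = (\<lambda>v. 0)"
      by (rule has_derivative_unique)
    then have "weighted t (\<sigma> x) \<bullet> ?D v + weighted t (?D v) \<bullet> \<sigma> x = 0"
      by (rule fun_cong)
    then show ?thesis by (simp add: weighted_inner_commute[of t "?D v"])
  qed
  then show ?thesis by (simp add: level_tangent_def)
qed

text \<open>The derivative of the chart and the infinitesimal action together have rank
  \<open>4 + 6\<close>, the dimension of the tangent space.\<close>

lemma level_tangent_decompose:
  assumes "x \<in> U" and "w \<in> level_tangent (\<sigma> x)"
  obtains v t where "w = frechet_derivative \<sigma> (at x) v + times_i (weighted t (\<sigma> x))"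
proof -
  let ?D = "frechet_derivative \<sigma> (at x)"
  define \<Psi> where "\<Psi> = (\<lambda>p :: (real ^ 4) \<times> (real ^ 6). ?D (fst p) + times_i (weighted (snd p) (\<sigma> x)))"
  have lD: "linear ?D" using chart_derivative_linear[OF assms(1)] .
  have lin: "linear \<Psi>"
    unfolding \<Psi>_def
    by (rule linearI)
      (simp_all add: linear_add[OF lD] linear_scale[OF lD] linear_add[OF weighted_linear]
        linear_scale[OF weighted_linear] linear_add[OF linear_times_i] linear_scale[OF linear_times_i]
        algebra_simps)
  have "p = 0" if "\<Psi> p = 0" for p
  proof -
    have eq: "?D (fst p) = times_i (weighted (- snd p) (\<sigma> x))"
      using that by (simp add: \<Psi>_def linear_neg[OF weighted_linear] add_eq_0_iff2)
    then have "?D (fst p) \<in> orbit_tangent (\<sigma> x)"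
      by (auto simp: orbit_tangent_weighted)
    then have "fst p = 0"
      using chart assms(1) by (auto simp: slice_chart_def)
    with eq have "weighted (- snd p) (\<sigma> x) = 0"
      by (metis linear_0[OF lD] times_i_eq_0)
    then have "- snd p = 0" using level_W_free chart_level[OF assms(1)] by blast
    with \<open>fst p = 0\<close> show ?thesis by (simp add: prod_eq_iff)
  qed
  then have "inj \<Psi>" by (simp add: linear_injective_0[OF lin])
  then have "dim (range \<Psi>) = dim (UNIV :: ((real ^ 4) \<times> (real ^ 6)) set)"
    by (intro dim_image_eq[OF lin]) (auto intro: inj_on_subset)
  then have "dim (range \<Psi>) = 10" by simp
  moreover have "range \<Psi> \<subseteq> level_tangent (\<sigma> x)"
    unfolding \<Psi>_def
    using subspace_add[OF subspace_level_tangent chart_derivative_level_tangent[OF assms(1)]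
        orbit_in_level_tangent] by blast
  moreover have "subspace (range \<Psi>)"
    by (rule linear_subspace_image[OF lin subspace_UNIV])
  ultimately have "range \<Psi> = level_tangent (\<sigma> x)"
    using dim_level_tangent[OF chart_level[OF assms(1)]] subspace_level_tangent
    by (intro subspace_dim_equal) auto
  then obtain p where "w = \<Psi> p" using assms(2) by blast
  then show ?thesis using that unfolding \<Psi>_def by blast
qed

lemma omega_mat_mult:
  assumes "x \<in> U"
  shows "(omega_mat \<sigma> x *v w) $ i =
    omega_st (frechet_derivative \<sigma> (at x) (axis i 1)) (frechet_derivative \<sigma> (at x) w)"
proof -
  let ?D = "frechet_derivative \<sigma> (at x)"
  have lin: "linear (\<lambda>w. omega_st (?D (axis i 1)) (?D w))"
    unfolding omega_st_inner
    using linear_compose[OF linear_compose[OF chart_derivative_linear[OF assms] linear_times_i]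
        bounded_linear.linear[OF bounded_linear_inner_right[of "?D (axis i 1)"]]]
    by (simp add: o_def)
  have "omega_st (?D (axis i 1)) (?D w) = (\<Sum>j\<in>UNIV. w $ j * omega_st (?D (axis i 1)) (?D (axis j 1)))"
    using linear_axis_expansion[OF lin, of w] by simp
  then show ?thesis
    by (simp add: matrix_vector_mult_def omega_mat_def mult.commute)
qed

text \<open>A vector in the kernel of the reduced form is symplectically orthogonal to the chart and, like every tangent
  vector of the level set, to the orbit. So it is symplectically orthogonal to the whole tangent space of the level set,
  hence an orbit direction, which the transversality of the slice excludes.\<close>

lemma omega_mat_invertible:
  assumes "x \<in> U"
  shows "invertible (omega_mat \<sigma> x)"
proof -
  let ?D = "frechet_derivative \<sigma> (at x)"
  have "v = 0" if "omega_mat \<sigma> x *v v = 0" for v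
  proof -
    have base: "omega_st (?D (axis i 1)) (?D v) = 0" for i
      using omega_mat_mult[OF assms, of v i] that by simp
    have "times_i (?D v) \<bullet> u = 0" if u: "u \<in> level_tangent (\<sigma> x)" for u
    proof -
      obtain w t where w: "u = ?D w + times_i (weighted t (\<sigma> x))"
        using level_tangent_decompose[OF assms u] .
      have "?D w = (\<Sum>j\<in>UNIV. w $ j *\<^sub>R ?D (axis j 1))"
        by (rule linear_axis_expansion[OF chart_derivative_linear[OF assms]])
      then have "?D w \<bullet> times_i (?D v) = 0"
        using base by (simp add: inner_sum_left omega_st_inner)
      moreover have "times_i (weighted t (\<sigma> x)) \<bullet> times_i (?D v) = 0"
        using chart_derivative_level_tangent[OF assms, of v]
        by (simp add: times_i_inner level_tangent_def)
      ultimately show ?thesis by (simp add: w inner_add_right inner_commute)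
    qed
    then obtain t where "times_i (?D v) = weighted t (\<sigma> x)"
      by (rule orthogonal_level_tangent)
    then have "times_i (times_i (?D v)) = times_i (weighted t (\<sigma> x))" by (rule arg_cong)
    then have "?D v = times_i (weighted (- t) (\<sigma> x))"
      by (simp add: linear_neg[OF weighted_linear] minus_equation_iff[of "?D v"] eq_commute)
    then have "?D v \<in> orbit_tangent (\<sigma> x)" by (auto simp: orbit_tangent_weighted)
    then show ?thesis using chart assms by (auto simp: slice_chart_def)
  qed
  then show ?thesis
    by (simp add: invertible_left_inverse matrix_left_invertible_ker)
qed

end

section \<open>Hessians at critical points\<close>

text \<open>If the gradient of \<open>G\<close> vanishes at \<open>\<sigma> u\<close>, the second derivative of the chart drops out of the
  second derivative of \<open>G \<circ> \<sigma>\<close>.\<close>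

lemma hessian_compose:
  fixes \<sigma> :: "real ^ 4 \<Rightarrow> complex ^ 8"
  assumes smooth: "smooth_on U \<sigma>" and u: "u \<in> U"
    and G: "\<And>y. (G has_derivative (\<lambda>\<zeta>. g y \<bullet> \<zeta>)) (at y)"
    and g: "(g has_derivative g') (at (\<sigma> u))" and crit: "g (\<sigma> u) = 0"
    and h: "\<And>x. x \<in> U \<Longrightarrow> h x = G (\<sigma> x) + c"
  shows "hessian h u $ i $ j =
    g' (frechet_derivative \<sigma> (at u) (axis i 1)) \<bullet> frechet_derivative \<sigma> (at u) (axis j 1)"
proof -
  let ?D = "\<lambda>x. frechet_derivative \<sigma> (at x)"
  have "open U" using smooth by (simp add: smooth_on_def)
  have D: "(\<sigma> has_derivative ?D x) (at x)" if "x \<in> U" for x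
    using smooth_on_derivative[OF smooth that] .
  have dh: "frechet_derivative h (at x) v = g (\<sigma> x) \<bullet> ?D x v" if "x \<in> U" for x v
  proof -
    have "((\<lambda>x. G (\<sigma> x) + c) has_derivative (\<lambda>v. g (\<sigma> x) \<bullet> ?D x v)) (at x)"
      using has_derivative_add[OF has_derivative_compose[OF D[OF that] G] has_derivative_const]
      by simp
    then have "(h has_derivative (\<lambda>v. g (\<sigma> x) \<bullet> ?D x v)) (at x)"
      by (rule has_derivative_transform_within_open[OF _ \<open>open U\<close> that]) (simp add: h)
    then show ?thesis by (metis frechet_derivative_at)
  qed
  obtain s' where s': "((\<lambda>x. ?D x (axis j 1)) has_derivative s') (at u)"
    using smooth_on_second_derivative[OF smooth u] by (auto simp: differentiable_def)
  have "((\<lambda>x. g (\<sigma> x) \<bullet> ?D x (axis j 1)) has_derivative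
      (\<lambda>v. g (\<sigma> u) \<bullet> s' v + g' (?D u v) \<bullet> ?D u (axis j 1))) (at u)"
    by (intro has_derivative_inner s' has_derivative_compose[OF D[OF u] g])
  from has_derivative_transform_within_open[OF this \<open>open U\<close> u,
      of "\<lambda>x. frechet_derivative h (at x) (axis j 1)"]
  have "((\<lambda>x. frechet_derivative h (at x) (axis j 1)) has_derivative
      (\<lambda>v. g' (?D u v) \<bullet> ?D u (axis j 1))) (at u)"
    by (simp add: dh crit)
  then show ?thesis
    by (simp add: hessian_def frechet_derivative_at[symmetric])
qed

lemma hessian_compose_mult:
  fixes \<sigma> :: "real ^ 4 \<Rightarrow> complex ^ 8"
  assumes smooth: "smooth_on U \<sigma>" and u: "u \<in> U"
    and G: "\<And>y. (G has_derivative (\<lambda>\<zeta>. g y \<bullet> \<zeta>)) (at y)"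
    and g: "(g has_derivative g') (at (\<sigma> u))" and crit: "g (\<sigma> u) = 0"
    and h: "\<And>x. x \<in> U \<Longrightarrow> h x = G (\<sigma> x) + c"
  shows "(hessian h u *v w) $ i =
    g' (frechet_derivative \<sigma> (at u) (axis i 1)) \<bullet> frechet_derivative \<sigma> (at u) w"
proof -
  let ?D = "frechet_derivative \<sigma> (at u)"
  have "linear ?D"
    using smooth_on_derivative[OF smooth u] has_derivative_linear by blast
  then have "?D w = (\<Sum>j\<in>UNIV. w $ j *\<^sub>R ?D (axis j 1))"
    by (rule linear_axis_expansion)
  then show ?thesis
    by (simp add: matrix_vector_mult_def hessian_compose[OF assms] inner_sum_right mult.commute)
qed

lemma matrix_inv_mult_eq:
  fixes A :: "real ^ 'n ^ 'n"
  assumes "invertible A" and "A *v x = y"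
  shows "matrix_inv A *v y = x"
proof -
  have "A ** matrix_inv A = mat 1 \<and> matrix_inv A ** A = mat 1"
    using assms(1) unfolding invertible_def matrix_inv_def by (rule someI_ex)
  then show ?thesis
    by (simp add: assms(2)[symmetric] matrix_vector_mul_assoc)
qed

section \<open>The gradient of X\<close>

definition X_poly :: "complex ^ 8 \<Rightarrow> real" where
  "X_poly y = Re (cnj (y $ 2) * cnj (y $ 3) * cnj (y $ 4) * y $ 6 * y $ 7 * y $ 8)"

definition X_grad :: "complex ^ 8 \<Rightarrow> complex ^ 8" where
  "X_grad y = vector [0,
     cnj (y $ 3) * cnj (y $ 4) * y $ 6 * y $ 7 * y $ 8,
     cnj (y $ 2) * cnj (y $ 4) * y $ 6 * y $ 7 * y $ 8,
     cnj (y $ 2) * cnj (y $ 3) * y $ 6 * y $ 7 * y $ 8,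
     0,
     y $ 2 * y $ 3 * y $ 4 * cnj (y $ 7) * cnj (y $ 8),
     y $ 2 * y $ 3 * y $ 4 * cnj (y $ 6) * cnj (y $ 8),
     y $ 2 * y $ 3 * y $ 4 * cnj (y $ 6) * cnj (y $ 7)]"

lemma has_derivative_vec_nth [derivative_intros]:
  "(f has_derivative f') F \<Longrightarrow> ((\<lambda>x. f x $ i) has_derivative (\<lambda>x. f' x $ i)) F"
  by (rule bounded_linear.has_derivative[OF bounded_linear_vec_nth])

lemma inner_Re: "z \<bullet> w = Re (cnj w * z)" and inner_Re': "z \<bullet> w = Re (cnj z * w)" for z w :: complex
  by (simp_all add: inner_complex_def algebra_simps)

lemma X_poly_derivative: "(X_poly has_derivative (\<lambda>\<zeta>. X_grad y \<bullet> \<zeta>)) (at y)"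
proof -
  let ?d = "\<lambda>\<zeta>. Re (cnj (\<zeta> $ 2) * (cnj (y $ 3) * cnj (y $ 4) * y $ 6 * y $ 7 * y $ 8))
    + Re (cnj (\<zeta> $ 3) * (cnj (y $ 2) * cnj (y $ 4) * y $ 6 * y $ 7 * y $ 8))
    + Re (cnj (\<zeta> $ 4) * (cnj (y $ 2) * cnj (y $ 3) * y $ 6 * y $ 7 * y $ 8))
    + Re (cnj (y $ 2) * cnj (y $ 3) * cnj (y $ 4) * y $ 7 * y $ 8 * \<zeta> $ 6)
    + Re (cnj (y $ 2) * cnj (y $ 3) * cnj (y $ 4) * y $ 6 * y $ 8 * \<zeta> $ 7)
    + Re (cnj (y $ 2) * cnj (y $ 3) * cnj (y $ 4) * y $ 6 * y $ 7 * \<zeta> $ 8)"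
  have "(X_poly has_derivative ?d) (at y)"
    unfolding X_poly_def[abs_def]
    by (rule derivative_eq_intros refl)+
      (simp only: fun_eq_iff plus_complex.sel(1)[symmetric], simp add: algebra_simps)
  moreover have "?d \<zeta> = X_grad y \<bullet> \<zeta>" for \<zeta>
    unfolding inner_vec_def sum_8
    by (simp only: X_grad_def vector_8 inner_zero_left inner_Re[of _ "\<zeta> $ 2"] inner_Re[of _ "\<zeta> $ 3"]
        inner_Re[of _ "\<zeta> $ 4"] inner_Re'[of _ "\<zeta> $ 6"] inner_Re'[of _ "\<zeta> $ 7"] inner_Re'[of _ "\<zeta> $ 8"]
        complex_cnj_mult complex_cnj_cnj add_0_left add_0_right)
  ultimately show ?thesis by simp
qed

lemma differentiable_vecI:
  fixes f :: "'a::real_normed_vector \<Rightarrow> 'b::euclidean_space ^ 'n"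
  assumes "\<And>i. (\<lambda>x. f x $ i) differentiable (at x)"
  shows "f differentiable (at x)"
proof -
  have "(\<lambda>x. axis i (f x $ i) :: 'b ^ 'n) differentiable (at x)" for i
  proof -
    obtain D where "((\<lambda>x. f x $ i) has_derivative D) (at x)"
      using assms[of i] unfolding differentiable_def by blast
    from bounded_linear.has_derivative[OF bounded_linear_axis this] show ?thesis
      unfolding differentiable_def by blast
  qed
  then have "(\<lambda>x. \<Sum>i\<in>UNIV. axis i (f x $ i)) differentiable (at x)"
    by (intro differentiable_sum) auto
  then show ?thesis by (simp only: sum_axis_nth)
qed

lemma X_grad_differentiable: "X_grad differentiable (at y)"
proof (rule differentiable_vecI)
  have "\<forall>i. (\<lambda>y. X_grad y $ i) differentiable (at y)"
    unfolding forall_8 X_grad_def vector_8 differentiable_def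
    by (intro conjI; rule exI; (rule derivative_intros)+)
  then show "(\<lambda>y. X_grad y $ i) differentiable (at y)" for i by blast
qed

text \<open>The derivative of \<open>X_poly\<close> along the orbits vanishes, computed from the phases: each conjugated factor
  of the monomial contributes its phase and each unconjugated one minus its phase, and these add up to \<open>0\<close>.\<close>

lemma X_grad_orbit: "X_grad y \<bullet> times_i (weighted t y) = 0"
proof -
  define M where "M = cnj (y $ 2) * cnj (y $ 3) * cnj (y $ 4) * y $ 6 * y $ 7 * y $ 8"
  have cj: "g \<bullet> (\<i> * (p *\<^sub>R x)) = p * Im m" if "cnj x * g = m" for g x m p
    unfolding that[symmetric] inner_Re by (simp add: algebra_simps)
  have hol: "g \<bullet> (\<i> * (p *\<^sub>R x)) = - p * Im m" if "cnj g * x = m" for g x m p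
    unfolding that[symmetric] inner_Re' by (simp add: algebra_simps)
  have e2: "X_grad y $ 2 \<bullet> (\<i> * (phase t $ 2 *\<^sub>R y $ 2)) = phase t $ 2 * Im M"
    by (rule cj) (simp add: X_grad_def M_def mult_ac)
  have e3: "X_grad y $ 3 \<bullet> (\<i> * (phase t $ 3 *\<^sub>R y $ 3)) = phase t $ 3 * Im M"
    by (rule cj) (simp add: X_grad_def M_def mult_ac)
  have e4: "X_grad y $ 4 \<bullet> (\<i> * (phase t $ 4 *\<^sub>R y $ 4)) = phase t $ 4 * Im M"
    by (rule cj) (simp add: X_grad_def M_def mult_ac)
  have e6: "X_grad y $ 6 \<bullet> (\<i> * (phase t $ 6 *\<^sub>R y $ 6)) = - phase t $ 6 * Im M"
    by (rule hol) (simp add: X_grad_def M_def mult_ac)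
  have e7: "X_grad y $ 7 \<bullet> (\<i> * (phase t $ 7 *\<^sub>R y $ 7)) = - phase t $ 7 * Im M"
    by (rule hol) (simp add: X_grad_def M_def mult_ac)
  have e8: "X_grad y $ 8 \<bullet> (\<i> * (phase t $ 8 *\<^sub>R y $ 8)) = - phase t $ 8 * Im M"
    by (rule hol) (simp add: X_grad_def M_def mult_ac)
  have e1: "X_grad y $ 1 = 0" and e5: "X_grad y $ 5 = 0"
    by (simp_all add: X_grad_def)
  have "X_grad y \<bullet> times_i (weighted t y) =
      (phase t $ 2 + phase t $ 3 + phase t $ 4 - phase t $ 6 - phase t $ 7 - phase t $ 8) * Im M"
    unfolding inner_vec_def sum_8 times_i_def weighted_def vec_lambda_beta e1 e2 e3 e4 e5 e6 e7 e8
    by (simp add: algebra_simps)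
  also have "\<dots> = 0" by (simp add: phase_def)
  finally show ?thesis .
qed

section \<open>The torus action\<close>

lemma act_nth: "act t z $ k = cis (phase t $ k) * z $ k"
  by (simp add: act_def)

lemma act_add: "act s (act t z) = act (s + t) z"
  by (simp add: vec_eq_iff act_nth phase_add cis_mult[symmetric] mult.assoc)

lemma act_zero: "act 0 z = z"
  using linear_0[OF phase_linear] by (simp add: vec_eq_iff act_nth)

lemma act_minus_act [simp]: "act (- t) (act t z) = z" "act t (act (- t) z) = z"
  by (simp_all add: act_add act_zero)

lemma tau_act: "tau (act t z) = tau z"
proof -
  have "tau (act t z) = range (\<lambda>s. act (s + t) z)"
    by (simp add: tau_def act_add)
  also have "\<dots> = tau z"
    unfolding tau_def by (auto simp: image_iff) (metis diff_add_cancel)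
  finally show ?thesis .
qed

lemma tau_eq_iff: "tau z = tau z' \<longleftrightarrow> (\<exists>t. z' = act t z)"
proof
  assume "tau z = tau z'"
  moreover have "z' \<in> tau z'" unfolding tau_def using act_zero by (metis rangeI)
  ultimately show "\<exists>t. z' = act t z" by (auto simp: tau_def)
qed (auto simp: tau_act)

lemma act_inner: "act t u \<bullet> act t v = u \<bullet> v"
proof -
  have "(cis p * x) \<bullet> (cis p * y) = x \<bullet> y" for p x y
  proof -
    have "cnj (cis p * x) * (cis p * y) = (cnj (cis p) * cis p) * (cnj x * y)"
      by (simp add: mult_ac)
    also have "\<dots> = cnj x * y" by (simp add: cis_cnj cis_mult)
    finally show ?thesis by (simp only: inner_Re')
  qed
  then show ?thesis by (simp add: inner_vec_def act_nth)
qed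

lemma linear_act: "linear (act t)"
  by (rule linearI) (auto simp: vec_eq_iff act_nth algebra_simps)

lemma weighted_act: "weighted s (act t z) = act t (weighted s z)"
  by (simp add: vec_eq_iff act_nth weighted_def)

lemma level_tangent_act: "\<zeta> \<in> level_tangent (act t z) \<longleftrightarrow> act (- t) \<zeta> \<in> level_tangent z"
proof -
  have "weighted s (act t z) \<bullet> \<zeta> = weighted s z \<bullet> act (- t) \<zeta>" for s
    using act_inner[of t "weighted s z" "act (- t) \<zeta>"] by (simp add: weighted_act)
  then show ?thesis by (simp add: level_tangent_def)
qed

lemma X_poly_act: "X_poly (act t z) = X_poly z"
  using X_fun_tau[of "act t z"] X_fun_tau[of z] by (simp add: tau_act X_poly_def)

lemma X_grad_act: "X_grad (act t z) \<bullet> \<zeta> = X_grad z \<bullet> act (- t) \<zeta>"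
proof -
  have bl: "bounded_linear (act t)" using linear_act by (simp add: linear_conv_bounded_linear)
  have "((\<lambda>y. X_poly (act t y)) has_derivative (\<lambda>\<xi>. X_grad (act t z) \<bullet> act t \<xi>)) (at z)"
    by (rule has_derivative_compose[OF bounded_linear_imp_has_derivative[OF bl] X_poly_derivative])
  then have "(X_poly has_derivative (\<lambda>\<xi>. X_grad (act t z) \<bullet> act t \<xi>)) (at z)"
    by (simp only: X_poly_act)
  from has_derivative_unique[OF this X_poly_derivative]
  have "X_grad (act t z) \<bullet> act t (act (- t) \<zeta>) = X_grad z \<bullet> act (- t) \<zeta>"
    by (rule fun_cong)
  then show ?thesis by simp
qed

lemma F_sys_half:
  "F_sys \<gamma> (1 / 2) (tau z) = ((cmod (z $ 1))\<^sup>2 / 2, \<gamma> / 2 * X_poly z)"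
  by (simp add: F_sys_def J_fun_tau X_fun_tau X_poly_def)

section \<open>Critical points\<close>

text \<open>Criticality of \<open>J\<close> and \<open>X\<close> at \<open>tau z\<close>, expressed on the tangent space of the level set in order to be
  independent of any chart. The inner product with \<open>z $ 1\<close> is the derivative of \<open>|z\<^sub>1|\<^sup>2 / 2\<close>.\<close>

definition critical :: "complex ^ 8 \<Rightarrow> bool" where
  "critical z \<longleftrightarrow> (\<forall>\<zeta>\<in>level_tangent z. z $ 1 \<bullet> \<zeta> $ 1 = 0 \<and> X_grad z \<bullet> \<zeta> = 0)"

lemma critical_act:
  assumes "critical z"
  shows "critical (act t z)"
proof -
  have "act t z $ 1 \<bullet> \<zeta> $ 1 = z $ 1 \<bullet> act (- t) \<zeta> $ 1" for \<zeta>
  proof -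
    have "act t (axis 1 (z $ 1)) = axis 1 (act t z $ 1)"
      by (simp add: vec_eq_iff act_nth axis_def)
    then show ?thesis
      using act_inner[of t "axis 1 (z $ 1)" "act (- t) \<zeta>"] by (simp add: inner_axis')
  qed
  then show ?thesis
    using assms unfolding critical_def by (simp add: level_tangent_act X_grad_act)
qed

text \<open>A chart only tests directions tangent to its slice; the orbit directions, which are missing, do not change
  invariant functions.\<close>

lemma fixed_point_critical:
  assumes "\<gamma> \<noteq> 0" and "fixed_point (F_sys \<gamma> (1 / 2)) (tau z)"
  shows "critical z"
proof -
  obtain U \<sigma> u where chart: "slice_chart U \<sigma>" and u: "u \<in> U" and p: "tau (\<sigma> u) = tau z"
    and d: "((\<lambda>x. F_sys \<gamma> (1 / 2) (tau (\<sigma> x))) has_derivative (\<lambda>_. 0)) (at u)"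
    using assms(2) unfolding fixed_point_def chart_at_def by blast
  let ?D = "frechet_derivative \<sigma> (at u)"
  have D: "(\<sigma> has_derivative ?D) (at u)" by (rule chart_derivative[OF chart u])
  have "((\<lambda>x. \<sigma> x $ 1 \<bullet> \<sigma> x $ 1 / 2) has_derivative (\<lambda>v. \<sigma> u $ 1 \<bullet> ?D v $ 1)) (at u)"
    by (rule derivative_eq_intros D | simp add: inner_commute)+
  moreover have "((\<lambda>x. \<sigma> x $ 1 \<bullet> \<sigma> x $ 1 / 2) has_derivative (\<lambda>v. 0)) (at u)"
    using has_derivative_fst[OF d] by (simp add: F_sys_half power2_norm_eq_inner)
  ultimately have "(\<lambda>v. \<sigma> u $ 1 \<bullet> ?D v $ 1) = (\<lambda>v. 0)"
    by (rule has_derivative_unique)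
  then have J: "\<sigma> u $ 1 \<bullet> ?D v $ 1 = 0" for v by (rule fun_cong)
  have "((\<lambda>x. X_poly (\<sigma> x)) has_derivative (\<lambda>v. X_grad (\<sigma> u) \<bullet> ?D v)) (at u)"
    by (rule has_derivative_compose[OF D X_poly_derivative])
  moreover have "((\<lambda>x. X_poly (\<sigma> x)) has_derivative (\<lambda>v. 0)) (at u)"
    using has_derivative_mult_right[OF has_derivative_snd[OF d], of "2 / \<gamma>"] assms(1)
    by (simp add: F_sys_half)
  ultimately have "(\<lambda>v. X_grad (\<sigma> u) \<bullet> ?D v) = (\<lambda>v. 0)"
    by (rule has_derivative_unique)
  then have X: "X_grad (\<sigma> u) \<bullet> ?D v = 0" for v by (rule fun_cong)
  have "critical (\<sigma> u)"
    unfolding critical_def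
  proof
    fix \<zeta> assume "\<zeta> \<in> level_tangent (\<sigma> u)"
    then obtain v t where \<zeta>: "\<zeta> = ?D v + times_i (weighted t (\<sigma> u))"
      by (rule level_tangent_decompose[OF chart u])
    have "\<sigma> u $ 1 \<bullet> times_i (weighted t (\<sigma> u)) $ 1 = 0"
      by (simp add: times_i_def weighted_def inner_complex_def)
    then show "\<sigma> u $ 1 \<bullet> \<zeta> $ 1 = 0 \<and> X_grad (\<sigma> u) \<bullet> \<zeta> = 0"
      using J X X_grad_orbit by (simp add: \<zeta> inner_add_right)
  qed
  then show ?thesis
    using p critical_act unfolding tau_eq_iff by metis
qed

text \<open>Away from the edges \<open>z\<^sub>1 = 0\<close> and \<open>z\<^sub>5 = 0\<close> of the octagon and its four vertices not on them,
  \<open>|z\<^sub>1|\<^sup>2\<close> can be varied to first order: change \<open>(|z\<^sub>5|\<^sup>2, |z\<^sub>7|\<^sup>2)\<close> in the direction \<open>(1, \<beta>)\<close>, where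
  \<open>\<beta>\<close> is the slope of the edge that the point lies on, if any.\<close>

lemma critical_cases:
  assumes z: "z \<in> level_W" and "critical z"
  shows "z $ 1 = 0 \<or> z $ 5 = 0 \<or> (z $ 7 = 0 \<and> z $ 8 = 0) \<or> (z $ 7 = 0 \<and> z $ 6 = 0)
    \<or> (z $ 3 = 0 \<and> z $ 4 = 0) \<or> (z $ 3 = 0 \<and> z $ 2 = 0)"
proof (rule ccontr)
  assume nz: "\<not> ?thesis"
  define A B where "A = (cmod (z $ 5))\<^sup>2" and "B = (cmod (z $ 7))\<^sup>2"
  have Z: "(cmod (z $ 1))\<^sup>2 = 6 - A" "(cmod (z $ 2))\<^sup>2 = 10 - A - B"
    "(cmod (z $ 3))\<^sup>2 = 6 - B" "(cmod (z $ 4))\<^sup>2 = 4 + A - B"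
    "(cmod (z $ 6))\<^sup>2 = A + B - 2" "(cmod (z $ 8))\<^sup>2 = 4 - A + B"
    using z unfolding level_W_def A_def B_def by auto
  have nn: "6 - A \<ge> 0" "10 - A - B \<ge> 0" "6 - B \<ge> 0" "4 + A - B \<ge> 0" "A + B - 2 \<ge> 0"
    "4 - A + B \<ge> 0" "A \<ge> 0" "B \<ge> 0"
    using Z[symmetric] by (simp_all add: A_def B_def)
  have n: "z $ k = 0 \<longleftrightarrow> (cmod (z $ k))\<^sup>2 = 0" for k by simp
  have zero: "z $ 1 = 0 \<longleftrightarrow> A = 6" "z $ 2 = 0 \<longleftrightarrow> A + B = 10" "z $ 3 = 0 \<longleftrightarrow> B = 6"
    "z $ 4 = 0 \<longleftrightarrow> B = 4 + A" "z $ 5 = 0 \<longleftrightarrow> A = 0" "z $ 6 = 0 \<longleftrightarrow> A + B = 2"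
    "z $ 7 = 0 \<longleftrightarrow> B = 0" "z $ 8 = 0 \<longleftrightarrow> A = 4 + B"
    unfolding n Z A_def[symmetric] B_def[symmetric] by linarith+
  define \<beta> :: real where "\<beta> = (if B = 4 + A \<or> A = 4 + B then 1 else if A + B = 10 \<or> A + B = 2 then -1 else 0)"
  define \<delta> :: "real ^ 8" where "\<delta> = vector [-1, - 1 - \<beta>, - \<beta>, 1 - \<beta>, 1, 1 + \<beta>, \<beta>, \<beta> - 1]"
  define \<zeta> :: "complex ^ 8" where "\<zeta> = (\<chi> k. (\<delta> $ k / (cmod (z $ k))\<^sup>2) *\<^sub>R z $ k)"
  have "\<forall>k. z $ k = 0 \<longrightarrow> \<delta> $ k = 0"
    using nz nn unfolding forall_8 zero \<delta>_def vector_8 \<beta>_def by (auto split: if_splits)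
  then have \<zeta>: "z $ k \<bullet> \<zeta> $ k = \<delta> $ k" for k
    by (cases "z $ k = 0") (auto simp: \<zeta>_def power2_norm_eq_inner)
  have "weighted t z \<bullet> \<zeta> = (\<Sum>k\<in>UNIV. phase t $ k * \<delta> $ k)" for t
    by (simp add: inner_vec_def weighted_def \<zeta>)
  also have "\<dots> t = 0" for t
    by (simp add: sum_8 phase_def \<delta>_def algebra_simps)
  finally have "\<zeta> \<in> level_tangent z" by (simp add: level_tangent_def)
  then have "z $ 1 \<bullet> \<zeta> $ 1 = 0" using \<open>critical z\<close> by (simp add: critical_def)
  then show False by (simp add: \<zeta> \<delta>_def)
qed

section \<open>Critical points over an edge\<close>

text \<open>Applying the combination of linearised Hamiltonian vector fields amounts to solving a linear system with
  matrix \<open>omega_mat \<sigma> u\<close>, so its inverse need not be computed.\<close>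

lemma lin_comb_mult:
  assumes "invertible (omega_mat \<sigma> u)"
    and "omega_mat \<sigma> u *v x = a *\<^sub>R (d2_1 f \<sigma> u *v w) + b *\<^sub>R (d2_2 f \<sigma> u *v w)"
  shows "lin_comb f \<sigma> u a b *v w = x"
proof -
  let ?I = "matrix_inv (omega_mat \<sigma> u)"
  have "lin_comb f \<sigma> u a b *v w = ?I *v (a *\<^sub>R (d2_1 f \<sigma> u *v w) + b *\<^sub>R (d2_2 f \<sigma> u *v w))"
    by (simp add: lin_comb_def matrix_vector_mult_add_rdistrib matrix_vector_right_distrib
        scaleR_matrix_vector_assoc[symmetric] matrix_vector_mul_assoc[symmetric]
        matrix_vector_mult_scaleR)
  then show ?thesis using matrix_inv_mult_eq[OF assms(1,2)] by simp
qed

text \<open>The eigenvector is \<open>x + \<i> y\<close>.\<close>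

lemma eigenvalues_imaginary:
  fixes A :: "real ^ 4 ^ 4"
  assumes x: "A *v x = - k *\<^sub>R y" and y: "A *v y = k *\<^sub>R x" and "x \<noteq> 0"
  shows "Complex 0 k \<in> eigenvalues A"
proof -
  define v :: "complex ^ 4" where "v = (\<chi> j. Complex (x $ j) (y $ j))"
  have "((\<chi> i j. complex_of_real (A $ i $ j)) *v v) $ i = Complex ((A *v x) $ i) ((A *v y) $ i)" for i
    by (simp add: matrix_vector_mult_def v_def complex_eq_iff)
  moreover have "Complex ((A *v x) $ i) ((A *v y) $ i) = Complex 0 k * v $ i" for i
    by (simp add: x y v_def complex_eq_iff)
  ultimately have "(\<chi> i j. complex_of_real (A $ i $ j)) *v v = Complex 0 k *s v"
    by (simp add: vec_eq_iff)
  moreover have "v \<noteq> 0"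
    using \<open>x \<noteq> 0\<close> by (auto simp: v_def vec_eq_iff complex_eq_iff)
  ultimately show ?thesis unfolding eigenvalues_def by blast
qed

text \<open>At a critical point with \<open>z\<^sub>1 = 0\<close> the circle action rotating \<open>z\<^sub>1\<close> fixes the point, and both
  Hessians are invariant under its linearisation. On the plane that it rotates they are therefore
  multiples of \<open>|\<zeta>\<^sub>1|\<^sup>2\<close>, and the plane contributes a pair of imaginary eigenvalues.\<close>

lemma imaginary_eigenvalue_on_edge:
  assumes chart: "slice_chart U \<sigma>" and u: "u \<in> U"
    and edge: "\<sigma> u $ 1 = 0" and crit: "critical (\<sigma> u)"
  shows "\<exists>k. Complex 0 k \<in> eigenvalues (lin_comb (F_sys \<gamma> (1 / 2)) \<sigma> u a b)"
proof -
  let ?D = "frechet_derivative \<sigma> (at u)" and ?z = "\<sigma> u" and ?F = "F_sys \<gamma> (1 / 2)"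
  have smooth: "smooth_on U \<sigma>" by (rule chart_smooth[OF chart])
  \<comment> \<open>The tangent vectors rotated by the circle are represented by the first coordinate axis.\<close>
  have "\<exists>w t. ?D w = axis 1 c + times_i (weighted t ?z)" for c :: complex
  proof -
    have "axis 1 c \<in> level_tangent ?z"
      by (simp add: level_tangent_def inner_axis weighted_def edge)
    then obtain w t where "axis 1 c = ?D w + times_i (weighted t ?z)"
      by (rule level_tangent_decompose[OF chart u])
    then have "?D w = axis 1 c + times_i (weighted (- t) ?z)"
      by (simp add: linear_neg[OF weighted_linear])
    then show ?thesis by blast
  qed
  then obtain w t where w: "\<And>c. ?D (w c) = axis 1 c + times_i (weighted (t c) ?z)" by metis
  have orb1: "times_i (weighted s ?z) $ 1 = 0" for s
    by (simp add: times_i_def weighted_def edge)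
  define r where "r c = (\<chi> i. ?D (axis i 1) $ 1 \<bullet> c)" for c :: complex
  have omega: "omega_mat \<sigma> u *v w c = r (\<i> * c)" for c
  proof -
    have "omega_st (?D (axis i 1)) (?D (w c)) = ?D (axis i 1) $ 1 \<bullet> (\<i> * c)" for i
    proof -
      have "times_i (axis 1 c) = axis 1 (\<i> * c)"
        by (simp add: times_i_def axis_def vec_eq_iff)
      then have "times_i (?D (w c)) = axis 1 (\<i> * c) - weighted (t c) ?z"
        by (simp add: w linear_add[OF linear_times_i])
      moreover have "?D (axis i 1) \<bullet> weighted (t c) ?z = 0"
        using chart_derivative_level_tangent[OF chart u]
        by (simp add: level_tangent_def inner_commute)
      ultimately show ?thesis by (simp add: omega_st_inner inner_diff_right inner_axis)
    qed
    then show ?thesis by (simp add: vec_eq_iff omega_mat_mult[OF chart u] r_def)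
  qed
  have J: "d2_1 ?F \<sigma> u *v w c = r c" for c
  proof -
    define g :: "complex ^ 8 \<Rightarrow> complex ^ 8" where "g y = axis 1 (y $ 1)" for y
    have "linear g" by (rule linearI) (auto simp: g_def axis_def vec_eq_iff)
    then have g: "(g has_derivative g) (at ?z)"
      using bounded_linear_imp_has_derivative linear_conv_bounded_linear by blast
    have G: "((\<lambda>y. y $ 1 \<bullet> y $ 1 / 2) has_derivative (\<lambda>\<zeta>. g y \<bullet> \<zeta>)) (at y)" for y :: "complex ^ 8"
    proof -
      have "((\<lambda>y. y $ 1 \<bullet> y $ 1) has_derivative (\<lambda>\<zeta>. y $ 1 \<bullet> \<zeta> $ 1 + \<zeta> $ 1 \<bullet> y $ 1)) (at y)"
        by (intro has_derivative_inner bounded_linear_imp_has_derivative bounded_linear_vec_nth)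
      from bounded_linear.has_derivative[OF bounded_linear_divide this, of 2] show ?thesis
        by (rule has_derivative_eq_rhs) (simp add: fun_eq_iff inner_commute g_def inner_axis)
    qed
    have "(d2_1 ?F \<sigma> u *v w c) $ i = g (?D (axis i 1)) \<bullet> ?D (w c)" for i
      unfolding d2_1_def
      by (rule hessian_compose_mult[OF smooth u G g, of _ 0])
        (simp_all add: g_def edge F_sys_half power2_norm_eq_inner)
    then show ?thesis
      by (simp add: vec_eq_iff r_def w g_def inner_axis' orb1)
  qed
  obtain l where l: "(\<gamma> / 2) *\<^sub>R X_grad ?z = weighted l ?z"
  proof (rule orthogonal_level_tangent)
    show "(\<gamma> / 2) *\<^sub>R X_grad ?z \<bullet> v = 0" if "v \<in> level_tangent ?z" for v
      using crit that by (simp add: critical_def)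
  qed
  have X: "d2_2 ?F \<sigma> u *v w c = - phase l $ 1 *\<^sub>R r c" for c
  proof -
    \<comment> \<open>\<open>l\<close> is the Lagrange multiplier of \<open>X\<close> at \<open>\<sigma> u\<close>; subtracting it from \<open>X\<close>
      makes the full gradient vanish there.\<close>
    define g where "g y = (\<gamma> / 2) *\<^sub>R X_grad y - weighted l y" for y
    define G where "G y = \<gamma> / 2 * X_poly y - weighted l y \<bullet> y / 2" for y
    define k where "k = (6 * l $ 1 + 10 * l $ 2 + 6 * l $ 3 + 4 * l $ 4 - 2 * l $ 5 + 4 * l $ 6) / 2"
    have "g differentiable (at ?z)"
      unfolding g_def
      by (intro differentiable_diff differentiable_scaleR differentiable_const X_grad_differentiable
          bounded_linear_imp_differentiable bounded_linear_weighted)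
    then obtain g' where g': "(g has_derivative g') (at ?z)" by (auto simp: differentiable_def)
    have G: "(G has_derivative (\<lambda>\<zeta>. g y \<bullet> \<zeta>)) (at y)" for y
    proof -
      have "((\<lambda>y. weighted l y \<bullet> y) has_derivative (\<lambda>\<zeta>. weighted l y \<bullet> \<zeta> + weighted l \<zeta> \<bullet> y)) (at y)"
        by (intro has_derivative_inner has_derivative_ident
            bounded_linear_imp_has_derivative bounded_linear_weighted)
      then have Q: "((\<lambda>y. weighted l y \<bullet> y) has_derivative (\<lambda>\<zeta>. 2 * (weighted l y \<bullet> \<zeta>))) (at y)"
        by (rule has_derivative_eq_rhs) (simp add: fun_eq_iff weighted_inner_commute[of l _ y])
      show ?thesis unfolding G_def[abs_def]
        by (rule has_derivative_eq_rhs,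
            rule has_derivative_diff[OF has_derivative_mult_right[OF X_poly_derivative, of "\<gamma> / 2"]
              bounded_linear.has_derivative[OF bounded_linear_divide Q, of 2]])
          (simp add: fun_eq_iff g_def inner_diff_left)
    qed
    have hess: "(d2_2 ?F \<sigma> u *v w c) $ i = g' (?D (axis i 1)) \<bullet> ?D (w c)" for i
      unfolding d2_2_def
    proof (rule hessian_compose_mult[OF smooth u G g', of _ k])
      show "g ?z = 0" by (simp add: g_def l)
      show "snd (?F (tau (\<sigma> x))) = G (\<sigma> x) + k" if "x \<in> U" for x
        using level_W_weighted[OF chart_level[OF chart that], of l]
        by (simp add: F_sys_half G_def k_def)
    qed
    have first: "g' \<zeta> $ 1 = - phase l $ 1 *\<^sub>R \<zeta> $ 1" for \<zeta>
    proof -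
      have "(\<lambda>y. g y $ 1) = (\<lambda>y. - phase l $ 1 *\<^sub>R y $ 1)"
        by (simp add: fun_eq_iff g_def X_grad_def weighted_def)
      moreover have "((\<lambda>y. - phase l $ 1 *\<^sub>R y $ 1) has_derivative (\<lambda>\<zeta>. - phase l $ 1 *\<^sub>R \<zeta> $ 1)) (at ?z)"
        by (intro derivative_intros)
      moreover have "((\<lambda>y. g y $ 1) has_derivative (\<lambda>\<zeta>. g' \<zeta> $ 1)) (at ?z)"
        by (intro derivative_intros g')
      ultimately have "(\<lambda>\<zeta>. g' \<zeta> $ 1) = (\<lambda>\<zeta>. - phase l $ 1 *\<^sub>R \<zeta> $ 1)"
        using has_derivative_unique by metis
      then show ?thesis by (rule fun_cong)
    qed
    \<comment> \<open>Differentiating the invariance of \<open>G\<close> under the torus at a zero of its gradient.\<close>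
    have orb: "g' \<zeta> \<bullet> times_i (weighted s ?z) = 0" for \<zeta> s
    proof -
      have bl: "bounded_linear (\<lambda>y. times_i (weighted s y))"
        by (rule bounded_linear_compose[OF bounded_linear_times_i bounded_linear_weighted])
      have "((\<lambda>y. g y \<bullet> times_i (weighted s y)) has_derivative
          (\<lambda>\<zeta>. g ?z \<bullet> times_i (weighted s \<zeta>) + g' \<zeta> \<bullet> times_i (weighted s ?z))) (at ?z)"
        by (intro has_derivative_inner g' bounded_linear_imp_has_derivative bl)
      moreover have "(\<lambda>y. g y \<bullet> times_i (weighted s y)) = (\<lambda>y. 0)"
        by (simp add: g_def inner_diff_left X_grad_orbit weighted_inner_orbit)
      ultimately have "((\<lambda>y :: complex ^ 8. 0 :: real) has_derivative
          (\<lambda>\<zeta>. g ?z \<bullet> times_i (weighted s \<zeta>) + g' \<zeta> \<bullet> times_i (weighted s ?z))) (at ?z)" by simp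
      from has_derivative_unique[OF this has_derivative_const]
      have "g ?z \<bullet> times_i (weighted s \<zeta>) + g' \<zeta> \<bullet> times_i (weighted s ?z) = 0"
        by (rule fun_cong)
      then show ?thesis by (simp add: g_def l)
    qed
    show ?thesis
      by (simp add: vec_eq_iff hess w inner_add_right orb inner_axis first r_def)
  qed
  define k where "k = a - b * phase l $ 1"
  have minus: "r (- c) = - r c" for c by (simp add: r_def vec_eq_iff)
  have "a *\<^sub>R (d2_1 ?F \<sigma> u *v w c) + b *\<^sub>R (d2_2 ?F \<sigma> u *v w c) = k *\<^sub>R r c" for c
    by (simp add: J X k_def scaleR_diff_left)
  then have lc: "lin_comb ?F \<sigma> u a b *v w c = x" if "omega_mat \<sigma> u *v x = k *\<^sub>R r c" for c x
    by (intro lin_comb_mult[OF omega_mat_invertible[OF chart u]]) (simp add: that)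
  have "lin_comb ?F \<sigma> u a b *v w 1 = - k *\<^sub>R w \<i>"
    by (intro lc, simp only: matrix_vector_mult_scaleR omega) (simp add: minus)
  moreover have "lin_comb ?F \<sigma> u a b *v w \<i> = k *\<^sub>R w 1"
    using omega[of 1] by (intro lc) (simp add: matrix_vector_mult_scaleR)
  moreover have "w 1 \<noteq> 0"
  proof
    assume "w 1 = 0"
    then have "?D (w 1) = 0" by (simp add: linear_0[OF chart_derivative_linear[OF chart u]])
    then have "?D (w 1) $ 1 = 0" by simp
    then show False by (simp add: w orb1)
  qed
  ultimately show ?thesis using eigenvalues_imaginary by blast
qed

lemma not_focus_focus_on_edge:
  assumes "\<gamma> \<noteq> 0" and "z $ 1 = 0"
  shows "\<not> focus_focus (F_sys \<gamma> (1 / 2)) (tau z)"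
proof
  assume ff: "focus_focus (F_sys \<gamma> (1 / 2)) (tau z)"
  then obtain U \<sigma> u a b \<alpha> \<beta> where chart: "slice_chart U \<sigma>" and u: "u \<in> U" and p: "tau (\<sigma> u) = tau z"
    and "\<alpha> \<noteq> 0" and ev: "eigenvalues (lin_comb (F_sys \<gamma> (1 / 2)) \<sigma> u a b) =
          {Complex \<alpha> \<beta>, Complex \<alpha> (- \<beta>), Complex (- \<alpha>) \<beta>, Complex (- \<alpha>) (- \<beta>)}"
    unfolding focus_focus_def chart_at_def by blast
  have "critical (\<sigma> u)"
    using ff fixed_point_critical[OF assms(1)] by (simp add: focus_focus_def p)
  moreover have "\<sigma> u $ 1 = 0"
    using p[symmetric] assms(2) by (auto simp: tau_eq_iff act_nth)
  ultimately obtain k where "Complex 0 k \<in> eigenvalues (lin_comb (F_sys \<gamma> (1 / 2)) \<sigma> u a b)"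
    using imaginary_eigenvalue_on_edge[OF chart u] by blast
  then show False using \<open>\<alpha> \<noteq> 0\<close> by (simp add: ev)
qed

section \<open>Symmetries\<close>

definition relabel :: "(8 \<Rightarrow> 8) \<Rightarrow> complex ^ 8 \<Rightarrow> complex ^ 8" where
  "relabel \<pi> z = (\<chi> k. z $ \<pi> k)"

text \<open>The last condition makes the permutation of coordinates normalise the torus action, so that it descends to
  the quotient.\<close>

definition level_symmetry :: "(8 \<Rightarrow> 8) \<Rightarrow> bool" where
  "level_symmetry \<pi> \<longleftrightarrow> (\<forall>k. \<pi> (\<pi> k) = k) \<and> (\<forall>z\<in>level_W. relabel \<pi> z \<in> level_W) \<and>
     (\<forall>t. \<exists>s. \<forall>k. phase s $ k = phase t $ \<pi> k)"

text \<open>These two involutions induce the reflections of the octagon in its axes of symmetry: \<open>flip_J\<close> replaces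
  \<open>|z\<^sub>5|\<^sup>2\<close> by \<open>6 - |z\<^sub>5|\<^sup>2\<close>, which is \<open>|z\<^sub>1|\<^sup>2\<close>, and \<open>flip_H\<close> replaces \<open>|z\<^sub>7|\<^sup>2\<close> by \<open>6 - |z\<^sub>7|\<^sup>2\<close>, which is \<open>|z\<^sub>3|\<^sup>2\<close>.\<close>

definition flip_J :: "8 \<Rightarrow> 8" where
  "flip_J k = (vector [5, 4, 3, 2, 1, 8, 7, 6] :: 8 ^ 8) $ k"

definition flip_H :: "8 \<Rightarrow> 8" where
  "flip_H k = (vector [1, 8, 7, 6, 5, 4, 3, 2] :: 8 ^ 8) $ k"

lemma relabel_nth [simp]: "relabel \<pi> z $ k = z $ \<pi> k"
  by (simp add: relabel_def)

lemma flip_J_simps [simp]: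
  "flip_J 1 = 5" "flip_J 2 = 4" "flip_J 3 = 3" "flip_J 4 = 2" "flip_J 5 = 1" "flip_J 6 = 8"
  "flip_J 7 = 7" "flip_J 8 = 6"
  unfolding flip_J_def vector_8 by (rule refl)+

lemma flip_H_simps [simp]:
  "flip_H 1 = 1" "flip_H 2 = 8" "flip_H 3 = 7" "flip_H 4 = 6" "flip_H 5 = 5" "flip_H 6 = 4"
  "flip_H 7 = 3" "flip_H 8 = 2"
  unfolding flip_H_def vector_8 by (rule refl)+

lemma level_symmetry_flip_J: "level_symmetry flip_J"
proof -
  have "\<exists>s. \<forall>k. phase s $ k = phase t $ flip_J k" for t
    by (rule exI[of _ "vector [phase t $ 5, phase t $ 4, phase t $ 3, phase t $ 2, phase t $ 8,
          phase t $ 6]"], unfold forall_8 flip_J_simps) (simp add: phase_def)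
  moreover have "relabel flip_J z \<in> level_W" if "z \<in> level_W" for z
    using that unfolding level_W_def mem_Collect_eq relabel_nth flip_J_simps by argo
  moreover have "\<forall>k. flip_J (flip_J k) = k"
    unfolding forall_8 flip_J_simps by blast
  ultimately show ?thesis by (simp add: level_symmetry_def)
qed

lemma level_symmetry_flip_H: "level_symmetry flip_H"
proof -
  have "\<exists>s. \<forall>k. phase s $ k = phase t $ flip_H k" for t
    by (rule exI[of _ "vector [phase t $ 1, phase t $ 8, phase t $ 7, phase t $ 6, phase t $ 4,
          phase t $ 2]"], unfold forall_8 flip_H_simps) (simp add: phase_def)
  moreover have "relabel flip_H z \<in> level_W" if "z \<in> level_W" for z
    using that unfolding level_W_def mem_Collect_eq relabel_nth flip_H_simps by argo
  moreover have "\<forall>k. flip_H (flip_H k) = k"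
    unfolding forall_8 flip_H_simps by blast
  ultimately show ?thesis by (simp add: level_symmetry_def)
qed

lemma X_poly_flip_J: "X_poly (relabel flip_J z) = X_poly z"
  by (simp add: X_poly_def mult_ac)

text \<open>The monomial itself is conjugated by \<open>flip_H\<close>.\<close>

lemma X_poly_flip_H: "X_poly (relabel flip_H z) = X_poly z"
proof -
  have "cnj (z $ 8) * cnj (z $ 7) * cnj (z $ 6) * z $ 4 * z $ 3 * z $ 2
      = cnj (cnj (z $ 2) * cnj (z $ 3) * cnj (z $ 4) * z $ 6 * z $ 7 * z $ 8)"
    by (simp add: mult_ac)
  then show ?thesis
    unfolding X_poly_def relabel_nth flip_H_simps by (simp only: cnj.sel)
qed

lemma J_flip_J:
  assumes "z \<in> level_W"
  shows "(cmod (relabel flip_J z $ 1))\<^sup>2 / 2 = 3 - (cmod (z $ 1))\<^sup>2 / 2"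
  using assms by (simp add: level_W_def)

lemma bounded_linear_relabel: "bounded_linear (relabel \<pi>)"
  by (intro linear_conv_bounded_linear[THEN iffD1] linearI) (auto simp: vec_eq_iff)

context
  fixes \<pi>
  assumes sym: "level_symmetry \<pi>"
begin

lemma relabel_relabel [simp]: "relabel \<pi> (relabel \<pi> z) = z"
  using sym by (simp add: level_symmetry_def vec_eq_iff)

lemma inj_relabel: "inj (relabel \<pi>)"
  by (metis injI relabel_relabel)

lemma relabel_level_W: "z \<in> level_W \<Longrightarrow> relabel \<pi> z \<in> level_W"
  using sym by (simp add: level_symmetry_def)

lemma relabel_inner: "relabel \<pi> u \<bullet> relabel \<pi> v = u \<bullet> v"
proof -
  have "bij \<pi>" using sym unfolding level_symmetry_def by (metis bijI')
  then have "(\<Sum>k\<in>UNIV. u $ \<pi> k \<bullet> v $ \<pi> k) = (\<Sum>k\<in>UNIV. u $ k \<bullet> v $ k)"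
    by (intro sum.reindex_bij_betw)
  then show ?thesis by (simp add: inner_vec_def)
qed

lemma omega_st_relabel: "omega_st (relabel \<pi> u) (relabel \<pi> v) = omega_st u v"
proof -
  have "times_i (relabel \<pi> v) = relabel \<pi> (times_i v)"
    by (simp add: times_i_def vec_eq_iff)
  then show ?thesis by (simp add: omega_st_inner relabel_inner)
qed

lemma relabel_act:
  obtains s where "\<And>z. relabel \<pi> (act t z) = act s (relabel \<pi> z)"
    and "\<And>z. relabel \<pi> (times_i (weighted t z)) = times_i (weighted s (relabel \<pi> z))"
proof -
  obtain s where "\<forall>k. phase s $ k = phase t $ \<pi> k"
    using sym unfolding level_symmetry_def by blast
  then show ?thesis
    by (intro that[of s]) (simp_all add: vec_eq_iff act_nth times_i_def weighted_def)
qed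

lemma tau_relabel: "tau (relabel \<pi> z) = relabel \<pi> ` tau z"
proof
  show "relabel \<pi> ` tau z \<subseteq> tau (relabel \<pi> z)"
  proof
    fix y assume "y \<in> relabel \<pi> ` tau z"
    then obtain t where t: "y = relabel \<pi> (act t z)" by (auto simp: tau_def)
    obtain s where "\<And>z. relabel \<pi> (act t z) = act s (relabel \<pi> z)"
      by (rule relabel_act[of t]) blast
    then show "y \<in> tau (relabel \<pi> z)" by (simp add: t tau_def)
  qed
  show "tau (relabel \<pi> z) \<subseteq> relabel \<pi> ` tau z"
  proof
    fix y assume "y \<in> tau (relabel \<pi> z)"
    then obtain t where t: "y = act t (relabel \<pi> z)" by (auto simp: tau_def)
    obtain s where s: "\<And>z. relabel \<pi> (act t z) = act s (relabel \<pi> z)"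
      by (rule relabel_act[of t]) blast
    have "y = relabel \<pi> (relabel \<pi> (act t (relabel \<pi> z)))" by (simp add: t)
    also have "\<dots> = relabel \<pi> (act s z)" by (simp only: s relabel_relabel)
    finally show "y \<in> relabel \<pi> ` tau z" by (auto simp: tau_def)
  qed
qed

lemma relabel_image_image: "relabel \<pi> ` relabel \<pi> ` p = p"
  by (simp add: image_image)

lemma relabel_derivative:
  assumes "slice_chart U \<sigma>" and "u \<in> U"
  shows "frechet_derivative (\<lambda>x. relabel \<pi> (\<sigma> x)) (at u) v =
    relabel \<pi> (frechet_derivative \<sigma> (at u) v)"
  using bounded_linear.has_derivative[OF bounded_linear_relabel chart_derivative[OF assms], of \<pi>]
  by (metis frechet_derivative_at)

lemma slice_chart_relabel:
  assumes "slice_chart U \<sigma>"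
  shows "slice_chart U (\<lambda>x. relabel \<pi> (\<sigma> x))"
  unfolding slice_chart_def
proof (intro conjI ballI allI impI)
  show "smooth_on U (\<lambda>x. relabel \<pi> (\<sigma> x))"
    by (rule smooth_on_compose_linear[OF bounded_linear_relabel chart_smooth[OF assms]])
  show "(\<lambda>x. relabel \<pi> (\<sigma> x)) ` U \<subseteq> level_W"
    using assms by (auto simp: slice_chart_def intro: relabel_level_W)
  show "inj_on (tau \<circ> (\<lambda>x. relabel \<pi> (\<sigma> x))) U"
    using assms
    unfolding slice_chart_def inj_on_def o_def tau_relabel inj_image_eq_iff[OF inj_relabel] by blast
  fix u v
  assume u: "u \<in> U"
    and "frechet_derivative (\<lambda>x. relabel \<pi> (\<sigma> x)) (at u) v \<in> orbit_tangent (relabel \<pi> (\<sigma> u))"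
  then obtain t where t: "relabel \<pi> (frechet_derivative \<sigma> (at u) v) =
      times_i (weighted t (relabel \<pi> (\<sigma> u)))"
    by (auto simp: relabel_derivative[OF assms u] orbit_tangent_weighted)
  obtain s where s: "\<And>z. relabel \<pi> (times_i (weighted t z)) = times_i (weighted s (relabel \<pi> z))"
    by (rule relabel_act[of t]) blast
  have "frechet_derivative \<sigma> (at u) v = times_i (weighted s (\<sigma> u))"
    using arg_cong[OF t, of "relabel \<pi>"] by (simp add: s)
  then show "v = 0"
    using assms u by (auto simp: slice_chart_def orbit_tangent_weighted)
qed

lemma local_rep_relabel:
  assumes "local_rep e x U \<sigma> V g"
  shows "local_rep (\<lambda>x. relabel \<pi> ` e x) x U (\<lambda>x. relabel \<pi> (\<sigma> x)) V g"
  using assms slice_chart_relabel by (simp add: local_rep_def tau_relabel)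

lemma embedded_sphere_relabel:
  assumes "embedded_sphere e"
  shows "embedded_sphere (\<lambda>x. relabel \<pi> ` e x)"
proof -
  have "inj_on (\<lambda>x. relabel \<pi> ` e x) (sphere 0 1)"
    using assms
    unfolding embedded_sphere_def inj_on_def inj_image_eq_iff[OF inj_relabel] by blast
  then show ?thesis
    using assms local_rep_relabel unfolding embedded_sphere_def by blast
qed

lemma transverse_at_relabel:
  assumes "transverse_at e1 e2 p"
  shows "transverse_at (\<lambda>x. relabel \<pi> ` e1 x) (\<lambda>x. relabel \<pi> ` e2 x) (relabel \<pi> ` p)"
  using assms local_rep_relabel unfolding transverse_at_def by blast

lemma double_pinched_torus_relabel:
  assumes "double_pinched_torus p q S"
  shows "double_pinched_torus (relabel \<pi> ` p) (relabel \<pi> ` q) ((`) (relabel \<pi>) ` S)"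
proof -
  have inj: "inj ((`) (relabel \<pi>))"
    by (auto simp: inj_def inj_image_eq_iff[OF inj_relabel])
  obtain e1 e2 where e: "embedded_sphere e1" "embedded_sphere e2"
      "S = e1 ` sphere 0 1 \<union> e2 ` sphere 0 1" "e1 ` sphere 0 1 \<inter> e2 ` sphere 0 1 = {p, q}"
      "transverse_at e1 e2 p" "transverse_at e1 e2 q"
    using assms unfolding double_pinched_torus_def by blast
  have "(\<lambda>x. relabel \<pi> ` e1 x) ` sphere 0 1 \<inter> (\<lambda>x. relabel \<pi> ` e2 x) ` sphere 0 1 =
      (`) (relabel \<pi>) ` (e1 ` sphere 0 1 \<inter> e2 ` sphere 0 1)"
    by (simp add: image_Int[OF inj] image_image)
  then have "(\<lambda>x. relabel \<pi> ` e1 x) ` sphere 0 1 \<inter> (\<lambda>x. relabel \<pi> ` e2 x) ` sphere 0 1 =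
      {relabel \<pi> ` p, relabel \<pi> ` q}"
    by (simp only: e(4) image_insert image_empty)
  moreover have "(`) (relabel \<pi>) ` S =
      (\<lambda>x. relabel \<pi> ` e1 x) ` sphere 0 1 \<union> (\<lambda>x. relabel \<pi> ` e2 x) ` sphere 0 1"
    by (simp only: e(3) image_Un image_image)
  moreover have "relabel \<pi> ` p \<noteq> relabel \<pi> ` q"
    using assms unfolding double_pinched_torus_def inj_image_eq_iff[OF inj_relabel] by blast
  ultimately show ?thesis
    unfolding double_pinched_torus_def
    using embedded_sphere_relabel[OF e(1)] embedded_sphere_relabel[OF e(2)]
      transverse_at_relabel[OF e(5)] transverse_at_relabel[OF e(6)]
    by (intro conjI exI[of _ "\<lambda>x. relabel \<pi> ` e1 x"] exI[of _ "\<lambda>x. relabel \<pi> ` e2 x"]) assumption+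
qed

lemma hessian_affine:
  assumes h: "smooth_on U h" and u: "u \<in> U" and h2: "\<And>x. x \<in> U \<Longrightarrow> h2 x = e * h x + (c :: real)"
  shows "hessian h2 u = e *\<^sub>R hessian h u"
proof -
  have "open U" using h by (simp add: smooth_on_def)
  have first: "frechet_derivative h2 (at x) v = e * frechet_derivative h (at x) v" if "x \<in> U" for x v
  proof -
    have "((\<lambda>x. e * h x + c) has_derivative (\<lambda>v. e * frechet_derivative h (at x) v)) (at x)"
      using has_derivative_add[OF has_derivative_mult_right[OF smooth_on_derivative[OF h that], of e]
          has_derivative_const[of c]] by simp
    then have "(h2 has_derivative (\<lambda>v. e * frechet_derivative h (at x) v)) (at x)"
      by (rule has_derivative_transform_within_open[OF _ \<open>open U\<close> that]) (simp add: h2)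
    then show ?thesis by (metis frechet_derivative_at)
  qed
  have "frechet_derivative (\<lambda>x. frechet_derivative h2 (at x) w) (at u) v =
      e * frechet_derivative (\<lambda>x. frechet_derivative h (at x) w) (at u) v" for v w
  proof -
    have "((\<lambda>x. e * frechet_derivative h (at x) w) has_derivative
        (\<lambda>v. e * frechet_derivative (\<lambda>x. frechet_derivative h (at x) w) (at u) v)) (at u)"
      using smooth_on_second_derivative[OF h u]
      by (intro has_derivative_mult_right) (simp add: frechet_derivative_works)
    from has_derivative_transform_within_open[OF this \<open>open U\<close> u,
        of "\<lambda>x. frechet_derivative h2 (at x) w"]
    have "((\<lambda>x. frechet_derivative h2 (at x) w) has_derivative
        (\<lambda>v. e * frechet_derivative (\<lambda>x. frechet_derivative h (at x) w) (at u) v)) (at u)"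
      by (simp add: first)
    then show ?thesis by (metis frechet_derivative_at)
  qed
  then show ?thesis by (simp add: hessian_def vec_eq_iff)
qed

text \<open>The sign \<open>e\<close> with which \<open>J\<close> may change is absorbed by the coefficient of its Hessian, so the same
  eigenvalues occur on both sides.\<close>

lemma focus_focus_relabel:
  assumes J: "\<And>z. z \<in> level_W \<Longrightarrow> (cmod (relabel \<pi> z $ 1))\<^sup>2 / 2 = e * ((cmod (z $ 1))\<^sup>2 / 2) + c"
    and e: "e * e = 1" and X: "\<And>z. X_poly (relabel \<pi> z) = X_poly z"
    and ff: "focus_focus (F_sys \<gamma> (1 / 2)) p"
  shows "focus_focus (F_sys \<gamma> (1 / 2)) (relabel \<pi> ` p)"
proof -
  let ?F = "F_sys \<gamma> (1 / 2)"
  have chart: "chart_at (relabel \<pi> ` p) U (\<lambda>x. relabel \<pi> (\<sigma> x)) u" if "chart_at p U \<sigma> u" for U \<sigma> u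
    using that slice_chart_relabel by (auto simp: chart_at_def tau_relabel)
  have F: "?F (tau (relabel \<pi> z)) = (e * fst (?F (tau z)) + c, snd (?F (tau z)))" if "z \<in> level_W" for z
    using J[OF that] X by (simp only: F_sys_half fst_conv snd_conv)
  have fixed: "fixed_point ?F (relabel \<pi> ` p)"
  proof -
    obtain U \<sigma> u where c: "chart_at p U \<sigma> u"
      and d: "((\<lambda>x. ?F (tau (\<sigma> x))) has_derivative (\<lambda>_. 0)) (at u)"
      using ff unfolding focus_focus_def fixed_point_def by blast
    have U: "open U" "u \<in> U" "\<And>x. x \<in> U \<Longrightarrow> \<sigma> x \<in> level_W"
      using c chart_open chart_level unfolding chart_at_def by blast+
    have "((\<lambda>x. (e * fst (?F (tau (\<sigma> x))) + c, snd (?F (tau (\<sigma> x))))) has_derivative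
        (\<lambda>v. (e * 0 + 0, 0))) (at u)"
      using has_derivative_fst[OF d] has_derivative_snd[OF d]
      by (intro has_derivative_Pair has_derivative_add has_derivative_mult_right) simp_all
    then have "((\<lambda>x. ?F (tau (relabel \<pi> (\<sigma> x)))) has_derivative (\<lambda>v. (e * 0 + 0, 0))) (at u)"
      by (rule has_derivative_transform_within_open[OF _ U(1,2)]) (simp add: F U(3))
    then show ?thesis
      using chart[OF c] unfolding fixed_point_def by (auto simp: zero_prod_def)
  qed
  obtain U \<sigma> u a b \<alpha> \<beta> where c: "chart_at p U \<sigma> u" and nd: "nondegenerate_at ?F \<sigma> u a b"
    and \<alpha>\<beta>: "\<alpha> \<noteq> 0" "\<beta> \<noteq> 0" and ev: "eigenvalues (lin_comb ?F \<sigma> u a b) =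
          {Complex \<alpha> \<beta>, Complex \<alpha> (- \<beta>), Complex (- \<alpha>) \<beta>, Complex (- \<alpha>) (- \<beta>)}"
    using ff unfolding focus_focus_def by blast
  let ?\<rho> = "\<lambda>x. relabel \<pi> (\<sigma> x)"
  have sc: "slice_chart U \<sigma>" and u: "u \<in> U" using c by (auto simp: chart_at_def)
  have om: "omega_mat ?\<rho> u = omega_mat \<sigma> u"
    by (simp add: omega_mat_def relabel_derivative[OF sc u] omega_st_relabel)
  have 1: "d2_1 ?F ?\<rho> u = e *\<^sub>R d2_1 ?F \<sigma> u"
    unfolding d2_1_def
  proof (rule hessian_affine[OF _ u])
    have "smooth_on U (\<lambda>x. (1 / 2) * ((Re (\<sigma> x $ 1))\<^sup>2 + (Im (\<sigma> x $ 1))\<^sup>2))"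
      using chart_smooth[OF sc] chart_open[OF sc]
      by (intro smooth_on_mult smooth_on_const smooth_on_add smooth_on_power2
          smooth_on_compose_linear[OF bounded_linear_Re] smooth_on_compose_linear[OF bounded_linear_Im]
          smooth_on_compose_linear[OF bounded_linear_vec_nth])
    then show "smooth_on U (\<lambda>x. fst (?F (tau (\<sigma> x))))"
      by (simp add: F_sys_half cmod_power2)
  qed (simp add: F chart_level[OF sc])
  have 2: "d2_2 ?F ?\<rho> u = d2_2 ?F \<sigma> u"
    by (simp add: d2_2_def F_sys_half X)
  have lc: "lin_comb ?F ?\<rho> u (e * a) b = lin_comb ?F \<sigma> u a b"
    using e by (simp add: lin_comb_def om 1 2 matrix_scalar_ac scalar_matrix_assoc[symmetric] mult_ac)
  have "nondegenerate_at ?F ?\<rho> u (e * a) b"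
  proof -
    have "c = 0 \<and> d = 0" if "c *\<^sub>R d2_1 ?F ?\<rho> u + d *\<^sub>R d2_2 ?F ?\<rho> u = 0" for c d
    proof -
      have "(c * e) *\<^sub>R d2_1 ?F \<sigma> u + d *\<^sub>R d2_2 ?F \<sigma> u = 0" using that by (simp add: 1 2)
      then have "c * e = 0 \<and> d = 0" using nd unfolding nondegenerate_at_def by blast
      then show ?thesis using e by auto
    qed
    then show ?thesis using nd unfolding nondegenerate_at_def by (simp add: lc)
  qed
  then show ?thesis
    using fixed chart[OF c] \<alpha>\<beta> ev lc unfolding focus_focus_def by metis
qed

end

lemma focus_focus_flip_J:
  "focus_focus (F_sys \<gamma> (1 / 2)) (tau z) \<Longrightarrow> focus_focus (F_sys \<gamma> (1 / 2)) (tau (relabel flip_J z))"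
  unfolding tau_relabel[OF level_symmetry_flip_J]
  by (rule focus_focus_relabel[OF level_symmetry_flip_J, of "- 1" 3])
    (simp_all add: J_flip_J X_poly_flip_J del: relabel_nth)

lemma focus_focus_flip_H:
  "focus_focus (F_sys \<gamma> (1 / 2)) (tau z) \<Longrightarrow> focus_focus (F_sys \<gamma> (1 / 2)) (tau (relabel flip_H z))"
  unfolding tau_relabel[OF level_symmetry_flip_H]
  by (rule focus_focus_relabel[OF level_symmetry_flip_H, of 1 0]) (simp_all add: X_poly_flip_H)

section \<open>A slice around a vertex of the octagon\<close>

text \<open>The level equations determine \<open>|z\<^sub>1|\<^sup>2, \<dots>, |z\<^sub>6|\<^sup>2\<close> from \<open>z\<^sub>7 = u\<^sub>1 + \<i> u\<^sub>2\<close> and \<open>z\<^sub>8 = u\<^sub>3 + \<i> u\<^sub>4\<close>.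
  The torus can make these six coordinates positive as long as they do not vanish, and then it has no
  freedom left; this is the slice below.\<close>

definition moduli :: "real ^ 4 \<Rightarrow> real ^ 6" where
  "moduli u = (let B = (u $ 1)\<^sup>2 + (u $ 2)\<^sup>2; A = 4 + B - ((u $ 3)\<^sup>2 + (u $ 4)\<^sup>2)
     in vector [6 - A, 10 - A - B, 6 - B, 4 + A - B, A, A + B - 2])"

definition slice :: "real ^ 4 \<Rightarrow> complex ^ 8" where
  "slice u = vector [of_real (sqrt (moduli u $ 1)), of_real (sqrt (moduli u $ 2)),
     of_real (sqrt (moduli u $ 3)), of_real (sqrt (moduli u $ 4)), of_real (sqrt (moduli u $ 5)),
     of_real (sqrt (moduli u $ 6)), Complex (u $ 1) (u $ 2), Complex (u $ 3) (u $ 4)]"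

definition slice_dom :: "(real ^ 4) set" where
  "slice_dom = {u. \<forall>k. 0 < moduli u $ k}"

lemma slice_nth:
  "slice u $ 1 = of_real (sqrt (moduli u $ 1))" "slice u $ 2 = of_real (sqrt (moduli u $ 2))"
  "slice u $ 3 = of_real (sqrt (moduli u $ 3))" "slice u $ 4 = of_real (sqrt (moduli u $ 4))"
  "slice u $ 5 = of_real (sqrt (moduli u $ 5))" "slice u $ 6 = of_real (sqrt (moduli u $ 6))"
  "slice u $ 7 = Complex (u $ 1) (u $ 2)" "slice u $ 8 = Complex (u $ 3) (u $ 4)"
  by (simp_all only: slice_def vector_8)

lemma moduli_nth:
  "moduli u $ 1 = 2 - ((u $ 1)\<^sup>2 + (u $ 2)\<^sup>2) + ((u $ 3)\<^sup>2 + (u $ 4)\<^sup>2)"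
  "moduli u $ 2 = 6 - 2 * ((u $ 1)\<^sup>2 + (u $ 2)\<^sup>2) + ((u $ 3)\<^sup>2 + (u $ 4)\<^sup>2)"
  "moduli u $ 3 = 6 - ((u $ 1)\<^sup>2 + (u $ 2)\<^sup>2)"
  "moduli u $ 4 = 8 - ((u $ 3)\<^sup>2 + (u $ 4)\<^sup>2)"
  "moduli u $ 5 = 4 + ((u $ 1)\<^sup>2 + (u $ 2)\<^sup>2) - ((u $ 3)\<^sup>2 + (u $ 4)\<^sup>2)"
  "moduli u $ 6 = 2 + 2 * ((u $ 1)\<^sup>2 + (u $ 2)\<^sup>2) - ((u $ 3)\<^sup>2 + (u $ 4)\<^sup>2)"
  by (simp_all add: moduli_def Let_def)

lemma slice_level:
  assumes "\<And>k. 0 \<le> moduli u $ k"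
  shows "slice u \<in> level_W"
proof -
  have sq: "(cmod (of_real (sqrt (moduli u $ k))))\<^sup>2 = moduli u $ k" for k
    using assms[of k] by simp
  have "(cmod (Complex x y))\<^sup>2 = x\<^sup>2 + y\<^sup>2" for x y by (simp add: cmod_power2)
  then show ?thesis
    unfolding level_W_def mem_Collect_eq slice_nth sq by (simp add: moduli_nth)
qed

lemma smooth_on_moduli: "open S \<Longrightarrow> smooth_on S (\<lambda>u. moduli u $ k)"
proof -
  assume S: "open S"
  have nth: "smooth_on S (\<lambda>u :: real ^ 4. u $ i)" for i
    by (rule smooth_on_linear[OF S bounded_linear_vec_nth])
  have "\<forall>k. smooth_on S (\<lambda>u. moduli u $ k)"
    unfolding forall_6 moduli_nth
    by (intro conjI smooth_on_add smooth_on_diff smooth_on_mult smooth_on_const smooth_on_power2 nth S)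
  then show ?thesis by blast
qed

lemma open_slice_dom: "open slice_dom"
proof -
  have "continuous_on UNIV (\<lambda>u. moduli u $ k)" for k
    using smooth_on_moduli[OF open_UNIV, of k] unfolding smooth_on_def by (metis C_k.simps(1))
  then have "open {u. 0 < moduli u $ k}" for k
    by (intro open_Collect_less continuous_on_const)
  then have "open (\<Inter>k\<in>UNIV. {u. 0 < moduli u $ k})" by (intro open_INT) auto
  moreover have "slice_dom = (\<Inter>k\<in>UNIV. {u. 0 < moduli u $ k})"
    by (auto simp: slice_dom_def)
  ultimately show ?thesis by simp
qed

lemma smooth_on_slice: "smooth_on slice_dom slice"
proof (rule smooth_on_vec[OF open_slice_dom])
  have sq: "smooth_on slice_dom (\<lambda>u. complex_of_real (sqrt (moduli u $ k)))" for k
    by (rule smooth_on_compose_linear[OF bounded_linear_of_real])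
      (rule smooth_on_sqrt[OF smooth_on_moduli[OF open_slice_dom]], simp add: slice_dom_def)
  have "bounded_linear (\<lambda>u :: real ^ 4. Complex (u $ i) (u $ j))" for i j
    by (intro linear_conv_bounded_linear[THEN iffD1] linearI) (auto simp: complex_eq_iff)
  then have lin: "smooth_on slice_dom (\<lambda>u. Complex (u $ i) (u $ j))" for i j
    by (intro smooth_on_linear open_slice_dom)
  have "\<forall>k. smooth_on slice_dom (\<lambda>u. slice u $ k)"
    unfolding forall_8 slice_nth by (intro conjI sq lin)
  then show "smooth_on slice_dom (\<lambda>u. slice u $ k)" for k by blast
qed

lemma slice_derivative:
  "u \<in> slice_dom \<Longrightarrow> (slice has_derivative frechet_derivative slice (at u)) (at u)"
  by (rule smooth_on_derivative[OF smooth_on_slice])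

lemma slice_derivative_nth:
  assumes "u \<in> slice_dom"
  shows "frechet_derivative slice (at u) v $ 7 = Complex (v $ 1) (v $ 2)"
    and "frechet_derivative slice (at u) v $ 8 = Complex (v $ 3) (v $ 4)"
proof -
  have lin: "((\<lambda>u. Complex (u $ i) (u $ j)) has_derivative (\<lambda>u. Complex (u $ i) (u $ j))) (at u)" for i j
    by (intro bounded_linear_imp_has_derivative linear_conv_bounded_linear[THEN iffD1] linearI)
      (auto simp: complex_eq_iff)
  note nth = has_derivative_vec_nth[OF slice_derivative[OF assms]]
  show "frechet_derivative slice (at u) v $ 7 = Complex (v $ 1) (v $ 2)"
    using fun_cong[OF has_derivative_unique[OF nth[of 7, unfolded slice_nth] lin], of v] .
  show "frechet_derivative slice (at u) v $ 8 = Complex (v $ 3) (v $ 4)"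
    using fun_cong[OF has_derivative_unique[OF nth[of 8, unfolded slice_nth] lin], of v] .
qed

text \<open>An orbit direction rotates the first six coordinates, whereas along the slice they stay real. So all six
  phases vanish.\<close>

lemma slice_transverse:
  assumes u: "u \<in> slice_dom" and "frechet_derivative slice (at u) v \<in> orbit_tangent (slice u)"
  shows "v = 0"
proof -
  let ?D = "frechet_derivative slice (at u)"
  obtain t where t: "?D v = times_i (weighted t (slice u))"
    using assms(2) by (auto simp: orbit_tangent_weighted)
  have real: "Im (?D v $ k) = 0" if "\<And>x. Im (slice x $ k) = 0" for k
  proof -
    have "((\<lambda>x. Im (slice x $ k)) has_derivative (\<lambda>v. Im (?D v $ k))) (at u)"
      by (intro derivative_intros slice_derivative u)
    then have "((\<lambda>x. 0) has_derivative (\<lambda>v. Im (?D v $ k))) (at u)" by (simp add: that)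
    from has_derivative_unique[OF this has_derivative_const] show ?thesis by (rule fun_cong)
  qed
  have "phase t $ k * Re (slice u $ k) = 0" if "\<And>x. Im (slice x $ k) = 0" for k
    using real[OF that] by (simp add: t times_i_def weighted_def)
  then have "phase t $ 1 = 0 \<and> phase t $ 2 = 0 \<and> phase t $ 3 = 0 \<and> phase t $ 4 = 0 \<and> phase t $ 5 = 0
      \<and> phase t $ 6 = 0"
    using u unfolding slice_dom_def mem_Collect_eq
    by (metis Im_complex_of_real Re_complex_of_real less_irrefl mult_eq_0_iff real_sqrt_eq_zero_cancel_iff slice_nth(1-6))
  then have "t = 0" by (auto simp: phase_def vec_eq_iff forall_6)
  then have "?D v = 0" by (simp add: t linear_0[OF weighted_linear])
  then have "Complex (v $ 1) (v $ 2) = 0" "Complex (v $ 3) (v $ 4) = 0"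
    using slice_derivative_nth[OF u, of v] by simp_all
  then show ?thesis by (simp add: vec_eq_iff forall_4 complex_eq_iff)
qed

lemma cis_eq_1_of_pos:
  assumes "complex_of_real a = cis p * complex_of_real b" and "0 < a" and "0 < b"
  shows "cis p = 1"
proof -
  have "a = b" using arg_cong[OF assms(1), of cmod] assms(2,3) by (simp add: norm_mult)
  then show ?thesis using assms by simp
qed

lemma slice_inj: "inj_on (tau \<circ> slice) slice_dom"
proof (rule inj_onI)
  fix u u' assume u: "u \<in> slice_dom" and u': "u' \<in> slice_dom" and "(tau \<circ> slice) u = (tau \<circ> slice) u'"
  then obtain t where t: "slice u' = act t (slice u)" by (auto simp: tau_eq_iff)
  have pos: "0 < sqrt (moduli u $ k)" "0 < sqrt (moduli u' $ k)" for k
    using u u' by (auto simp: slice_dom_def)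
  have comp: "slice u' $ k = cis (phase t $ k) * slice u $ k" for k
    by (simp add: t act_nth)
  have c: "cis (t $ 1) = 1" "cis (t $ 2) = 1" "cis (t $ 3) = 1" "cis (t $ 4) = 1"
    "cis (t $ 1 + t $ 2 - t $ 4 - t $ 5 + t $ 6) = 1" "cis (t $ 5) = 1"
    using cis_eq_1_of_pos[OF comp[of 1, unfolded slice_nth] pos(2,1)]
      cis_eq_1_of_pos[OF comp[of 2, unfolded slice_nth] pos(2,1)]
      cis_eq_1_of_pos[OF comp[of 3, unfolded slice_nth] pos(2,1)]
      cis_eq_1_of_pos[OF comp[of 4, unfolded slice_nth] pos(2,1)]
      cis_eq_1_of_pos[OF comp[of 5, unfolded slice_nth] pos(2,1)]
      cis_eq_1_of_pos[OF comp[of 6, unfolded slice_nth] pos(2,1)]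
    by (simp_all add: phase_def)
  then have "cis (t $ 6) = 1"
    by (simp add: cis_mult[symmetric] cis_divide[symmetric])
  then have "cis (phase t $ 7) = 1" "cis (phase t $ 8) = 1"
    using c by (simp_all add: phase_def cis_mult[symmetric] cis_divide[symmetric])
  then have "slice u' $ 7 = slice u $ 7" "slice u' $ 8 = slice u $ 8"
    by (simp_all add: comp)
  then show "u = u'" by (simp add: slice_nth vec_eq_iff forall_4)
qed

lemma slice_chart_slice: "slice_chart slice_dom slice"
  using smooth_on_slice slice_inj slice_transverse slice_level
  by (auto simp: slice_chart_def slice_dom_def less_imp_le)

lemma cis_minus_Arg: "cis (- Arg z) * z = of_real (cmod z)"
proof -
  have "cis (- Arg z) * z = cis (- Arg z) * (of_real (cmod z) * cis (Arg z))"
    using rcis_cmod_Arg[of z] by (simp only: rcis_def)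
  also have "\<dots> = of_real (cmod z) * (cis (- Arg z) * cis (Arg z))"
    by (simp only: mult_ac)
  finally show ?thesis by (simp only: cis_mult) simp
qed

text \<open>The last entry of \<open>t\<close> is chosen such that the phase of the fifth coordinate, which is not free, comes out as
  \<open>- Arg (z $ 5)\<close>.\<close>

lemma slice_surj:
  assumes z: "z \<in> level_W" and nz: "z $ 1 \<noteq> 0" "z $ 2 \<noteq> 0" "z $ 3 \<noteq> 0" "z $ 4 \<noteq> 0" "z $ 5 \<noteq> 0" "z $ 6 \<noteq> 0"
  obtains u where "u \<in> slice_dom" and "tau z = tau (slice u)"
    and "cmod (z $ 7) = cmod (slice u $ 7)" and "cmod (z $ 8) = cmod (slice u $ 8)"
proof -
  define t :: "real ^ 6" where "t = vector [- Arg (z $ 1), - Arg (z $ 2), - Arg (z $ 3), - Arg (z $ 4),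
    - Arg (z $ 6), - Arg (z $ 5) + Arg (z $ 1) + Arg (z $ 2) - Arg (z $ 4) - Arg (z $ 6)]"
  define y where "y = act t z"
  define u :: "real ^ 4" where "u = vector [Re (y $ 7), Im (y $ 7), Re (y $ 8), Im (y $ 8)]"
  have cm: "cmod (y $ k) = cmod (z $ k)" for k by (simp add: y_def act_nth norm_mult)
  have y: "y $ k = of_real (cmod (z $ k))" if "phase t $ k = - Arg (z $ k)" for k
    by (simp add: y_def act_nth that cis_minus_Arg)
  have u78: "(u $ 1)\<^sup>2 + (u $ 2)\<^sup>2 = (cmod (z $ 7))\<^sup>2" "(u $ 3)\<^sup>2 + (u $ 4)\<^sup>2 = (cmod (z $ 8))\<^sup>2"
    by (simp_all add: u_def cm[symmetric] cmod_power2)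
  have mod: "moduli u $ 1 = (cmod (z $ 1))\<^sup>2" "moduli u $ 2 = (cmod (z $ 2))\<^sup>2"
    "moduli u $ 3 = (cmod (z $ 3))\<^sup>2" "moduli u $ 4 = (cmod (z $ 4))\<^sup>2"
    "moduli u $ 5 = (cmod (z $ 5))\<^sup>2" "moduli u $ 6 = (cmod (z $ 6))\<^sup>2"
    using z unfolding level_W_def moduli_nth u78 by auto
  have "\<forall>k. 0 < moduli u $ k" unfolding forall_6 mod using nz by simp
  then have dom: "u \<in> slice_dom" by (simp add: slice_dom_def)
  have "phase t $ 1 = - Arg (z $ 1)" "phase t $ 2 = - Arg (z $ 2)" "phase t $ 3 = - Arg (z $ 3)"
     "phase t $ 4 = - Arg (z $ 4)" "phase t $ 5 = - Arg (z $ 5)" "phase t $ 6 = - Arg (z $ 6)"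
    by (simp_all add: phase_def t_def)
  then have y16: "y $ 1 = of_real (cmod (z $ 1))" "y $ 2 = of_real (cmod (z $ 2))"
     "y $ 3 = of_real (cmod (z $ 3))" "y $ 4 = of_real (cmod (z $ 4))"
     "y $ 5 = of_real (cmod (z $ 5))" "y $ 6 = of_real (cmod (z $ 6))"
    by (simp_all only: y)
  have y78: "y $ 7 = Complex (u $ 1) (u $ 2)" "y $ 8 = Complex (u $ 3) (u $ 4)"
    by (simp_all add: u_def)
  have "y = slice u"
    unfolding vec_eq_iff forall_8 y16 y78 slice_nth mod by simp
  then have "tau z = tau (slice u)" by (metis tau_act y_def)
  then show ?thesis using that dom \<open>y = slice u\<close> cm by metis
qed

section \<open>The focus-focus point of the slice\<close>

lemma moduli_0: "moduli 0 $ 1 = 2" "moduli 0 $ 2 = 6" "moduli 0 $ 3 = 6" "moduli 0 $ 4 = 8"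
  "moduli 0 $ 5 = 4" "moduli 0 $ 6 = 2"
  by (simp_all add: moduli_nth)

lemma zero_in_slice_dom: "0 \<in> slice_dom"
  unfolding slice_dom_def mem_Collect_eq forall_6 moduli_0 by simp

text \<open>The squared moduli are quadratic in \<open>u\<close>, so they do not contribute to first order at the centre.\<close>

lemma slice_derivative_0:
  "frechet_derivative slice (at 0) v =
     vector [0, 0, 0, 0, 0, 0, Complex (v $ 1) (v $ 2), Complex (v $ 3) (v $ 4)]"
proof -
  have "\<forall>k. ((\<lambda>u. moduli u $ k) has_derivative (\<lambda>_. 0)) (at 0)"
    unfolding forall_6 moduli_nth by (intro conjI) (auto intro!: derivative_eq_intros)
  moreover have "0 < moduli 0 $ k" for k using zero_in_slice_dom by (simp add: slice_dom_def)
  ultimately have "((\<lambda>u. complex_of_real (sqrt (moduli u $ k))) has_derivative (\<lambda>_. 0)) (at 0)" for k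
    using has_derivative_of_real[OF has_derivative_real_sqrt[of "\<lambda>u. moduli u $ k"], of 0 "\<lambda>_. 0" UNIV] by simp
  then have z: "frechet_derivative slice (at 0) v $ k = 0"
    if "(\<lambda>u. slice u $ k) = (\<lambda>u. complex_of_real (sqrt (moduli u $ j)))" for k j
    using fun_cong[OF has_derivative_unique[OF
          has_derivative_vec_nth[OF slice_derivative[OF zero_in_slice_dom], of k, unfolded that]], of "\<lambda>_. 0" v]
    by simp
  have "frechet_derivative slice (at 0) v $ 1 = 0" "frechet_derivative slice (at 0) v $ 2 = 0"
    "frechet_derivative slice (at 0) v $ 3 = 0" "frechet_derivative slice (at 0) v $ 4 = 0"
    "frechet_derivative slice (at 0) v $ 5 = 0" "frechet_derivative slice (at 0) v $ 6 = 0"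
    by (rule z, simp only: slice_nth)+
  then show ?thesis
    unfolding vec_eq_iff forall_8 vector_8 by (simp add: slice_derivative_nth[OF zero_in_slice_dom])
qed

lemma omega_mat_slice:
  "omega_mat slice 0 *v w = vector [- w $ 2, w $ 1, - w $ 4, w $ 3]"
proof -
  have "omega_st (frechet_derivative slice (at 0) e) (frechet_derivative slice (at 0) w) =
      e $ 2 * w $ 1 - e $ 1 * w $ 2 + e $ 4 * w $ 3 - e $ 3 * w $ 4" for e
    by (simp add: omega_st_inner inner_vec_def sum_8 times_i_def slice_derivative_0 inner_complex_def)
  then show ?thesis
    by (simp add: vec_eq_iff forall_4 omega_mat_mult[OF slice_chart_slice zero_in_slice_dom] axis_def)
qed

text \<open>On the slice \<open>J = 1 + (|z\<^sub>8|\<^sup>2 - |z\<^sub>7|\<^sup>2) / 2\<close>. This expression, unlike \<open>|z\<^sub>1|\<^sup>2 / 2\<close>, is critical at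
  \<open>slice 0\<close> as a function on the whole of \<open>complex ^ 8\<close>; the same holds for \<open>X\<close>. No Lagrange multipliers are
  needed, then, to compute the Hessians.\<close>

definition J_ext :: "complex ^ 8 \<Rightarrow> real" where
  "J_ext y = (y $ 8 \<bullet> y $ 8 - y $ 7 \<bullet> y $ 7) / 2"

definition J_ext_grad :: "complex ^ 8 \<Rightarrow> complex ^ 8" where
  "J_ext_grad y = axis 8 (y $ 8) - axis 7 (y $ 7)"

lemma J_ext_grad_inner: "J_ext_grad x \<bullet> y = x $ 8 \<bullet> y $ 8 - x $ 7 \<bullet> y $ 7"
  by (simp add: J_ext_grad_def inner_diff_left inner_axis')

lemma J_ext_slice:
  assumes "u \<in> slice_dom"
  shows "fst (F_sys \<gamma> (1 / 2) (tau (slice u))) = J_ext (slice u) + 1"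
proof -
  have "0 < moduli u $ 1" using assms by (simp add: slice_dom_def)
  then show ?thesis
    by (simp add: F_sys_half slice_nth J_ext_def inner_complex_def moduli_nth power2_eq_square field_simps)
qed

lemma J_ext_derivative: "(J_ext has_derivative (\<lambda>\<zeta>. J_ext_grad y \<bullet> \<zeta>)) (at y)"
proof -
  have nth: "((\<lambda>y :: complex ^ 8. y $ k \<bullet> y $ k) has_derivative (\<lambda>\<zeta>. y $ k \<bullet> \<zeta> $ k + \<zeta> $ k \<bullet> y $ k)) (at y)" for k
    by (intro has_derivative_inner bounded_linear_imp_has_derivative bounded_linear_vec_nth)
  show ?thesis
    unfolding J_ext_def[abs_def]
    by (rule has_derivative_eq_rhs, rule bounded_linear.has_derivative[OF bounded_linear_divide
          has_derivative_diff[OF nth nth]])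
      (rule ext, unfold J_ext_grad_inner, simp add: inner_commute)
qed

lemma J_ext_grad_derivative: "(J_ext_grad has_derivative J_ext_grad) (at y)"
  by (intro bounded_linear_imp_has_derivative linear_conv_bounded_linear[THEN iffD1] linearI)
    (auto simp: J_ext_grad_def vec_eq_iff axis_def algebra_simps)

lemma hessian_J_slice:
  "d2_1 (F_sys \<gamma> (1 / 2)) slice 0 *v w = vector [- w $ 1, - w $ 2, w $ 3, w $ 4]"
proof -
  have "J_ext_grad (slice 0) = 0"
    by (simp add: J_ext_grad_def slice_nth vec_eq_iff axis_def complex_eq_iff)
  from hessian_compose_mult[OF smooth_on_slice zero_in_slice_dom J_ext_derivative
      J_ext_grad_derivative this J_ext_slice]
  have "(d2_1 (F_sys \<gamma> (1 / 2)) slice 0 *v w) $ i =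
      J_ext_grad (frechet_derivative slice (at 0) (axis i 1)) \<bullet> frechet_derivative slice (at 0) w" for i
    by (simp add: d2_1_def)
  then show ?thesis
    by (simp add: vec_eq_iff forall_4 J_ext_grad_inner slice_derivative_0 inner_complex_def axis_def)
qed

lemma X_grad_slice_0: "X_grad (slice 0) = 0"
  unfolding vec_eq_iff forall_8 X_grad_def vector_8 by (simp add: slice_nth complex_eq_iff)

text \<open>At \<open>slice 0\<close> the coefficient of \<open>z\<^sub>7 z\<^sub>8\<close> in the monomial is \<open>\<surd>6 \<cdot> \<surd>6 \<cdot> \<surd>8 \<cdot> \<surd>2 = 24\<close>.\<close>

lemma hessian_X_slice:
  "d2_2 (F_sys \<gamma> (1 / 2)) slice 0 *v w = (12 * \<gamma>) *\<^sub>R vector [w $ 3, - w $ 4, w $ 1, - w $ 2]"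
proof -
  let ?D = "frechet_derivative slice (at 0)" and ?z = "slice 0"
  obtain g' where g': "(X_grad has_derivative g') (at ?z)"
    using X_grad_differentiable by (auto simp: differentiable_def)
  have G: "((\<lambda>y. \<gamma> / 2 * X_poly y) has_derivative (\<lambda>\<zeta>. ((\<gamma> / 2) *\<^sub>R X_grad y) \<bullet> \<zeta>)) (at y)" for y
    using has_derivative_mult_right[OF X_poly_derivative, of "\<gamma> / 2"] by simp
  have g: "((\<lambda>y. (\<gamma> / 2) *\<^sub>R X_grad y) has_derivative (\<lambda>\<zeta>. (\<gamma> / 2) *\<^sub>R g' \<zeta>)) (at ?z)"
    by (intro derivative_intros g')
  have "(d2_2 (F_sys \<gamma> (1 / 2)) slice 0 *v w) $ i =
      ((\<gamma> / 2) *\<^sub>R g' (?D (axis i 1))) \<bullet> ?D w" for i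
    unfolding d2_2_def
    by (rule hessian_compose_mult[OF smooth_on_slice zero_in_slice_dom G g, of _ 0])
      (simp_all add: X_grad_slice_0 F_sys_half)
  then have hess: "(d2_2 (F_sys \<gamma> (1 / 2)) slice 0 *v w) $ i =
      (\<gamma> / 2) * (g' (?D (axis i 1)) \<bullet> ?D w)" for i
    by simp
  have P: "?z $ 2 * ?z $ 3 * ?z $ 4 * cnj (?z $ 6) = 24"
  proof -
    have "sqrt 6 * sqrt 6 * sqrt 8 * sqrt 2 = (24 :: real)"
      using real_sqrt_mult[of 2 8] by simp
    then show ?thesis
      unfolding slice_nth moduli_0 complex_cnj_complex_of_real of_real_mult[symmetric]
      by (simp only:) simp
  qed
  have z78: "?z $ 7 = 0" "?z $ 8 = 0" by (simp_all add: slice_nth complex_eq_iff)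
  have g7: "g' \<zeta> $ 7 = 24 * cnj (\<zeta> $ 8)" and g8: "g' \<zeta> $ 8 = 24 * cnj (\<zeta> $ 7)" for \<zeta>
  proof -
    have "\<exists>Q. ((\<lambda>y :: complex ^ 8. y $ 2 * y $ 3 * y $ 4 * cnj (y $ 6)) has_derivative Q) (at ?z)"
      by (rule exI, (rule derivative_intros)+)
    then obtain Q where Q: "((\<lambda>y. y $ 2 * y $ 3 * y $ 4 * cnj (y $ 6)) has_derivative Q) (at ?z)"
      by blast
    have Y: "((\<lambda>y. y $ 2 * y $ 3 * y $ 4 * cnj (y $ 6) * cnj (y $ k)) has_derivative
          (\<lambda>\<zeta>. 24 * cnj (\<zeta> $ k))) (at ?z)" if "?z $ k = 0" for k
    proof -
      have "((\<lambda>y :: complex ^ 8. cnj (y $ k)) has_derivative (\<lambda>\<zeta>. cnj (\<zeta> $ k))) (at ?z)"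
        by (intro derivative_intros)
      from has_derivative_mult[OF Q this] show ?thesis
        by (rule has_derivative_eq_rhs) (simp only: P that complex_cnj_zero mult_zero_right add_0_right)
    qed
    have "((\<lambda>y. X_grad y $ 7) has_derivative (\<lambda>\<zeta>. g' \<zeta> $ 7)) (at ?z)"
      "((\<lambda>y. X_grad y $ 8) has_derivative (\<lambda>\<zeta>. g' \<zeta> $ 8)) (at ?z)"
      by (intro derivative_intros g')+
    note this[unfolded X_grad_def vector_8]
    from has_derivative_unique[OF this(1) Y[OF z78(2)]] has_derivative_unique[OF this(2) Y[OF z78(1)]]
    show "g' \<zeta> $ 7 = 24 * cnj (\<zeta> $ 8)" "g' \<zeta> $ 8 = 24 * cnj (\<zeta> $ 7)"
      by (simp_all add: fun_eq_iff)
  qed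
  have "g' \<zeta> \<bullet> ?D w = 24 * (cnj (\<zeta> $ 8) \<bullet> ?D w $ 7 + cnj (\<zeta> $ 7) \<bullet> ?D w $ 8)" for \<zeta>
    unfolding inner_vec_def sum_8 g7 g8
    by (simp add: slice_derivative_0 inner_complex_def algebra_simps)
  then show ?thesis
    by (simp add: vec_eq_iff forall_4 hess slice_derivative_0 axis_def inner_complex_def)
qed

text \<open>The linearised Hamiltonian vector field of \<open>J + F\<^sub>2 / (12 \<gamma>)\<close> at the centre of the slice, where \<open>F\<^sub>2\<close> is the second
  component; the coefficient is chosen such that \<open>\<gamma>\<close> cancels.\<close>

definition focus_matrix :: "real ^ 4 ^ 4" where
  "focus_matrix = vector [vector [0, -1, 0, -1], vector [1, 0, -1, 0], vector [0, -1, 0, 1],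
     vector [-1, 0, -1, 0]]"

text \<open>The fourth power of the matrix is \<open>- 4\<close>, so the eigenvalues are among the fourth roots of \<open>- 4\<close>; all four of
  them have explicit eigenvectors.\<close>

lemma eigenvalues_focus_matrix:
  "eigenvalues focus_matrix = {Complex 1 1, Complex 1 (-1), Complex (-1) 1, Complex (-1) (-1)}"
proof (intro equalityI subsetI)
  have mult: "((\<chi> i j. complex_of_real (focus_matrix $ i $ j)) *v v) =
      vector [- v $ 2 - v $ 4, v $ 1 - v $ 3, - v $ 2 + v $ 4, - v $ 1 - v $ 3]" for v :: "complex ^ 4"
    by (simp add: vec_eq_iff forall_4 matrix_vector_mult_def sum_4 focus_matrix_def)
  {
    fix l assume "l \<in> eigenvalues focus_matrix"
    then obtain v :: "complex ^ 4" where "v \<noteq> 0" and "vector [- v $ 2 - v $ 4, v $ 1 - v $ 3, - v $ 2 + v $ 4, - v $ 1 - v $ 3] = l *s v"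
      unfolding eigenvalues_def mult by blast
    then have v: "- v $ 2 - v $ 4 = l * v $ 1" "v $ 1 - v $ 3 = l * v $ 2" "- v $ 2 + v $ 4 = l * v $ 3"
        "- v $ 1 - v $ 3 = l * v $ 4"
      by (simp_all add: vec_eq_iff forall_4)
    have sq: "l * (l * v $ 1) = 2 * v $ 3" "l * (l * v $ 2) = - 2 * v $ 4"
      "l * (l * v $ 3) = - 2 * v $ 1" "l * (l * v $ 4) = 2 * v $ 2"
      by (simp_all only: v[symmetric] right_diff_distrib minus_mult_right[symmetric] distrib_left) simp_all
    have "((l * l) * (l * l)) * v $ k = - 4 * v $ k" for k
    proof -
      define m where "m = l * l"
      have m: "m * v $ 1 = 2 * v $ 3" "m * v $ 2 = - 2 * v $ 4" "m * v $ 3 = - 2 * v $ 1"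
        "m * v $ 4 = 2 * v $ 2"
        by (simp_all only: m_def mult.assoc sq)
      have "\<forall>k. m * m * v $ k = - 4 * v $ k"
        unfolding forall_4
        by (simp only: mult.assoc m mult.left_commute[of m 2] mult.left_commute[of m "- 2"]) simp
      then show ?thesis by (simp add: m_def)
    qed
    moreover obtain k where "v $ k \<noteq> 0" using \<open>v \<noteq> 0\<close> by (auto simp: vec_eq_iff)
    ultimately have "(l * l) * (l * l) = - 4" by (metis mult_cancel_right)
    then have "(l * l) * (l * l) = (2 * \<i>) * (2 * \<i>)" by simp
    then have "l * l = 2 * \<i> \<or> l * l = - (2 * \<i>)" by (simp only: square_eq_iff)
    moreover have "2 * \<i> = Complex 1 1 * Complex 1 1" "- (2 * \<i>) = Complex 1 (-1) * Complex 1 (-1)"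
      by (simp_all add: complex_eq_iff)
    ultimately have "l = Complex 1 1 \<or> l = - Complex 1 1 \<or> l = Complex 1 (-1) \<or> l = - Complex 1 (-1)"
      by (simp only: square_eq_iff) blast
    moreover have "- Complex 1 1 = Complex (-1) (-1)" "- Complex 1 (-1) = Complex (-1) 1"
      by (simp_all add: complex_eq_iff)
    ultimately show "l \<in> {Complex 1 1, Complex 1 (-1), Complex (-1) 1, Complex (-1) (-1)}" by auto
  }
  {
    fix l assume l: "l \<in> {Complex 1 1, Complex 1 (-1), Complex (-1) 1, Complex (-1) (-1)}"
    \<comment> \<open>Here \<open>l\<^sup>2 = 2 * c\<close> with \<open>c\<close> one of \<open>\<plusminus>\<i>\<close>.\<close>
    define c where "c = l * l / 2"
    have cc: "c * c = -1" and "l \<noteq> 0" and ll: "l * l = 2 * c"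
      using l by (auto simp: c_def complex_eq_iff)
    define v :: "complex ^ 4" where "v = vector [1, (1 - c) / l, c, (- 1 - c) / l]"
    have v4: "v $ 1 = 1" "v $ 2 = (1 - c) / l" "v $ 3 = c" "v $ 4 = (- 1 - c) / l"
      by (simp_all add: v_def)
    have "- v $ 2 - v $ 4 = l * v $ 1" "v $ 1 - v $ 3 = l * v $ 2" "- v $ 2 + v $ 4 = l * v $ 3"
        "- v $ 1 - v $ 3 = l * v $ 4"
      unfolding v4 using \<open>l \<noteq> 0\<close> cc ll by (auto simp: field_simps)
    then have "vector [- v $ 2 - v $ 4, v $ 1 - v $ 3, - v $ 2 + v $ 4, - v $ 1 - v $ 3] = l *s v"
      by (simp add: vec_eq_iff forall_4)
    moreover have "v \<noteq> 0" using v4(1) by auto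
    ultimately show "l \<in> eigenvalues focus_matrix" unfolding eigenvalues_def mult by blast
  }
qed

lemma lin_comb_slice:
  assumes "\<gamma> \<noteq> 0"
  shows "lin_comb (F_sys \<gamma> (1 / 2)) slice 0 1 (1 / (12 * \<gamma>)) = focus_matrix"
proof -
  have "lin_comb (F_sys \<gamma> (1 / 2)) slice 0 1 (1 / (12 * \<gamma>)) *v w = focus_matrix *v w" for w
  proof (rule lin_comb_mult[OF omega_mat_invertible[OF slice_chart_slice zero_in_slice_dom]])
    have "focus_matrix *v w =
        vector [- w $ 2 - w $ 4, w $ 1 - w $ 3, - w $ 2 + w $ 4, - w $ 1 - w $ 3]"
      by (simp add: vec_eq_iff forall_4 matrix_vector_mult_def sum_4 focus_matrix_def)
    then show "omega_mat slice 0 *v (focus_matrix *v w) =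
        1 *\<^sub>R (d2_1 (F_sys \<gamma> (1 / 2)) slice 0 *v w) +
        (1 / (12 * \<gamma>)) *\<^sub>R (d2_2 (F_sys \<gamma> (1 / 2)) slice 0 *v w)"
      using assms
      by (simp add: omega_mat_slice hessian_J_slice hessian_X_slice vec_eq_iff forall_4)
  qed
  then show ?thesis by (simp add: matrix_eq)
qed

lemma focus_focus_slice:
  assumes "\<gamma> \<noteq> 0"
  shows "focus_focus (F_sys \<gamma> (1 / 2)) (tau (slice 0))"
proof -
  let ?F = "F_sys \<gamma> (1 / 2)"
  have chart: "chart_at (tau (slice 0)) slice_dom slice 0"
    by (simp add: chart_at_def slice_chart_slice zero_in_slice_dom)
  have "fixed_point ?F (tau (slice 0))"
  proof -
    note D = slice_derivative[OF zero_in_slice_dom]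
    have "((\<lambda>x. (J_ext (slice x) + 1, \<gamma> / 2 * X_poly (slice x))) has_derivative
       (\<lambda>v. (J_ext_grad (slice 0) \<bullet> frechet_derivative slice (at 0) v + 0,
          \<gamma> / 2 * (X_grad (slice 0) \<bullet> frechet_derivative slice (at 0) v)))) (at 0)"
      by (intro has_derivative_Pair has_derivative_add has_derivative_const has_derivative_mult_right
          has_derivative_compose[OF D J_ext_derivative] has_derivative_compose[OF D X_poly_derivative])
    moreover have "J_ext_grad (slice 0) = 0"
      by (simp add: J_ext_grad_def slice_nth vec_eq_iff axis_def complex_eq_iff)
    ultimately have "((\<lambda>x. (J_ext (slice x) + 1, \<gamma> / 2 * X_poly (slice x))) has_derivative (\<lambda>v. 0)) (at 0)"
      by (simp add: X_grad_slice_0 zero_prod_def)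
    then have "((\<lambda>x. ?F (tau (slice x))) has_derivative (\<lambda>v. 0)) (at 0)"
    proof (rule has_derivative_transform_within_open[OF _ open_slice_dom zero_in_slice_dom])
      show "(J_ext (slice x) + 1, \<gamma> / 2 * X_poly (slice x)) = ?F (tau (slice x))" if "x \<in> slice_dom" for x
        using J_ext_slice[OF that, of \<gamma>] by (simp add: F_sys_half)
    qed
    then show ?thesis using chart unfolding fixed_point_def by blast
  qed
  moreover have "nondegenerate_at ?F slice 0 1 (1 / (12 * \<gamma>))"
  proof -
    have "c = 0 \<and> d = 0" if eq: "c *\<^sub>R d2_1 ?F slice 0 + d *\<^sub>R d2_2 ?F slice 0 = 0" for c d
    proof -
      have "c *\<^sub>R (d2_1 ?F slice 0 *v w) + d *\<^sub>R (d2_2 ?F slice 0 *v w) = 0" for w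
        using arg_cong[OF eq, of "\<lambda>A. A *v w"]
        by (simp add: matrix_vector_mult_add_rdistrib scaleR_matrix_vector_assoc[symmetric])
      from this[of "axis 3 1"] show ?thesis
        using assms by (simp add: hessian_J_slice hessian_X_slice vec_eq_iff forall_4 axis_def)
    qed
    then show ?thesis
      by (simp add: nondegenerate_at_def lin_comb_slice[OF assms] eigenvalues_focus_matrix)
  qed
  ultimately show ?thesis
    using chart lin_comb_slice[OF assms] eigenvalues_focus_matrix
    unfolding focus_focus_def
    by (intro conjI exI[of _ slice_dom] exI[of _ slice] exI[of _ 0] exI[of _ 1] exI[of _ "1 / (12 * \<gamma>)"])
      simp_all
qed

section \<open>Classification of the focus-focus points\<close>

definition pole :: "complex ^ 8" where "pole = slice 0"

lemma pole_level: "pole \<in> level_W"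
  using zero_in_slice_dom by (auto simp: pole_def slice_dom_def intro!: slice_level less_imp_le)

lemma tau_eq_pole:
  assumes z: "z \<in> level_W" and "z $ 7 = 0" and "z $ 8 = 0"
  shows "tau z = tau pole"
proof -
  have "z $ 1 \<noteq> 0 \<and> z $ 2 \<noteq> 0 \<and> z $ 3 \<noteq> 0 \<and> z $ 4 \<noteq> 0 \<and> z $ 5 \<noteq> 0 \<and> z $ 6 \<noteq> 0"
    using assms by (auto simp: level_W_def)
  then obtain u where "tau z = tau (slice u)" "cmod (z $ 7) = cmod (slice u $ 7)"
      "cmod (z $ 8) = cmod (slice u $ 8)"
    using slice_surj[OF z] by metis
  moreover from this assms(2,3) have "u = 0"
    by (simp add: slice_nth vec_eq_iff forall_4 complex_eq_iff)
  ultimately show ?thesis by (simp add: pole_def)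
qed

lemma tau_relabel_cong:
  assumes "level_symmetry \<pi>" and "tau (relabel \<pi> z) = tau y"
  shows "tau z = tau (relabel \<pi> y)"
  using assms tau_relabel[OF assms(1)] relabel_relabel[OF assms(1)] by metis

text \<open>By \<open>critical_cases\<close> a focus-focus point lies over an edge with \<open>J\<close> constant or over one of four vertices. The
  edges are excluded, the second one after reflecting it to \<open>z\<^sub>1 = 0\<close>, and the vertices are reflections of the
  centre of the slice.\<close>

lemma focus_focus_iff:
  assumes "\<gamma> \<noteq> 0"
  shows "focus_focus (F_sys \<gamma> (1 / 2)) p \<longleftrightarrow>
    p \<in> {tau pole, tau (relabel flip_H pole), tau (relabel flip_J pole),
         tau (relabel flip_J (relabel flip_H pole))}"
proof
  assume ff: "focus_focus (F_sys \<gamma> (1 / 2)) p"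
  then obtain z where z: "z \<in> level_W" and p: "p = tau z"
    unfolding focus_focus_def fixed_point_def chart_at_def using chart_level by metis
  have "critical z"
    using ff fixed_point_critical[OF assms] by (simp add: focus_focus_def p)
  moreover have "z $ 1 \<noteq> 0"
    using not_focus_focus_on_edge[OF assms] ff p by blast
  moreover have "z $ 5 \<noteq> 0"
    using not_focus_focus_on_edge[OF assms, of "relabel flip_J z"] focus_focus_flip_J[of \<gamma> z] ff p by auto
  ultimately consider "z $ 7 = 0" "z $ 8 = 0" | "z $ 7 = 0" "z $ 6 = 0" | "z $ 3 = 0" "z $ 4 = 0"
    | "z $ 3 = 0" "z $ 2 = 0"
    using critical_cases[OF z] by blast
  then show "p \<in> {tau pole, tau (relabel flip_H pole), tau (relabel flip_J pole),
         tau (relabel flip_J (relabel flip_H pole))}"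
  proof cases
    case 1
    then show ?thesis using tau_eq_pole[OF z] p by simp
  next
    case 2
    then have "tau (relabel flip_J z) = tau pole"
      by (intro tau_eq_pole relabel_level_W[OF level_symmetry_flip_J] z) simp_all
    from tau_relabel_cong[OF level_symmetry_flip_J this] show ?thesis unfolding p by blast
  next
    case 3
    then have "tau (relabel flip_H (relabel flip_J z)) = tau pole"
      by (intro tau_eq_pole relabel_level_W[OF level_symmetry_flip_J]
          relabel_level_W[OF level_symmetry_flip_H] z) simp_all
    from tau_relabel_cong[OF level_symmetry_flip_J tau_relabel_cong[OF level_symmetry_flip_H this]]
    show ?thesis unfolding p by blast
  next
    case 4
    then have "tau (relabel flip_H z) = tau pole"
      by (intro tau_eq_pole relabel_level_W[OF level_symmetry_flip_H] z) simp_all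
    from tau_relabel_cong[OF level_symmetry_flip_H this] show ?thesis unfolding p by blast
  qed
next
  have "focus_focus (F_sys \<gamma> (1 / 2)) (tau pole)"
    using focus_focus_slice[OF assms] by (simp add: pole_def)
  then show "focus_focus (F_sys \<gamma> (1 / 2)) p"
    if "p \<in> {tau pole, tau (relabel flip_H pole), tau (relabel flip_J pole),
         tau (relabel flip_J (relabel flip_H pole))}"
    using that focus_focus_flip_J focus_focus_flip_H by auto
qed

section \<open>The two spheres\<close>

text \<open>For a point \<open>x\<close> of the unit sphere, the complex number \<open>w = radial \<eta> x \<cdot> (x\<^sub>1 + \<i> x\<^sub>2)\<close> satisfies
  \<open>|w|\<^sup>2 = 3 (1 - \<eta> x\<^sub>3)\<close>: up to scaling it is the equal-area coordinate on the sphere without the point \<open>(0, 0, - \<eta>)\<close>. The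
  point \<open>lift \<eta> s x\<close> of the slice has \<open>z\<^sub>8 = w\<close> and \<open>z\<^sub>7 = s \<i> cnj w\<close>.\<close>

definition radial :: "real \<Rightarrow> real ^ 3 \<Rightarrow> real" where
  "radial \<eta> x = sqrt (3 / (1 + \<eta> * x $ 3))"

definition lift :: "real \<Rightarrow> real \<Rightarrow> real ^ 3 \<Rightarrow> real ^ 4" where
  "lift \<eta> s x = vector [s * (radial \<eta> x * x $ 2), s * (radial \<eta> x * x $ 1), radial \<eta> x * x $ 1,
     radial \<eta> x * x $ 2]"

definition cap :: "real \<Rightarrow> (real ^ 3) set" where
  "cap \<eta> = {x. (x $ 1)\<^sup>2 + (x $ 2)\<^sup>2 < 2 * (1 + \<eta> * x $ 3)}"

text \<open>Neither chart covers a whole sphere: the slice misses the points with \<open>z\<^sub>2 = z\<^sub>3 = 0\<close>, its reflection those with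
  \<open>z\<^sub>7 = z\<^sub>8 = 0\<close>.\<close>

definition piece :: "real \<Rightarrow> real ^ 4 \<Rightarrow> complex ^ 8" where
  "piece \<eta> u = (if \<eta> = 1 then slice u else relabel flip_H (slice u))"

definition pinch_sphere :: "real \<Rightarrow> real ^ 3 \<Rightarrow> (complex ^ 8) set" where
  "pinch_sphere s x = (if x $ 3 > - 1 then tau (slice (lift 1 s x)) else tau (relabel flip_H pole))"

lemma sphere_3: "x \<in> sphere 0 1 \<longleftrightarrow> (x $ 1)\<^sup>2 + (x $ 2)\<^sup>2 + (x $ 3)\<^sup>2 = 1" for x :: "real ^ 3"
  by (simp add: norm_eq_1 inner_vec_def sum_3 power2_eq_square)

lemma cap_pos:
  assumes "x \<in> cap \<eta>"
  shows "0 < 1 + \<eta> * x $ 3"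
proof -
  have "0 \<le> (x $ 1)\<^sup>2 + (x $ 2)\<^sup>2" by simp
  also have "\<dots> < 2 * (1 + \<eta> * x $ 3)" using assms by (simp only: cap_def mem_Collect_eq)
  finally show ?thesis by (simp only: zero_less_mult_iff) simp
qed

lemma sphere_cap:
  assumes "x \<in> sphere 0 1" and "0 < 1 + \<eta> * x $ 3" and "\<eta> \<in> {1, -1}"
  shows "x \<in> cap \<eta>" and "(x $ 1)\<^sup>2 + (x $ 2)\<^sup>2 = (1 - \<eta> * x $ 3) * (1 + \<eta> * x $ 3)"
proof -
  show eq: "(x $ 1)\<^sup>2 + (x $ 2)\<^sup>2 = (1 - \<eta> * x $ 3) * (1 + \<eta> * x $ 3)"
    using assms(3) assms(1)[unfolded sphere_3] by (auto simp: algebra_simps power2_eq_square)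
  have "(1 - \<eta> * x $ 3) * (1 + \<eta> * x $ 3) < 2 * (1 + \<eta> * x $ 3)"
    using assms(2) by (intro mult_strict_right_mono) auto
  then show "x \<in> cap \<eta>" by (simp add: cap_def eq)
qed

lemma open_cap: "open (cap \<eta>)"
  unfolding cap_def by (intro open_Collect_less continuous_intros)

lemma radial_square:
  assumes "0 < 1 + \<eta> * x $ 3"
  shows "(radial \<eta> x)\<^sup>2 * (1 + \<eta> * x $ 3) = 3"
proof -
  have "(sqrt (3 / d))\<^sup>2 * d = 3" if "0 < d" for d :: real using that by simp
  from this[OF assms] show ?thesis by (simp only: radial_def)
qed

lemma radial_pos: "0 < 1 + \<eta> * x $ 3 \<Longrightarrow> 0 < radial \<eta> x"
  by (simp add: radial_def)

lemma smooth_on_radial: "smooth_on (cap \<eta>) (radial \<eta>)"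
proof -
  have nth: "smooth_on (cap \<eta>) (\<lambda>x. x $ 3)"
    by (rule smooth_on_linear[OF open_cap bounded_linear_vec_nth])
  have "smooth_on (cap \<eta>) (\<lambda>x. sqrt (3 * (1 + \<eta> * x $ 3) powr (- 1)))"
    by (intro smooth_on_sqrt smooth_on_mult smooth_on_powr smooth_on_add smooth_on_const open_cap nth)
      (use cap_pos in fastforce)+
  moreover have "sqrt (3 * (1 + \<eta> * x $ 3) powr (- 1)) = radial \<eta> x" if "x \<in> cap \<eta>" for x
    using cap_pos[OF that] by (simp add: radial_def powr_minus_divide)
  ultimately show ?thesis
    by (subst smooth_on_cong[where g = "\<lambda>x. sqrt (3 * (1 + \<eta> * x $ 3) powr (- 1))"]) simp_all
qed

lemma smooth_on_lift: "smooth_on (cap \<eta>) (lift \<eta> s)"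
proof (rule smooth_on_vec[OF open_cap])
  have nth: "smooth_on (cap \<eta>) (\<lambda>x. x $ i)" for i
    by (rule smooth_on_linear[OF open_cap bounded_linear_vec_nth])
  have "\<forall>i. smooth_on (cap \<eta>) (\<lambda>x. lift \<eta> s x $ i)"
    unfolding forall_4 lift_def vector_4
    by (intro conjI smooth_on_mult smooth_on_const open_cap smooth_on_radial nth)
  then show "smooth_on (cap \<eta>) (\<lambda>x. lift \<eta> s x $ i)" for i by blast
qed

lemma lift_norms:
  assumes "s \<in> {1, -1}"
  shows "(lift \<eta> s x $ 1)\<^sup>2 + (lift \<eta> s x $ 2)\<^sup>2 = (radial \<eta> x)\<^sup>2 * ((x $ 1)\<^sup>2 + (x $ 2)\<^sup>2)"
    and "(lift \<eta> s x $ 3)\<^sup>2 + (lift \<eta> s x $ 4)\<^sup>2 = (radial \<eta> x)\<^sup>2 * ((x $ 1)\<^sup>2 + (x $ 2)\<^sup>2)"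
  using assms by (auto simp: lift_def power_mult_distrib algebra_simps)

lemma lift_slice_dom:
  assumes "s \<in> {1, -1}" and "x \<in> cap \<eta>"
  shows "lift \<eta> s x \<in> slice_dom"
proof -
  define b where "b = (radial \<eta> x)\<^sup>2 * ((x $ 1)\<^sup>2 + (x $ 2)\<^sup>2)"
  have "(radial \<eta> x)\<^sup>2 * ((x $ 1)\<^sup>2 + (x $ 2)\<^sup>2) < (radial \<eta> x)\<^sup>2 * (2 * (1 + \<eta> * x $ 3))"
    using assms(2) radial_pos[OF cap_pos[OF assms(2)]] by (simp add: cap_def)
  also have "\<dots> = 6" using radial_square[OF cap_pos[OF assms(2)]] by (simp only: mult.left_commute[of _ 2])
  finally have "b < 6" by (simp add: b_def)
  moreover have "0 \<le> b" by (simp add: b_def)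
  ultimately show ?thesis
    unfolding slice_dom_def mem_Collect_eq forall_6 moduli_nth lift_norms[OF assms(1)] b_def[symmetric] by simp
qed

lemma lift_sphere:
  assumes "s \<in> {1, -1}" and "\<eta> \<in> {1, -1}" and "x \<in> sphere 0 1" and "0 < 1 + \<eta> * x $ 3"
  shows "(radial \<eta> x)\<^sup>2 * ((x $ 1)\<^sup>2 + (x $ 2)\<^sup>2) = 3 * (1 - \<eta> * x $ 3)"
    and "moduli (lift \<eta> s x) = vector [2, 3 * (1 + \<eta> * x $ 3), 3 * (1 + \<eta> * x $ 3),
      5 + 3 * \<eta> * x $ 3, 4, 5 - 3 * \<eta> * x $ 3]"
proof -
  show eq: "(radial \<eta> x)\<^sup>2 * ((x $ 1)\<^sup>2 + (x $ 2)\<^sup>2) = 3 * (1 - \<eta> * x $ 3)"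
    using radial_square[OF assms(4)] by (simp only: sphere_cap(2)[OF assms(3,4,2)] mult.left_commute[of _ "1 - _"] mult.commute[of "1 - _" 3])
  show "moduli (lift \<eta> s x) = vector [2, 3 * (1 + \<eta> * x $ 3), 3 * (1 + \<eta> * x $ 3),
      5 + 3 * \<eta> * x $ 3, 4, 5 - 3 * \<eta> * x $ 3]"
    unfolding vec_eq_iff forall_6 vector_6 moduli_nth lift_norms[OF assms(1)] eq by (simp add: algebra_simps)
qed

lemma cis_minus_quarter:
  assumes "s \<in> {1, -1}"
  shows "cis (- (s * pi / 2)) = - of_real s * \<i>"
  using assms by (auto simp: complex_eq_iff)

text \<open>Seen from the reflected slice, the sphere with sign \<open>s\<close> is the one with sign \<open>- s\<close>. The torus element \<open>t\<close> moves the
  angle of \<open>(z\<^sub>7, z\<^sub>8)\<close> to \<open>(z\<^sub>3, z\<^sub>2)\<close>; the quarter turn by \<open>s pi / 2\<close> makes the seventh coordinate positive.\<close>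

lemma pinch_sphere_overlap:
  assumes s: "s \<in> {1, -1}" and x: "x \<in> sphere 0 1" and x3: "- 1 < x $ 3" "x $ 3 < 1"
  shows "tau (slice (lift 1 s x)) = tau (relabel flip_H (slice (lift (- 1) (- s) x)))"
proof -
  define z where "z = Complex (x $ 1) (x $ 2)"
  define \<theta> where "\<theta> = Arg z"
  have pos: "0 < 1 + 1 * x $ 3" "0 < 1 + (- 1) * x $ 3" using x3 by simp_all
  have z: "z = of_real (cmod z) * cis \<theta>" using rcis_cmod_Arg[of z] by (simp add: \<theta>_def rcis_def)
  have norm_z: "(cmod z)\<^sup>2 = (x $ 1)\<^sup>2 + (x $ 2)\<^sup>2" by (simp add: z_def cmod_power2)
  have r: "radial \<eta> x * cmod z = sqrt (3 * (1 - \<eta> * x $ 3))" if "\<eta> \<in> {1, -1}" "0 < 1 + \<eta> * x $ 3" for \<eta>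
    using lift_sphere(1)[OF s that(1) x that(2)] radial_pos[OF that(2)]
    by (intro real_sqrt_unique[symmetric]) (simp_all add: power_mult_distrib norm_z)
  have w: "Complex (lift \<eta> s' x $ 3) (lift \<eta> s' x $ 4) = of_real (sqrt (3 * (1 - \<eta> * x $ 3))) * cis \<theta>"
    if "\<eta> \<in> {1, -1}" "0 < 1 + \<eta> * x $ 3" for \<eta> s'
  proof -
    have "Complex (lift \<eta> s' x $ 3) (lift \<eta> s' x $ 4) = of_real (radial \<eta> x) * z"
      by (simp add: lift_def z_def complex_eq_iff)
    also have "\<dots> = of_real (radial \<eta> x * cmod z) * cis \<theta>"
      by (subst z) simp
    finally show ?thesis by (simp only: r[OF that])
  qed
  have w7: "Complex (lift \<eta> s' x $ 1) (lift \<eta> s' x $ 2) =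
      of_real s' * \<i> * (of_real (sqrt (3 * (1 - \<eta> * x $ 3))) * cis (- \<theta>))"
    if "\<eta> \<in> {1, -1}" "0 < 1 + \<eta> * x $ 3" for \<eta> s'
  proof -
    have "Complex (lift \<eta> s' x $ 1) (lift \<eta> s' x $ 2) =
        of_real s' * \<i> * cnj (Complex (lift \<eta> s' x $ 3) (lift \<eta> s' x $ 4))"
      by (simp add: lift_def complex_eq_iff)
    then show ?thesis by (simp add: w[OF that] cis_cnj)
  qed
  define t :: "real ^ 6" where "t = vector [0, \<theta>, - \<theta> - s * pi / 2, 0, 0, - \<theta>]"
  have ph: "phase t $ 1 = 0" "phase t $ 2 = \<theta>" "phase t $ 3 = - \<theta> + - (s * pi / 2)" "phase t $ 4 = 0"
    "phase t $ 5 = 0" "phase t $ 6 = 0" "phase t $ 7 = \<theta> + - (s * pi / 2)" "phase t $ 8 = - \<theta>"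
    by (simp_all add: phase_def t_def)
  have ms: "- s \<in> {1, -1}" "(1 :: real) \<in> {1, -1}" "(- 1 :: real) \<in> {1, -1}" using s by auto
  note m = lift_sphere(2)[OF s ms(2) x pos(1)] lift_sphere(2)[OF ms(1) ms(3) x pos(2)]
  note W = w[OF ms(2) pos(1)] w[OF ms(3) pos(2)] w7[OF ms(2) pos(1)] w7[OF ms(3) pos(2)]
  have cc: "cis \<theta> * cis (- \<theta>) = 1" "cis (- \<theta>) * cis \<theta> = 1" by (simp_all add: cis_mult)
  have "relabel flip_H (slice (lift (- 1) (- s) x)) = act t (slice (lift 1 s x))"
    unfolding vec_eq_iff forall_8 relabel_nth flip_H_simps act_nth ph slice_nth W m vector_6
      cis_mult[symmetric] cis_minus_quarter[OF s] cis_zero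
    by (simp add: mult_ac) (use s in \<open>auto simp: cc\<close>)
  then show ?thesis by (simp add: tau_act)
qed

lemma pinch_sphere_piece:
  assumes s: "s \<in> {1, -1}" and \<eta>: "\<eta> \<in> {1, -1}" and x: "x \<in> sphere 0 1" and pos: "0 < 1 + \<eta> * x $ 3"
  shows "pinch_sphere s x = tau (piece \<eta> (lift \<eta> (\<eta> * s) x))"
proof (cases "\<eta> = 1")
  case True
  then show ?thesis using pos by (simp add: pinch_sphere_def piece_def)
next
  case False
  then have \<eta>: "\<eta> = - 1" using \<eta> by simp
  show ?thesis
  proof (cases "x $ 3 = - 1")
    case True
    have "(x $ 1)\<^sup>2 + (x $ 2)\<^sup>2 = 0" using x[unfolded sphere_3] True by simp
    then have "x $ 1 = 0" "x $ 2 = 0" by (simp_all only: sum_power2_eq_zero_iff)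
    then have "lift \<eta> (\<eta> * s) x = 0" by (simp add: vec_eq_iff forall_4 lift_def)
    then show ?thesis using True \<eta> by (simp add: pinch_sphere_def piece_def pole_def)
  next
    case False
    have "(x $ 3)\<^sup>2 \<le> 1" using x[unfolded sphere_3] sum_power2_ge_zero[of "x $ 1" "x $ 2"] by linarith
    then have "\<bar>x $ 3\<bar> \<le> 1" by (simp add: abs_square_le_1)
    then have "- 1 < x $ 3" using False by linarith
    moreover have "x $ 3 < 1" using pos \<eta> by simp
    ultimately show ?thesis
      using pinch_sphere_overlap[OF s x] \<eta> by (simp add: pinch_sphere_def piece_def)
  qed
qed

lemma slice_chart_piece: "slice_chart slice_dom (piece \<eta>)"
proof (cases "\<eta> = 1")
  case True
  then have "piece \<eta> = slice" by (simp add: piece_def fun_eq_iff)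
  then show ?thesis using slice_chart_slice by simp
next
  case False
  then have "piece \<eta> = (\<lambda>u. relabel flip_H (slice u))" by (simp add: piece_def fun_eq_iff)
  then show ?thesis using slice_chart_relabel[OF level_symmetry_flip_H slice_chart_slice] by simp
qed

lemma local_rep_pinch_sphere:
  assumes s: "s \<in> {1, -1}" and \<eta>: "\<eta> \<in> {1, -1}" and x: "x \<in> sphere 0 1" and pos: "0 < 1 + \<eta> * x $ 3"
  shows "local_rep (pinch_sphere s) x slice_dom (piece \<eta>) (cap \<eta>) (lift \<eta> (\<eta> * s))"
proof -
  have "\<eta> * s \<in> {1, -1}" using s \<eta> by auto
  then show ?thesis
    using slice_chart_piece sphere_cap(1)[OF x pos \<eta>] smooth_on_lift lift_slice_dom
      pinch_sphere_piece[OF s \<eta> _ cap_pos]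
    unfolding local_rep_def by blast
qed

text \<open>The derivative \<open>q'\<close> of \<open>radial \<eta>\<close> enters only through the relation obtained by differentiating
  \<open>(radial \<eta> x)\<^sup>2 * (1 + \<eta> * x $ 3) = 3\<close>.\<close>

lemma lift_derivative:
  assumes x: "x \<in> cap \<eta>"
  obtains q' where
    "\<And>v. frechet_derivative (lift \<eta> s) (at x) v = vector [s * (q' v * x $ 2 + radial \<eta> x * v $ 2),
       s * (q' v * x $ 1 + radial \<eta> x * v $ 1), q' v * x $ 1 + radial \<eta> x * v $ 1,
       q' v * x $ 2 + radial \<eta> x * v $ 2]"
    and "\<And>v. 2 * q' v * (1 + \<eta> * x $ 3) = - radial \<eta> x * \<eta> * v $ 3"
proof -
  let ?q' = "frechet_derivative (radial \<eta>) (at x)"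
  note q = smooth_on_derivative[OF smooth_on_radial x] and l = smooth_on_derivative[OF smooth_on_lift x]
  have nth: "((\<lambda>x :: real ^ 3. x $ i) has_derivative (\<lambda>v. v $ i)) (at x)" for i
    by (rule bounded_linear_imp_has_derivative[OF bounded_linear_vec_nth])
  have p: "((\<lambda>x. radial \<eta> x * x $ i) has_derivative (\<lambda>v. ?q' v * x $ i + radial \<eta> x * v $ i)) (at x)" for i
    by (rule has_derivative_eq_rhs, rule has_derivative_mult[OF q nth]) (simp add: fun_eq_iff)
  have comp: "frechet_derivative (lift \<eta> s) (at x) v $ k = d v"
    if "((\<lambda>x. lift \<eta> s x $ k) has_derivative d) (at x)" for k d v
    using fun_cong[OF has_derivative_unique[OF has_derivative_vec_nth[OF l] that]] .
  have 1: "frechet_derivative (lift \<eta> s) (at x) v = vector [s * (?q' v * x $ 2 + radial \<eta> x * v $ 2),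
       s * (?q' v * x $ 1 + radial \<eta> x * v $ 1), ?q' v * x $ 1 + radial \<eta> x * v $ 1,
       ?q' v * x $ 2 + radial \<eta> x * v $ 2]" for v
    unfolding vec_eq_iff forall_4 vector_4
    by (intro conjI comp[of _ "\<lambda>v. s * (?q' v * x $ 2 + radial \<eta> x * v $ 2)"]
        comp[of _ "\<lambda>v. s * (?q' v * x $ 1 + radial \<eta> x * v $ 1)"]
        comp[of _ "\<lambda>v. ?q' v * x $ 1 + radial \<eta> x * v $ 1"]
        comp[of _ "\<lambda>v. ?q' v * x $ 2 + radial \<eta> x * v $ 2"])
      (simp_all only: lift_def vector_4 has_derivative_mult_right p)
  have 2: "2 * ?q' v * (1 + \<eta> * x $ 3) = - radial \<eta> x * \<eta> * v $ 3" for v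
  proof -
    have "((\<lambda>x. radial \<eta> x * radial \<eta> x * (1 + \<eta> * x $ 3)) has_derivative
        (\<lambda>v. radial \<eta> x * radial \<eta> x * (0 + \<eta> * v $ 3) +
          (radial \<eta> x * ?q' v + ?q' v * radial \<eta> x) * (1 + \<eta> * x $ 3))) (at x)"
      by (intro has_derivative_mult has_derivative_add has_derivative_const has_derivative_mult_right q nth)
    moreover have "((\<lambda>x. radial \<eta> x * radial \<eta> x * (1 + \<eta> * x $ 3)) has_derivative (\<lambda>v. 0)) (at x)"
      using has_derivative_const[of 3 "at x"]
      by (rule has_derivative_transform_within_open[OF _ open_cap x])
        (simp add: radial_square[OF cap_pos] flip: power2_eq_square)
    ultimately have "radial \<eta> x * radial \<eta> x * (0 + \<eta> * v $ 3) +
          (radial \<eta> x * ?q' v + ?q' v * radial \<eta> x) * (1 + \<eta> * x $ 3) = 0"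
      by (rule fun_cong[OF has_derivative_unique])
    then have "radial \<eta> x * (2 * ?q' v * (1 + \<eta> * x $ 3) + radial \<eta> x * \<eta> * v $ 3) = 0"
      by (simp add: algebra_simps)
    then show ?thesis using radial_pos[OF cap_pos[OF x]] by simp
  qed
  show ?thesis by (rule that[OF 1 2])
qed

lemma lift_immersive:
  assumes x: "x \<in> sphere 0 1" and \<eta>: "\<eta> \<in> {1, -1}" and pos: "0 < 1 + \<eta> * x $ 3"
  shows "inj_on (frechet_derivative (lift \<eta> s) (at x)) (sphere_tangent x)"
proof (rule inj_onI)
  let ?D = "frechet_derivative (lift \<eta> s) (at x)" and ?q = "radial \<eta> x"
  have cap: "x \<in> cap \<eta>" by (rule sphere_cap(1)[OF x pos \<eta>])
  have lin: "linear ?D"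
    using smooth_on_derivative[OF smooth_on_lift cap] has_derivative_linear by blast
  obtain q' where D: "\<And>v. ?D v = vector [s * (q' v * x $ 2 + ?q * v $ 2),
       s * (q' v * x $ 1 + ?q * v $ 1), q' v * x $ 1 + ?q * v $ 1, q' v * x $ 2 + ?q * v $ 2]"
    and q': "\<And>v. 2 * q' v * (1 + \<eta> * x $ 3) = - ?q * \<eta> * v $ 3"
    by (rule lift_derivative[OF cap, where s = s]) blast
  fix a b assume ab: "a \<in> sphere_tangent x" "b \<in> sphere_tangent x" "?D a = ?D b"
  define v where "v = a - b"
  have "?D v = 0" using ab(3) by (simp add: v_def linear_diff[OF lin])
  then have 0: "q' v * x $ 1 + ?q * v $ 1 = 0" "q' v * x $ 2 + ?q * v $ 2 = 0"
    by (simp_all add: D vec_eq_iff forall_4)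
  have "v \<bullet> x = 0" using ab by (simp add: v_def sphere_tangent_def inner_diff_left)
  then have tan: "v $ 1 * x $ 1 + v $ 2 * x $ 2 + v $ 3 * x $ 3 = 0" by (simp add: inner_vec_def sum_3)
  \<comment> \<open>The tangent vector is orthogonal to \<open>x\<close>; pairing the two equations with \<open>(x\<^sub>1, x\<^sub>2)\<close> therefore
    leaves an equation for \<open>v\<^sub>3\<close> alone.\<close>
  have radial_part: "q' v * ((x $ 1)\<^sup>2 + (x $ 2)\<^sup>2) = ?q * (v $ 3 * x $ 3)"
  proof -
    have "q' v * ((x $ 1)\<^sup>2 + (x $ 2)\<^sup>2) + ?q * (v $ 1 * x $ 1 + v $ 2 * x $ 2) =
        (q' v * x $ 1 + ?q * v $ 1) * x $ 1 + (q' v * x $ 2 + ?q * v $ 2) * x $ 2"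
      by (simp add: algebra_simps power2_eq_square)
    moreover have "v $ 1 * x $ 1 + v $ 2 * x $ 2 = - (v $ 3 * x $ 3)" using tan by linarith
    ultimately show ?thesis by (simp add: 0)
  qed
  have "(2 * q' v * (1 + \<eta> * x $ 3)) * (1 - \<eta> * x $ 3) =
      2 * (q' v * ((1 - \<eta> * x $ 3) * (1 + \<eta> * x $ 3)))"
    by (simp only: mult_ac)
  then have "(- ?q * \<eta> * v $ 3) * (1 - \<eta> * x $ 3) = 2 * (?q * (v $ 3 * x $ 3))"
    by (simp only: q' radial_part[unfolded sphere_cap(2)[OF x pos \<eta>]])
  then have "?q * (v $ 3 * (1 + \<eta> * x $ 3)) = 0"
    using \<eta> by (auto simp: algebra_simps)
  then have v3: "v $ 3 = 0" using pos radial_pos[OF pos] by auto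
  then have "q' v = 0" using q'[of v] pos by auto
  then have "v $ 1 = 0" "v $ 2 = 0" using 0 radial_pos[OF pos] by auto
  with v3 have "v = 0" by (simp add: vec_eq_iff forall_3)
  then show "a = b" by (simp add: v_def)
qed

lemma north_or_south:
  obtains \<eta> :: real where "\<eta> \<in> {1, -1}" and "0 < 1 + \<eta> * (x :: real ^ 3) $ 3"
proof (cases "x $ 3 > - 1")
  case True
  then show ?thesis by (intro that[of 1]) auto
next
  case False
  then show ?thesis by (intro that[of "-1"]) auto
qed

lemma south_pole:
  fixes x :: "real ^ 3"
  assumes "x \<in> sphere 0 1" and "\<not> x $ 3 > - 1"
  shows "x = - axis 3 1"
proof -
  have "1 \<le> (x $ 3)\<^sup>2" using assms(2) power_mono[of 1 "- x $ 3" 2] by simp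
  then have "(x $ 1)\<^sup>2 + (x $ 2)\<^sup>2 = 0" "(x $ 3)\<^sup>2 = 1"
    using assms(1)[unfolded sphere_3] sum_power2_ge_zero[of "x $ 1" "x $ 2"] by linarith+
  moreover have "x $ 3 = - 1" using \<open>(x $ 3)\<^sup>2 = 1\<close> assms(2) by (auto simp: power2_eq_1_iff)
  ultimately show ?thesis
    by (simp add: vec_eq_iff forall_3 axis_def)
qed

text \<open>The function \<open>H\<close> recovers the height on the sphere. For injectivity this separates the added pole from the
  other points, and it shows that two points with the same image have the same factor \<open>radial\<close>.\<close>

lemma pinch_sphere_third_modulus:
  assumes "s \<in> {1, -1}" and "x \<in> sphere 0 1" and "pinch_sphere s x = tau z"
  shows "(cmod (z $ 3))\<^sup>2 = 3 * (1 + x $ 3)"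
proof (cases "x $ 3 > - 1")
  case True
  then have "tau (slice (lift 1 s x)) = tau z" using assms(3) by (simp add: pinch_sphere_def)
  then have "(cmod (z $ 3))\<^sup>2 = (cmod (slice (lift 1 s x) $ 3))\<^sup>2"
    by (auto simp: tau_eq_iff act_nth norm_mult)
  also have "\<dots> = 3 * (1 + x $ 3)"
    using True lift_sphere(2)[OF assms(1) _ assms(2), of 1] by (simp add: slice_nth)
  finally show ?thesis .
next
  case False
  then have "tau (relabel flip_H pole) = tau z" using assms(3) by (simp add: pinch_sphere_def)
  then have "cmod (z $ 3) = cmod (relabel flip_H pole $ 3)"
    by (auto simp: tau_eq_iff act_nth norm_mult)
  also have "\<dots> = 0" by (simp add: pole_def slice_nth zero_complex.code[symmetric])
  finally show ?thesis using south_pole[OF assms(2) False] by simp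
qed

lemma pinch_sphere_tau: "\<exists>z. pinch_sphere s x = tau z"
  by (auto simp: pinch_sphere_def)

lemma pinch_sphere_eq_cases:
  assumes s: "s \<in> {1, -1}" and s': "s' \<in> {1, -1}"
    and x: "x \<in> sphere 0 1" and y: "y \<in> sphere 0 1" and eq: "pinch_sphere s x = pinch_sphere s' y"
  shows "x = y \<and> (s = s' \<or> x = axis 3 1 \<or> x = - axis 3 1)"
proof (cases "x $ 3 > - 1")
  case True
  obtain z where z: "pinch_sphere s x = tau z" using pinch_sphere_tau by blast
  have "x $ 3 = y $ 3"
    using pinch_sphere_third_modulus[OF s x z] pinch_sphere_third_modulus[OF s' y] z eq by simp
  have pos: "0 < 1 + 1 * x $ 3" "0 < 1 + 1 * y $ 3" using True \<open>x $ 3 = y $ 3\<close> by simp_all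
  have dom: "lift 1 s x \<in> slice_dom" "lift 1 s' y \<in> slice_dom"
    using lift_slice_dom[OF s sphere_cap(1)[OF x pos(1)]] lift_slice_dom[OF s' sphere_cap(1)[OF y pos(2)]] by auto
  have "tau (slice (lift 1 s x)) = tau (slice (lift 1 s' y))"
    using eq True \<open>x $ 3 = y $ 3\<close> by (simp add: pinch_sphere_def)
  then have lift: "lift 1 s x = lift 1 s' y"
    using inj_onD[OF slice_inj _ dom] by simp
  have "radial 1 x = radial 1 y" by (simp add: radial_def \<open>x $ 3 = y $ 3\<close>)
  then have xy: "x $ 1 = y $ 1" "x $ 2 = y $ 2"
    using lift radial_pos[OF pos(1)] by (simp_all add: lift_def vec_eq_iff forall_4)
  then have "x = y" using \<open>x $ 3 = y $ 3\<close> by (simp add: vec_eq_iff forall_3)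
  moreover have "s = s' \<or> x = axis 3 1"
  proof (rule ccontr)
    assume n: "\<not> (s = s' \<or> x = axis 3 1)"
    have "s * (radial 1 x * x $ 2) = s' * (radial 1 x * x $ 2)" "s * (radial 1 x * x $ 1) = s' * (radial 1 x * x $ 1)"
      using lift unfolding \<open>x = y\<close>[symmetric] by (simp_all add: lift_def vec_eq_iff forall_4)
    then have "x $ 1 = 0" "x $ 2 = 0" using n radial_pos[OF pos(1)] by auto
    then have "(x $ 3)\<^sup>2 = 1" using x[unfolded sphere_3] by simp
    then have "x $ 3 = 1" using True by (auto simp: power2_eq_1_iff)
    then have "x = axis 3 1" using \<open>x $ 1 = 0\<close> \<open>x $ 2 = 0\<close> by (simp add: vec_eq_iff forall_3 axis_def)
    then show False using n by simp
  qed
  ultimately show ?thesis by blast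
next
  case False
  obtain z where z: "pinch_sphere s x = tau z" using pinch_sphere_tau by blast
  have "x $ 3 = y $ 3"
    using pinch_sphere_third_modulus[OF s x z] pinch_sphere_third_modulus[OF s' y] z eq by simp
  then have y3: "\<not> y $ 3 > - 1" using False by simp
  have "x = - axis 3 1" "y = - axis 3 1"
    by (rule south_pole[OF x False], rule south_pole[OF y y3])
  then show ?thesis by blast
qed

lemma embedded_pinch_sphere:
  assumes s: "s \<in> {1, -1}"
  shows "embedded_sphere (pinch_sphere s)"
  unfolding embedded_sphere_def
proof (intro conjI ballI)
  show "inj_on (pinch_sphere s) (sphere 0 1)"
    by (rule inj_onI) (rule pinch_sphere_eq_cases[OF s s, THEN conjunct1])
  fix x :: "real ^ 3" assume x: "x \<in> sphere 0 1"
  obtain \<eta> where \<eta>: "\<eta> \<in> {1, -1}" "0 < 1 + \<eta> * x $ 3" by (rule north_or_south)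
  show "\<exists>U \<sigma> V g. local_rep (pinch_sphere s) x U \<sigma> V g \<and>
      inj_on (frechet_derivative g (at x)) (sphere_tangent x)"
    by (intro exI conjI, rule local_rep_pinch_sphere[OF s \<eta>(1) x \<eta>(2)], rule lift_immersive[OF x \<eta>])
qed

lemma transverse_pinch_spheres:
  assumes \<eta>: "\<eta> \<in> {1, -1}"
  shows "transverse_at (pinch_sphere 1) (pinch_sphere (- 1)) (tau (piece \<eta> 0))"
proof -
  define x :: "real ^ 3" where "x = axis 3 \<eta>"
  have x_nth: "x $ 1 = 0" "x $ 2 = 0" "x $ 3 = \<eta>" by (simp_all add: x_def axis_def)
  have x: "x \<in> sphere 0 1" unfolding sphere_3 x_nth using \<eta> by auto
  have pos: "0 < 1 + \<eta> * x $ 3" using \<eta> by (auto simp: x_nth)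
  have signs: "(1 :: real) \<in> {1, -1}" "(- 1 :: real) \<in> {1, -1}" by auto
  have cap: "x \<in> cap \<eta>" by (rule sphere_cap(1)[OF x pos \<eta>])
  have lift0: "lift \<eta> s x = 0" for s by (simp add: lift_def vec_eq_iff forall_4 x_nth)
  have at: "pinch_sphere 1 x = tau (piece \<eta> 0)" "pinch_sphere (- 1) x = tau (piece \<eta> 0)"
    using pinch_sphere_piece[OF signs(1) \<eta> x pos] pinch_sphere_piece[OF signs(2) \<eta> x pos] by (simp_all add: lift0)
  define q where "q = radial \<eta> x"
  have q: "q > 0" using radial_pos[OF pos] by (simp add: q_def)
  have D: "frechet_derivative (lift \<eta> s) (at x) v = vector [s * (q * v $ 2), s * (q * v $ 1), q * v $ 1, q * v $ 2]" for s v
  proof -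
    obtain q' where "\<And>v. frechet_derivative (lift \<eta> s) (at x) v = vector [s * (q' v * x $ 2 + radial \<eta> x * v $ 2),
       s * (q' v * x $ 1 + radial \<eta> x * v $ 1), q' v * x $ 1 + radial \<eta> x * v $ 1,
       q' v * x $ 2 + radial \<eta> x * v $ 2]"
      by (rule lift_derivative[OF cap, where s = s]) blast
    then show ?thesis by (simp add: x_nth q_def)
  qed
  have "\<exists>a b. y = a + b \<and> a \<in> frechet_derivative (lift \<eta> (\<eta> * 1)) (at x) ` sphere_tangent x \<and>
      b \<in> frechet_derivative (lift \<eta> (\<eta> * - 1)) (at x) ` sphere_tangent x" for y :: "real ^ 4"
  proof -
    \<comment> \<open>The two planes are the graphs of \<open>\<plusminus>\<eta> \<cdot> swap\<close> over the last two coordinates.\<close>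
    define v :: "real ^ 3" where "v = vector [(y $ 3 + \<eta> * y $ 2) / (2 * q), (y $ 4 + \<eta> * y $ 1) / (2 * q), 0]"
    define w :: "real ^ 3" where "w = vector [(y $ 3 - \<eta> * y $ 2) / (2 * q), (y $ 4 - \<eta> * y $ 1) / (2 * q), 0]"
    have "v \<in> sphere_tangent x" "w \<in> sphere_tangent x"
      by (simp_all add: sphere_tangent_def inner_vec_def sum_3 x_nth v_def w_def)
    moreover have "y = frechet_derivative (lift \<eta> (\<eta> * 1)) (at x) v + frechet_derivative (lift \<eta> (\<eta> * - 1)) (at x) w"
      using \<eta> q by (auto simp: vec_eq_iff forall_4 D v_def w_def field_simps)
    ultimately show ?thesis by blast
  qed
  then have "{a + b |a b. a \<in> frechet_derivative (lift \<eta> (\<eta> * 1)) (at x) ` sphere_tangent x \<and>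
      b \<in> frechet_derivative (lift \<eta> (\<eta> * - 1)) (at x) ` sphere_tangent x} = UNIV"
    by (auto simp: set_eq_iff)
  then show ?thesis
    using x at local_rep_pinch_sphere[OF signs(1) \<eta> x pos] local_rep_pinch_sphere[OF signs(2) \<eta> x pos]
    unfolding transverse_at_def by blast
qed

section \<open>The focus-focus fibres\<close>

lemma X_poly_slice:
  "X_poly (slice u) = sqrt (moduli u $ 2) * sqrt (moduli u $ 3) * sqrt (moduli u $ 4) *
     sqrt (moduli u $ 6) * (u $ 1 * u $ 3 - u $ 2 * u $ 4)"
  by (simp add: X_poly_def slice_nth algebra_simps)

lemma X_poly_pole: "X_poly pole = 0"
  by (simp add: pole_def X_poly_slice)

lemma fibre_iff:
  assumes "\<gamma> \<noteq> 0"
  shows "p \<in> fibre (F_sys \<gamma> (1 / 2)) (j, 0) \<longleftrightarrow>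
    (\<exists>z\<in>level_W. p = tau z \<and> (cmod (z $ 1))\<^sup>2 = 2 * j \<and> X_poly z = 0)"
  using assms by (auto simp: fibre_def mfd_def F_sys_half)

lemma slice_antidiagonal:
  assumes s: "s \<in> {1, -1}" and cd: "c\<^sup>2 + d\<^sup>2 < 6"
  defines "u \<equiv> vector [s * d, s * c, c, d] :: real ^ 4"
  shows "u \<in> slice_dom" and "(cmod (slice u $ 1))\<^sup>2 = 2" and "X_poly (slice u) = 0"
proof -
  have u: "(u $ 1)\<^sup>2 + (u $ 2)\<^sup>2 = c\<^sup>2 + d\<^sup>2" "(u $ 3)\<^sup>2 + (u $ 4)\<^sup>2 = c\<^sup>2 + d\<^sup>2"
    using s by (auto simp: u_def power_mult_distrib)
  define b where "b = c\<^sup>2 + d\<^sup>2"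
  have "0 \<le> b" "b < 6" using cd by (simp_all add: b_def)
  then show "u \<in> slice_dom"
    unfolding slice_dom_def mem_Collect_eq forall_6 moduli_nth u b_def[symmetric] by simp
  show "(cmod (slice u $ 1))\<^sup>2 = 2"
    unfolding slice_nth moduli_nth u by simp
  show "X_poly (slice u) = 0" by (simp add: X_poly_slice) (simp add: u_def)
qed

text \<open>In complex terms, \<open>Z = x + \<i> y\<close> and \<open>W = c + \<i> d\<close> satisfy \<open>|Z| = |W|\<close> and \<open>Re (Z W) = 0\<close>, so
  \<open>Z = \<plusminus>\<i> cnj W\<close>.\<close>

lemma antidiagonal_cases:
  fixes x y c d :: real
  assumes "x\<^sup>2 + y\<^sup>2 = c\<^sup>2 + d\<^sup>2" and "x * c = y * d"
  shows "\<exists>s\<in>{1, -1}. x = s * d \<and> y = s * c"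
proof -
  have "(x - d)\<^sup>2 + (y - c)\<^sup>2 = 2 * (c\<^sup>2 + d\<^sup>2) - 2 * (x * d + y * c)"
    "(x + d)\<^sup>2 + (y + c)\<^sup>2 = 2 * (c\<^sup>2 + d\<^sup>2) + 2 * (x * d + y * c)"
    using assms(1) by (simp_all add: power2_eq_square algebra_simps)
  moreover have "(x * d + y * c)\<^sup>2 = (c\<^sup>2 + d\<^sup>2)\<^sup>2"
  proof -
    have "(x * d + y * c)\<^sup>2 = (x\<^sup>2 + y\<^sup>2) * (c\<^sup>2 + d\<^sup>2) - (x * c - y * d)\<^sup>2"
      by (simp add: power2_eq_square algebra_simps)
    then show ?thesis using assms by (simp add: power2_eq_square)
  qed
  then have "x * d + y * c = c\<^sup>2 + d\<^sup>2 \<or> x * d + y * c = - (c\<^sup>2 + d\<^sup>2)"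
    by (simp add: power2_eq_iff)
  ultimately have "(x - d)\<^sup>2 + (y - c)\<^sup>2 = 0 \<or> (x + d)\<^sup>2 + (y + c)\<^sup>2 = 0" by auto
  then have "(x - d = 0 \<and> y - c = 0) \<or> (x + d = 0 \<and> y + c = 0)"
    by (simp only: sum_power2_eq_zero_iff)
  then have "(x = 1 * d \<and> y = 1 * c) \<or> (x = - 1 * d \<and> y = - 1 * c)" by auto
  then show ?thesis by blast
qed

text \<open>On this part of the level set \<open>|z\<^sub>3|\<^sup>2 = |z\<^sub>2|\<^sup>2 = 6 - |z\<^sub>7|\<^sup>2\<close>. If these vanish the point is the reflected centre
  of the slice; otherwise it lies in the slice, where \<open>|z\<^sub>1|\<^sup>2 = 2\<close> and \<open>X = 0\<close> become the two
  equations of the preceding lemma.\<close>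

lemma fibre_point_cases:
  assumes z: "z \<in> level_W" and J: "(cmod (z $ 1))\<^sup>2 = 2" and X: "X_poly z = 0"
  obtains "tau z = tau (relabel flip_H pole)"
  | s c d where "s \<in> {1, -1}" and "c\<^sup>2 + d\<^sup>2 < 6"
    and "tau z = tau (slice (vector [s * d, s * c, c, d]))"
proof (cases "z $ 3 = 0")
  case True
  have "z $ 2 = 0" using z J True by (auto simp: level_W_def)
  have "tau (relabel flip_H z) = tau pole"
    using True \<open>z $ 2 = 0\<close>
    by (intro tau_eq_pole relabel_level_W[OF level_symmetry_flip_H] z) simp_all
  then show ?thesis using tau_relabel_cong[OF level_symmetry_flip_H] that(1) by blast
next
  case False
  define b where "b = (cmod (z $ 7))\<^sup>2"
  have "0 < (cmod (z $ 3))\<^sup>2" using False by simp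
  moreover have "(cmod (z $ 3))\<^sup>2 = 6 - b" using z unfolding level_W_def b_def by auto
  ultimately have b: "0 \<le> b" "b < 6" by (simp_all add: b_def)
  have "(cmod (z $ 2))\<^sup>2 = 6 - b" "(cmod (z $ 4))\<^sup>2 = 8 - b" "(cmod (z $ 5))\<^sup>2 = 4" "(cmod (z $ 6))\<^sup>2 = 2 + b"
    using z J unfolding level_W_def b_def by auto
  then have "0 < (cmod (z $ 2))\<^sup>2" "0 < (cmod (z $ 4))\<^sup>2" "0 < (cmod (z $ 5))\<^sup>2" "0 < (cmod (z $ 6))\<^sup>2"
    using b by simp_all
  then have nz: "z $ 2 \<noteq> 0" "z $ 4 \<noteq> 0" "z $ 5 \<noteq> 0" "z $ 6 \<noteq> 0" by auto
  have "z $ 1 \<noteq> 0" using J by auto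
  obtain u where u: "u \<in> slice_dom" and tau: "tau z = tau (slice u)"
    using slice_surj[OF z \<open>z $ 1 \<noteq> 0\<close> nz(1) False nz(2-4)] by blast
  then obtain t where t: "slice u = act t z" by (auto simp: tau_eq_iff)
  have pos: "0 < moduli u $ k" for k using u by (simp add: slice_dom_def)
  have "(cmod (slice u $ 1))\<^sup>2 = 2" using J by (simp add: t act_nth norm_mult)
  then have "moduli u $ 1 = 2" using pos[of 1] by (simp add: slice_nth)
  then have norms: "(u $ 1)\<^sup>2 + (u $ 2)\<^sup>2 = (u $ 3)\<^sup>2 + (u $ 4)\<^sup>2" by (simp add: moduli_nth)
  have "X_poly (slice u) = 0" using X by (simp add: t X_poly_act)
  then have "u $ 1 * u $ 3 = u $ 2 * u $ 4"
    using pos[of 2] pos[of 3] pos[of 4] pos[of 6] by (simp add: X_poly_slice)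
  from antidiagonal_cases[OF norms this]
  obtain s where s: "s \<in> {1, -1}" "u $ 1 = s * u $ 4" "u $ 2 = s * u $ 3" by blast
  then have "u = vector [s * u $ 4, s * u $ 3, u $ 3, u $ 4]"
    unfolding vec_eq_iff forall_4 vector_4 by blast
  moreover have "(u $ 3)\<^sup>2 + (u $ 4)\<^sup>2 < 6" using pos[of 3] norms by (simp add: moduli_nth)
  ultimately show ?thesis using that(2)[OF s(1)] tau by metis
qed

lemma pole_values: "(cmod (pole $ 1))\<^sup>2 = 2" "(cmod (relabel flip_H pole $ 1))\<^sup>2 = 2"
  "X_poly (relabel flip_H pole) = 0"
  by (simp_all add: pole_def slice_nth moduli_0 X_poly_flip_H X_poly_pole[unfolded pole_def])

lemma pole_south_ne: "tau pole \<noteq> tau (relabel flip_H pole)"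
proof
  assume "tau pole = tau (relabel flip_H pole)"
  then have "cmod (relabel flip_H pole $ 3) = cmod (pole $ 3)"
    by (auto simp: tau_eq_iff act_nth norm_mult simp del: relabel_nth)
  then show False by (simp add: pole_def slice_nth moduli_0 zero_complex.code[symmetric])
qed

lemma poles_in_sphere: "(axis 3 1 :: real ^ 3) \<in> sphere 0 1" "- (axis 3 1 :: real ^ 3) \<in> sphere 0 1"
  unfolding sphere_3 by (simp_all add: axis_def)

lemma fibre_spheres:
  assumes "\<gamma> \<noteq> 0"
  shows "fibre (F_sys \<gamma> (1 / 2)) (1, 0) =
    pinch_sphere 1 ` sphere 0 1 \<union> pinch_sphere (- 1) ` sphere 0 1"
proof (intro equalityI subsetI)
  fix p assume "p \<in> pinch_sphere 1 ` sphere 0 1 \<union> pinch_sphere (- 1) ` sphere 0 1"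
  then obtain s x where s: "s \<in> {1, -1}" and x: "x \<in> sphere 0 1" and p: "p = pinch_sphere s x" by blast
  show "p \<in> fibre (F_sys \<gamma> (1 / 2)) (1, 0)"
  proof (cases "x $ 3 > - 1")
    case True
    then have pos: "0 < 1 + 1 * x $ 3" by simp
    let ?c = "radial 1 x * x $ 1" and ?d = "radial 1 x * x $ 2"
    have "?c\<^sup>2 + ?d\<^sup>2 = 3 * (1 - 1 * x $ 3)"
      using lift_sphere(1)[OF s _ x pos] by (simp add: power_mult_distrib distrib_left)
    then have cd: "?c\<^sup>2 + ?d\<^sup>2 < 6" using True by simp
    have "p = tau (slice (vector [s * ?d, s * ?c, ?c, ?d]))"
      using True by (simp add: p pinch_sphere_def lift_def)
    moreover have "slice (vector [s * ?d, s * ?c, ?c, ?d]) \<in> level_W"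
      using slice_antidiagonal(1)[OF s cd] chart_level[OF slice_chart_slice] by blast
    ultimately show ?thesis
      using slice_antidiagonal(2,3)[OF s cd] fibre_iff[OF assms, of p 1] by auto
  next
    case False
    then have "p = tau (relabel flip_H pole)" by (simp add: p pinch_sphere_def)
    then show ?thesis
      using pole_values(2,3) relabel_level_W[OF level_symmetry_flip_H pole_level]
      unfolding fibre_iff[OF assms] by auto
  qed
next
  fix p assume "p \<in> fibre (F_sys \<gamma> (1 / 2)) (1, 0)"
  then obtain z where z: "z \<in> level_W" "(cmod (z $ 1))\<^sup>2 = 2" "X_poly z = 0" and p: "p = tau z"
    using fibre_iff[OF assms, of p 1] by auto
  show "p \<in> pinch_sphere 1 ` sphere 0 1 \<union> pinch_sphere (- 1) ` sphere 0 1"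
    using z
  proof (cases rule: fibre_point_cases)
    case 1
    then have "p = pinch_sphere 1 (- axis 3 1)" by (simp add: p pinch_sphere_def)
    then show ?thesis using poles_in_sphere(2) by blast
  next
    case (2 s c d)
    define h where "h = 1 - (c\<^sup>2 + d\<^sup>2) / 3"
    define q where "q = sqrt (3 / (1 + h))"
    define x :: "real ^ 3" where "x = vector [c / q, d / q, h]"
    have h: "- 1 < h" using 2(2) by (simp add: h_def)
    then have q: "0 < q" "q\<^sup>2 = 3 / (1 + h)" by (simp_all add: q_def)
    have "(c / q)\<^sup>2 + (d / q)\<^sup>2 = (c\<^sup>2 + d\<^sup>2) / q\<^sup>2"
      by (simp add: power_divide add_divide_distrib)
    also have "\<dots> = (3 * (1 - h)) * (1 + h) / 3" by (simp add: q(2) h_def)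
    also have "\<dots> = 1 - h\<^sup>2" by (simp add: power2_eq_square field_simps)
    finally have x: "x \<in> sphere 0 1" unfolding sphere_3 by (simp add: x_def)
    have "radial 1 x = q" by (simp add: radial_def x_def q_def)
    then have "lift 1 s x = vector [s * d, s * c, c, d]"
      using q(1) by (simp add: lift_def x_def)
    then have "p = pinch_sphere s x" using h 2(3) by (simp add: p pinch_sphere_def x_def)
    then show ?thesis using x 2(1) by blast
  qed
qed

lemma double_pinched_fibre:
  assumes "\<gamma> \<noteq> 0"
  shows "double_pinched_torus (tau pole) (tau (relabel flip_H pole)) (fibre (F_sys \<gamma> (1 / 2)) (1, 0))"
proof -
  have signs: "(1 :: real) \<in> {1, -1}" "(- 1 :: real) \<in> {1, -1}" by auto
  let ?n = "axis 3 1 :: real ^ 3"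
  have ends: "pinch_sphere s ?n = tau pole" "pinch_sphere s (- ?n) = tau (relabel flip_H pole)" for s
  proof -
    have "lift 1 s ?n = 0" by (simp add: lift_def vec_eq_iff forall_4 axis_def)
    then show "pinch_sphere s ?n = tau pole" by (simp add: pinch_sphere_def pole_def axis_def)
    show "pinch_sphere s (- ?n) = tau (relabel flip_H pole)" by (simp add: pinch_sphere_def)
  qed
  have "pinch_sphere 1 ` sphere 0 1 \<inter> pinch_sphere (- 1) ` sphere 0 1 = {tau pole, tau (relabel flip_H pole)}"
  proof (intro equalityI subsetI)
    fix p assume "p \<in> pinch_sphere 1 ` sphere 0 1 \<inter> pinch_sphere (- 1) ` sphere 0 1"
    then obtain x y where "x \<in> sphere 0 1" "y \<in> sphere 0 1" "pinch_sphere 1 x = pinch_sphere (- 1) y"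
      and p: "p = pinch_sphere 1 x" by auto
    have "(1 :: real) \<noteq> - 1" by simp
    with pinch_sphere_eq_cases[OF signs \<open>x \<in> sphere 0 1\<close> \<open>y \<in> sphere 0 1\<close>
        \<open>pinch_sphere 1 x = pinch_sphere (- 1) y\<close>]
    have "x = ?n \<or> x = - ?n" by blast
    then show "p \<in> {tau pole, tau (relabel flip_H pole)}" using ends[of 1] p by auto
  next
    fix p assume "p \<in> {tau pole, tau (relabel flip_H pole)}"
    then show "p \<in> pinch_sphere 1 ` sphere 0 1 \<inter> pinch_sphere (- 1) ` sphere 0 1"
      using ends[of 1, symmetric] ends[of "- 1", symmetric] poles_in_sphere by blast
  qed
  moreover have "piece 1 0 = pole" "piece (- 1) 0 = relabel flip_H pole"
    by (simp_all add: piece_def pole_def)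
  then have "transverse_at (pinch_sphere 1) (pinch_sphere (- 1)) (tau pole)"
    "transverse_at (pinch_sphere 1) (pinch_sphere (- 1)) (tau (relabel flip_H pole))"
    using transverse_pinch_spheres[OF signs(1)] transverse_pinch_spheres[OF signs(2)] by simp_all
  ultimately show ?thesis
    unfolding double_pinched_torus_def
    using pole_south_ne fibre_spheres[OF assms] embedded_pinch_sphere[OF signs(1)] embedded_pinch_sphere[OF signs(2)]
    by (intro conjI exI[of _ "pinch_sphere 1"] exI[of _ "pinch_sphere (- 1)"]) assumption+
qed

lemma fibre_flip_J:
  assumes "\<gamma> \<noteq> 0"
  shows "fibre (F_sys \<gamma> (1 / 2)) (2, 0) = (`) (relabel flip_J) ` fibre (F_sys \<gamma> (1 / 2)) (1, 0)"
proof -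
  let ?F = "F_sys \<gamma> (1 / 2)"
  have flip: "relabel flip_J ` p \<in> fibre ?F (3 - j, 0)" if mem: "p \<in> fibre ?F (j, 0)" for p j
  proof -
    obtain z where z: "z \<in> level_W" "(cmod (z $ 1))\<^sup>2 = 2 * j" "X_poly z = 0" and p: "p = tau z"
      using mem unfolding fibre_iff[OF assms] by blast
    have "(cmod (relabel flip_J z $ 1))\<^sup>2 = 2 * (3 - j)" using J_flip_J[OF z(1)] z(2) by simp
    moreover have "X_poly (relabel flip_J z) = 0" by (simp add: X_poly_flip_J z(3))
    ultimately show ?thesis
      using relabel_level_W[OF level_symmetry_flip_J z(1)]
      unfolding p tau_relabel[OF level_symmetry_flip_J, symmetric] fibre_iff[OF assms] by blast
  qed
  show ?thesis
  proof (intro equalityI subsetI)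
    fix p assume "p \<in> fibre ?F (2, 0)"
    then have "relabel flip_J ` p \<in> fibre ?F (1, 0)" using flip[of p 2] by simp
    moreover have "p = relabel flip_J ` relabel flip_J ` p"
      by (rule relabel_image_image[OF level_symmetry_flip_J, symmetric])
    ultimately show "p \<in> (`) (relabel flip_J) ` fibre ?F (1, 0)" by blast
  next
    fix p assume "p \<in> (`) (relabel flip_J) ` fibre ?F (1, 0)"
    then obtain p' where "p' \<in> fibre ?F (1, 0)" "p = relabel flip_J ` p'" by blast
    then show "p \<in> fibre ?F (2, 0)" using flip[of p' 1] by simp
  qed
qed

definition fibre_point :: "real \<Rightarrow> real \<Rightarrow> complex \<Rightarrow> complex ^ 8" where
  "fibre_point \<theta> r s = vector [complex_of_real (sqrt 2), complex_of_real (sqrt (6 - r\<^sup>2)),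
     complex_of_real (sqrt (6 - r\<^sup>2)), complex_of_real (sqrt (8 - r\<^sup>2)), 2,
     complex_of_real (sqrt (2 + r\<^sup>2)), s * complex_of_real r * \<i> * exp (- (\<i> * complex_of_real \<theta>)),
     complex_of_real r * exp (\<i> * complex_of_real \<theta>)]"

lemma fibre_point_level:
  assumes "r \<in> {0..sqrt 6}" and "s \<in> {1, -1}"
  shows "fibre_point \<theta> r s \<in> level_W"
proof -
  have "r\<^sup>2 \<le> (sqrt 6)\<^sup>2" using assms(1) by (intro power_mono) auto
  then have r: "r\<^sup>2 \<le> 6" by simp
  have "cmod (exp (- (\<i> * complex_of_real \<theta>))) = 1" "cmod (exp (\<i> * complex_of_real \<theta>)) = 1" "cmod s = 1"
    using assms(2) by (auto simp: norm_exp_eq_Re)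
  then show ?thesis
    using r by (simp add: level_W_def fibre_point_def norm_mult)
qed

lemma fibre_point_X:
  assumes "s \<in> {1, -1}"
  shows "X_poly (fibre_point \<theta> r s) = 0"
proof -
  have e: "exp (- (\<i> * complex_of_real \<theta>)) * exp (\<i> * complex_of_real \<theta>) = 1"
    by (simp add: exp_minus)
  obtain k :: real where k: "s = of_real k" using assms by (metis insertE of_real_1 of_real_minus singletonD)
  define m where "m = sqrt (6 - r\<^sup>2) * sqrt (6 - r\<^sup>2) * sqrt (8 - r\<^sup>2) * sqrt (2 + r\<^sup>2) * k * r * r"
  have "cnj (fibre_point \<theta> r s $ 2) * cnj (fibre_point \<theta> r s $ 3) * cnj (fibre_point \<theta> r s $ 4) *
      fibre_point \<theta> r s $ 6 * fibre_point \<theta> r s $ 7 * fibre_point \<theta> r s $ 8 =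
      of_real m * \<i> * (exp (- (\<i> * complex_of_real \<theta>)) * exp (\<i> * complex_of_real \<theta>))"
    unfolding fibre_point_def vector_8 m_def k complex_cnj_complex_of_real of_real_mult by (simp only: mult_ac)
  then show ?thesis unfolding X_poly_def e by simp
qed

lemma slice_fibre_point:
  assumes s: "s \<in> {1, -1}" and cd: "c\<^sup>2 + d\<^sup>2 < 6"
  shows "\<exists>\<theta>\<in>{0..<2 * pi}. \<exists>r\<in>{0..sqrt 6}. slice (vector [s * d, s * c, c, d]) = fibre_point \<theta> r (of_real s)"
proof -
  define w where "w = Complex c d"
  define \<theta> r where "\<theta> = Arg2pi w" and "r = cmod w"
  have r2: "r\<^sup>2 = c\<^sup>2 + d\<^sup>2" by (simp add: r_def w_def cmod_power2)
  have w: "w = complex_of_real r * exp (\<i> * complex_of_real \<theta>)"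
    unfolding \<theta>_def r_def by (rule Arg2pi_eq)
  have "cnj w = complex_of_real r * exp (- (\<i> * complex_of_real \<theta>))"
    by (subst w) (simp add: exp_cnj)
  moreover have "Complex (s * d) (s * c) = of_real s * \<i> * cnj w"
    by (simp add: w_def complex_eq_iff)
  ultimately have w7: "Complex (s * d) (s * c) = of_real s * complex_of_real r * \<i> * exp (- (\<i> * complex_of_real \<theta>))"
    by (simp add: mult_ac)
  have u: "(s * d)\<^sup>2 + (s * c)\<^sup>2 = r\<^sup>2" "c\<^sup>2 + d\<^sup>2 = r\<^sup>2" using s r2 by auto
  have sqrt4: "complex_of_real (sqrt 4) = 2" using real_sqrt_abs[of 2] by simp
  have "slice (vector [s * d, s * c, c, d]) = fibre_point \<theta> r (of_real s)"
    unfolding vec_eq_iff forall_8 slice_nth fibre_point_def vector_8 moduli_nth vector_4 u w7 w_def[symmetric]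
    using w sqrt4 by simp
  moreover have "\<theta> \<in> {0..<2 * pi}" using Arg2pi_ge_0 Arg2pi_lt_2pi by (simp add: \<theta>_def)
  moreover have "r \<in> {0..sqrt 6}"
    using cd by (auto simp: r2[symmetric] r_def intro!: real_le_rsqrt)
  ultimately show ?thesis by blast
qed

text \<open>The value \<open>r = \<surd>6\<close> is not in the slice; there the representative has \<open>z\<^sub>2 = z\<^sub>3 = 0\<close> and gives the reflected centre
  for all angles and both signs.\<close>

lemma fibre_parametrisation:
  assumes "\<gamma> \<noteq> 0"
  shows "fibre (F_sys \<gamma> (1 / 2)) (1, 0) =
    {tau (fibre_point \<theta> r s) | \<theta> r s. \<theta> \<in> {0..<2 * pi} \<and> r \<in> {0..sqrt 6} \<and> s \<in> {1, -1}}"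
proof (intro equalityI subsetI)
  fix p assume "p \<in> fibre (F_sys \<gamma> (1 / 2)) (1, 0)"
  then obtain z where z: "z \<in> level_W" "(cmod (z $ 1))\<^sup>2 = 2" "X_poly z = 0" and p: "p = tau z"
    using fibre_iff[OF assms, of p 1] by auto
  have "\<exists>\<theta>\<in>{0..<2 * pi}. \<exists>r\<in>{0..sqrt 6}. \<exists>s\<in>{1, -1}. p = tau (fibre_point \<theta> r s)"
    using z
  proof (cases rule: fibre_point_cases)
    case 1
    let ?y = "fibre_point 0 (sqrt 6) 1"
    have "relabel flip_H ?y $ 7 = 0" "relabel flip_H ?y $ 8 = 0" by (simp_all add: fibre_point_def)
    moreover have "relabel flip_H ?y \<in> level_W"
      by (intro relabel_level_W[OF level_symmetry_flip_H] fibre_point_level) simp_all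
    ultimately have "tau (relabel flip_H ?y) = tau pole" by (intro tau_eq_pole)
    then have "tau ?y = tau (relabel flip_H pole)" by (rule tau_relabel_cong[OF level_symmetry_flip_H])
    then have "p = tau ?y" using 1 p by simp
    then show ?thesis by (intro bexI[of _ 0] bexI[of _ "sqrt 6"] bexI[of _ 1]) simp_all
  next
    case (2 s c d)
    obtain \<theta> r where "\<theta> \<in> {0..<2 * pi}" "r \<in> {0..sqrt 6}"
      "slice (vector [s * d, s * c, c, d]) = fibre_point \<theta> r (of_real s)"
      using slice_fibre_point[OF 2(1,2)] by blast
    moreover have "complex_of_real s \<in> {1, -1}" using 2(1) by auto
    ultimately show ?thesis using 2(3) p by metis
  qed
  then show "p \<in> {tau (fibre_point \<theta> r s) | \<theta> r s. \<theta> \<in> {0..<2 * pi} \<and> r \<in> {0..sqrt 6} \<and> s \<in> {1, -1}}"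
    by blast
next
  fix p assume "p \<in> {tau (fibre_point \<theta> r s) | \<theta> r s. \<theta> \<in> {0..<2 * pi} \<and> r \<in> {0..sqrt 6} \<and> s \<in> {1, -1}}"
  then obtain \<theta> r s where p: "p = tau (fibre_point \<theta> r s)" and r: "r \<in> {0..sqrt 6}" and s: "s \<in> {1, -1}"
    by blast
  have "(cmod (fibre_point \<theta> r s $ 1))\<^sup>2 = 2" by (simp add: fibre_point_def)
  then show "p \<in> fibre (F_sys \<gamma> (1 / 2)) (1, 0)"
    using fibre_point_level[OF r s] fibre_point_X[OF s] unfolding fibre_iff[OF assms] p by auto
qed

theorem proposition1p3:
  fixes \<gamma> :: real
  assumes "0 < \<gamma>" and "\<gamma> < 1 / 48"
  shows "card (focus_focus_fibres (F_sys \<gamma> (1 / 2))) = 2 \<and>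
    (\<forall>S \<in> focus_focus_fibres (F_sys \<gamma> (1 / 2)).
       \<exists>p q. p \<noteq> q \<and> {x \<in> S. focus_focus (F_sys \<gamma> (1 / 2)) x} = {p, q} \<and>
             double_pinched_torus p q S) \<and>
    fibre (F_sys \<gamma> (1 / 2)) (1, 0) =
      {tau (vector [complex_of_real (sqrt 2),
                    complex_of_real (sqrt (6 - r\<^sup>2)),
                    complex_of_real (sqrt (6 - r\<^sup>2)),
                    complex_of_real (sqrt (8 - r\<^sup>2)),
                    2,
                    complex_of_real (sqrt (2 + r\<^sup>2)),
                    s * complex_of_real r * \<i> * exp (- (\<i> * complex_of_real \<theta>)),
                    complex_of_real r * exp (\<i> * complex_of_real \<theta>)])
       | (\<theta>::real) (r::real) (s::complex).
         \<theta> \<in> {0..<2 * pi} \<and> r \<in> {0..sqrt 6} \<and> s \<in> {1, -1}}"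
proof (intro conjI)
  let ?F = "F_sys \<gamma> (1 / 2)"
  let ?p = "tau pole" and ?q = "tau (relabel flip_H pole)"
  let ?p' = "tau (relabel flip_J pole)" and ?q' = "tau (relabel flip_J (relabel flip_H pole))"
  have \<gamma>: "\<gamma> \<noteq> 0" using assms by simp
  have level: "relabel flip_H pole \<in> level_W" "relabel flip_J pole \<in> level_W"
    "relabel flip_J (relabel flip_H pole) \<in> level_W"
    by (intro relabel_level_W[OF level_symmetry_flip_J] relabel_level_W[OF level_symmetry_flip_H] pole_level)+
  have in1: "?p \<in> fibre ?F (1, 0)" "?q \<in> fibre ?F (1, 0)"
    unfolding fibre_iff[OF \<gamma>] using pole_values pole_level level X_poly_pole by auto
  have image: "?p' = relabel flip_J ` ?p" "?q' = relabel flip_J ` ?q"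
    by (rule tau_relabel[OF level_symmetry_flip_J])+
  have in2: "?p' \<in> fibre ?F (2, 0)" "?q' \<in> fibre ?F (2, 0)"
    unfolding fibre_flip_J[OF \<gamma>] image using in1 by blast+
  have ne: "?p' \<notin> fibre ?F (1, 0)" "?q' \<notin> fibre ?F (1, 0)"
    "?p \<notin> fibre ?F (2, 0)" "?q \<notin> fibre ?F (2, 0)"
    using in1 in2 by (simp_all add: fibre_def)
  have same: "c = d" if "p \<in> fibre ?F c" "p \<in> fibre ?F d" for p c d
    using that by (simp add: fibre_def)
  have fibres: "focus_focus_fibres ?F = {fibre ?F (1, 0), fibre ?F (2, 0)}"
  proof (intro equalityI subsetI)
    fix S assume "S \<in> focus_focus_fibres ?F"
    then obtain c p where S: "S = fibre ?F c" and p: "p \<in> fibre ?F c" "focus_focus ?F p"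
      unfolding focus_focus_fibres_def by blast
    from p(2) have "p \<in> fibre ?F (1, 0) \<or> p \<in> fibre ?F (2, 0)"
      unfolding focus_focus_iff[OF \<gamma>] using in1 in2 by blast
    then show "S \<in> {fibre ?F (1, 0), fibre ?F (2, 0)}"
      using same[OF p(1)] S by blast
  next
    have "focus_focus ?F ?p" "focus_focus ?F ?p'" unfolding focus_focus_iff[OF \<gamma>] by simp_all
    then show "S \<in> focus_focus_fibres ?F" if "S \<in> {fibre ?F (1, 0), fibre ?F (2, 0)}" for S
      using that in1(1) in2(1) unfolding focus_focus_fibres_def by blast
  qed
  show "card (focus_focus_fibres ?F) = 2" using ne(1) in2(1) by (auto simp: fibres card_2_iff)
  have points1: "{x \<in> fibre ?F (1, 0). focus_focus ?F x} = {?p, ?q}"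
    unfolding focus_focus_iff[OF \<gamma>] using in1 ne by blast
  have points2: "{x \<in> fibre ?F (2, 0). focus_focus ?F x} = {?p', ?q'}"
    unfolding focus_focus_iff[OF \<gamma>] using in2 ne by blast
  have torus1: "double_pinched_torus ?p ?q (fibre ?F (1, 0))"
    by (rule double_pinched_fibre[OF \<gamma>])
  have torus2: "double_pinched_torus ?p' ?q' (fibre ?F (2, 0))"
    unfolding fibre_flip_J[OF \<gamma>] image
    by (rule double_pinched_torus_relabel[OF level_symmetry_flip_J torus1])
  show "\<forall>S \<in> focus_focus_fibres ?F. \<exists>p q. p \<noteq> q \<and> {x \<in> S. focus_focus ?F x} = {p, q} \<and>
      double_pinched_torus p q S"
  proof
    fix S assume "S \<in> focus_focus_fibres ?F"
    then consider "S = fibre ?F (1, 0)" | "S = fibre ?F (2, 0)" unfolding fibres by blast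
    then show "\<exists>p q. p \<noteq> q \<and> {x \<in> S. focus_focus ?F x} = {p, q} \<and> double_pinched_torus p q S"
    proof cases
      case 1
      show ?thesis unfolding 1
        by (rule exI[of _ ?p], rule exI[of _ ?q])
          (use points1 torus1 in \<open>simp add: double_pinched_torus_def\<close>)
    next
      case 2
      show ?thesis unfolding 2
        by (rule exI[of _ ?p'], rule exI[of _ ?q'])
          (use points2 torus2 in \<open>simp add: double_pinched_torus_def\<close>)
    qed
  qed
qed (rule fibre_parametrisation[unfolded fibre_point_def], use assms in simp)

end
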